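(* Let $m\ge1$, let $K$ be a field of characteristic different from $2$, let $a_1,\dots,a_m\in K$, and put $a_0=0$, $a_{-s}=-a_s$ for $1\le s\le m$, and $a_s=0$ for $|s|>m$. (1) Fix $n\ge m$ and let $A_n=(a_{j-i})_{i,j=1}^n$. For $0\le j\le m$ and $j$-subsets $A,B\subseteq\{1,\dots,m\}$ let $M^{(n,j)}_{A,B}=\det A_n[A^c,B^c]$. Then $$M^{(n,j)}_{B,A}=(-1)^{n-j}M^{(n,j)}_{A,B}.$$ Hence the span of the level-$j$ coordinates $M^{(n,j)}_{A,B}$ has dimension at most $$K^{(n)}_{m,j}=\frac12\left(\binom mj^2+(-1)^{n-j}\binom mj\right),$$ and $$\sum_{j=0}^mK^{(n)}_{m,j}=\frac12\binom{2m}m.$$ (2) Assume in addition that $a_m\ne0$ and that $q(z)=z^m\sum_{s=-m}^ma_sz^s$ has $2m$ distinct roots in an algebraic closure $\overline K$, and write $$q(z)=a_m(z^2-1)\prod_{i=1}^{m-1}(z-x_i)(z-x_i^{-1}).$$ Let $V=\overline K^{\,2m}$, let $C_q$ be the companion matrix of $q(z)/a_m$, and let $T=(-1)^ma_m\bigwedge^mC_q$ on $\bigwedge^mV$. Then the middle exterior space has the Hodge decomposition $$\textstyle\bigwedge^mV=H_+\oplus H_-,\qquad \dim H_+=\dim H_-=\frac12\binom{2m}m.$$ The transfer $T$ exchanges $H_+$ and $H_-$, while $T^2$ preserves each of them. On either half, $T^2$ has eigenvalues $$\mu_\varepsilon=a_m^2x_1^{2\varepsilon_1}\cdots x_{m-1}^{2\varepsilon_{m-1}},\qquad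 \varepsilon\in\{-1,0,1\}^{m-1}.$$ If $s=|\{i:\varepsilon_i\ne0\}|$ and $h=m-1-s$, then the multiplicity of $\mu_\varepsilon$ in either Hodge half is $$\binom h{\lfloor h/2\rfloor}.$$ (3) Consequently, $T^2$ restricted to either Hodge half has minimal polynomial of degree at most $3^{m-1}$, and generically exactly $3^{m-1}$; and $T$ is annihilated by a polynomial of degree at most $2\cdot3^{m-1}$, which is generically the degree of its minimal polynomial.
   Context: $A_n[A^c,B^c]$ is the submatrix of $A_n$ obtained by deleting the rows in $A$ and the columns in $B$; the span in (1) is the linear span of the minors regarded as polynomial functions of the parameters $a_1,\dots,a_m$. Hodge decomposition: on $V$ choose a nondegenerate symmetric bilinear form $\beta$ preserved by $C_q$ (pairing the eigenlines of $x_i$ and $x_i^{-1}$, with the eigenlines of $1$ and $-1$ self-paired). Extend $\beta$ to $\bigwedge^\bullet V$, choose $\mathrm{vol}\in\bigwedge^{2m}V$ with $\beta(\mathrm{vol},\mathrm{vol})=1$, and let $*:\bigwedge^mV\to\bigwedge^mV$ be defined by $\alpha\wedge*\gamma=\beta(\alpha,\gamma)\,\mathrm{vol}$. Then $*^2=(-1)^m$, and $H_\pm$ are the two eigenspaces of $*$ (eigenvalues $\pm\mathrm i^m$, where $\mathrm i^2=-1$). When the values $\mu_\varepsilon$ are not distinct for different $\varepsilon$, "multiplicity of $\mu_\varepsilon$" means the multiplicity contributed by the ternary weight $\varepsilon$, i.e. the dimension in that half of the span of wedges of eigenvectors of $C_q$ having squared weight $\varepsilon$ (counting $\varepsilon_i=\pm1$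 when exactly the eigenvector of $x_i^{\pm1}$ is selected from the $i$-th reciprocal pair and $\varepsilon_i=0$ when both or neither are). "Generically" means on a nonempty Zariski-open subset of the space of parameters $(a_1,\dots,a_m)\in\overline K^{\,m}$. *)

theory Defs
  imports
    "HOL-Library.Function_Algebras"
    "HOL-Library.FuncSet"
    "HOL-Algebra.Algebraic_Closure_Type"
    "Jordan_Normal_Form.Char_Poly"
    "Jordan_Normal_Form.DL_Submatrix"
begin

subsection \<open>Spaces of functions as vector spaces\<close>

definition scale_fun :: "'a \<Rightarrow> ('i \<Rightarrow> 'a) \<Rightarrow> ('i \<Rightarrow> 'a::field)"
  where "scale_fun c f = (\<lambda>x. c * f x)"

lemma vector_space_scale_fun: "vector_space (scale_fun :: 'a::field \<Rightarrow> ('i \<Rightarrow> 'a) \<Rightarrow> _)"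
  by unfold_locales (auto simp: scale_fun_def fun_eq_iff algebra_simps)

abbreviation fun_span :: "('i \<Rightarrow> 'a::field) set \<Rightarrow> ('i \<Rightarrow> 'a) set"
  where "fun_span \<equiv> Modules.module.span scale_fun"

abbreviation fun_subspace :: "('i \<Rightarrow> 'a::field) set \<Rightarrow> bool"
  where "fun_subspace \<equiv> Modules.module.subspace scale_fun"

abbreviation fun_dim :: "('i \<Rightarrow> 'a::field) set \<Rightarrow> nat"
  where "fun_dim \<equiv> vector_space.dim scale_fun"

definition is_direct_sum ::
    "('i \<Rightarrow> 'a::field) set \<Rightarrow> ('i \<Rightarrow> 'a) set \<Rightarrow> ('i \<Rightarrow> 'a) set \<Rightarrow> bool"
  where "is_direct_sum W U1 U2 \<longleftrightarrow>
    fun_subspace U1 \<and> fun_subspace U2 \<and> U1 \<inter> U2 = {0} \<and> W = {u + v | u v. u \<in> U1 \<and> v \<in> U2}"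

definition annihilates_on ::
    "'a::field poly \<Rightarrow> (('i \<Rightarrow> 'a) \<Rightarrow> ('i \<Rightarrow> 'a)) \<Rightarrow> ('i \<Rightarrow> 'a) set \<Rightarrow> bool"
  where "annihilates_on p f W \<longleftrightarrow>
    (\<forall>w\<in>W. (\<Sum>k\<le>degree p. scale_fun (coeff p k) ((f ^^ k) w)) = 0)"

definition is_min_poly_on ::
    "'a::field poly \<Rightarrow> (('i \<Rightarrow> 'a) \<Rightarrow> ('i \<Rightarrow> 'a)) \<Rightarrow> ('i \<Rightarrow> 'a) set \<Rightarrow> bool"
  where "is_min_poly_on p f W \<longleftrightarrow>
    monic p \<and> annihilates_on p f W \<and> (\<forall>q. annihilates_on q f W \<longrightarrow> p dvd q)"


subsection \<open>Skew-symmetric banded Toeplitz matrices and their minors\<close>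

text \<open>Parameters \<open>(a\<^sub>1, \<dots>, a\<^sub>m)\<close> are given by a function \<open>a :: nat \<Rightarrow> 'a\<close>, of which only the
  values at \<open>1, \<dots>, m\<close> are ever used.\<close>

definition skew_ext :: "nat \<Rightarrow> (nat \<Rightarrow> 'a::field) \<Rightarrow> int \<Rightarrow> 'a"
  where "skew_ext m a s =
    (if 1 \<le> s \<and> s \<le> int m then a (nat s)
     else if 1 \<le> - s \<and> - s \<le> int m then - a (nat (- s))
     else 0)"

definition toeplitz :: "nat \<Rightarrow> (nat \<Rightarrow> 'a::field) \<Rightarrow> nat \<Rightarrow> 'a mat"
  where "toeplitz m a n = mat n n (\<lambda>(i, j). skew_ext m a (int j - int i))"

text \<open>Rows and columns of \<^typ>\<open>'a mat\<close> are numbered from 0, whereas \<open>A\<close> and \<open>B\<close> consist of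
  indices numbered from 1.\<close>

definition toeplitz_minor ::
    "nat \<Rightarrow> nat \<Rightarrow> nat set \<Rightarrow> nat set \<Rightarrow> (nat \<Rightarrow> 'a::field) \<Rightarrow> 'a"
  where "toeplitz_minor m n A B a =
    det (submatrix (toeplitz m a n) {i. Suc i \<notin> A} {j. Suc j \<notin> B})"

definition level_minors :: "nat \<Rightarrow> nat \<Rightarrow> nat \<Rightarrow> ((nat \<Rightarrow> 'a::field) \<Rightarrow> 'a) set"
  where "level_minors m n j =
    {toeplitz_minor m n A B | A B. A \<subseteq> {1..m} \<and> B \<subseteq> {1..m} \<and> card A = j \<and> card B = j}"

definition level_bound :: "nat \<Rightarrow> nat \<Rightarrow> nat \<Rightarrow> real"
  where "level_bound m n j =
    1/2 * (real (m choose j) ^ 2 + (-1) ^ (n - j) * real (m choose j))"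


subsection \<open>The symbol polynomial and its companion matrix\<close>

definition symbol_poly :: "nat \<Rightarrow> (nat \<Rightarrow> 'a::field) \<Rightarrow> 'a poly"
  where "symbol_poly m a = (\<Sum>s = - int m..int m. monom (skew_ext m a s) (nat (int m + s)))"

text \<open>Over an algebraically closed field: \<open>a\<^sub>m \<noteq> 0\<close> and \<open>q\<close> has \<open>2m\<close> distinct roots.\<close>

definition admissible :: "nat \<Rightarrow> (nat \<Rightarrow> 'a::alg_closed_field) \<Rightarrow> bool"
  where "admissible m a \<longleftrightarrow> a m \<noteq> 0 \<and> card {z. poly (symbol_poly m a) z = 0} = 2 * m"

definition root_pairs :: "nat \<Rightarrow> (nat \<Rightarrow> 'a::field) \<Rightarrow> (nat \<Rightarrow> 'a) \<Rightarrow> bool"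
  where "root_pairs m a x \<longleftrightarrow> (\<forall>i\<in>{1..<m}. x i \<noteq> 0) \<and>
    symbol_poly m a =
      smult (a m) ([:-1, 0, 1:] * (\<Prod>i=1..<m. [:- x i, 1:] * [:- inverse (x i), 1:]))"

definition companion :: "'a::field poly \<Rightarrow> 'a mat"
  where "companion p = mat (degree p) (degree p)
    (\<lambda>(i, j). if Suc j = degree p then - coeff p i else if i = Suc j then 1 else 0)"

definition companion_q :: "nat \<Rightarrow> (nat \<Rightarrow> 'a::field) \<Rightarrow> 'a mat"
  where "companion_q m a = companion (smult (inverse (a m)) (symbol_poly m a))"


subsection \<open>The exterior algebra of a coordinate space\<close>

text \<open>The exterior algebra of \<open>F\<^sup>N\<close> is modelled in coordinates: \<open>\<omega> I\<close> is the coefficient of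
  \<open>e\<^bsub>i1\<^esub> \<and> \<dots> \<and> e\<^bsub>ik\<^esub>\<close>, where \<open>I = {i1 < \<dots> < ik} \<subseteq> {0, \<dots>, N - 1}\<close>.\<close>

definition ext_power :: "nat \<Rightarrow> nat \<Rightarrow> (nat set \<Rightarrow> 'a::field) set"
  where "ext_power N k = {\<omega>. \<forall>I. \<omega> I \<noteq> 0 \<longrightarrow> I \<subseteq> {..<N} \<and> card I = k}"

definition ext_basis :: "nat set \<Rightarrow> nat set \<Rightarrow> 'a::field"
  where "ext_basis I = (\<lambda>J. if J = I then 1 else 0)"

definition wedge :: "(nat set \<Rightarrow> 'a::field) \<Rightarrow> (nat set \<Rightarrow> 'a) \<Rightarrow> nat set \<Rightarrow> 'a"
  where "wedge \<alpha> \<gamma> = (\<lambda>L. \<Sum>I\<in>Pow L.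
    (-1) ^ card {(i, j). i \<in> I \<and> j \<in> L - I \<and> j < i} * \<alpha> I * \<gamma> (L - I))"

definition ext_of_vec :: "'a::field vec \<Rightarrow> nat set \<Rightarrow> 'a"
  where "ext_of_vec v = (\<Sum>i<dim_vec v. scale_fun (v $ i) (ext_basis {i}))"

definition wedge_list :: "'a::field vec list \<Rightarrow> nat set \<Rightarrow> 'a"
  where "wedge_list vs = foldr (\<lambda>v \<omega>. wedge (ext_of_vec v) \<omega>) vs (ext_basis {})"

text \<open>The algebra endomorphism \<open>\<And>C\<close>, i.e. the linear map with
  \<open>e\<^bsub>i1\<^esub> \<and> \<dots> \<and> e\<^bsub>ik\<^esub> \<mapsto> C e\<^bsub>i1\<^esub> \<and> \<dots> \<and> C e\<^bsub>ik\<^esub>\<close>.\<close>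

definition ext_map :: "'a::field mat \<Rightarrow> (nat set \<Rightarrow> 'a) \<Rightarrow> nat set \<Rightarrow> 'a"
  where "ext_map C \<omega> = (\<Sum>I\<in>Pow {..<dim_col C}.
    scale_fun (\<omega> I) (wedge_list (map (col C) (sorted_list_of_set I))))"

definition transfer :: "nat \<Rightarrow> (nat \<Rightarrow> 'a::field) \<Rightarrow> (nat set \<Rightarrow> 'a) \<Rightarrow> nat set \<Rightarrow> 'a"
  where "transfer m a \<omega> = scale_fun ((-1) ^ m * a m) (ext_map (companion_q m a) \<omega>)"


subsection \<open>The invariant form and the Hodge star\<close>

text \<open>A bilinear form on \<open>F\<^sup>N\<close> is given by its Gram matrix \<open>G\<close>.\<close>

definition bform :: "'a::field mat \<Rightarrow> 'a vec \<Rightarrow> 'a vec \<Rightarrow> 'a"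
  where "bform G u v = u \<bullet> (G *\<^sub>v v)"

text \<open>The extension to the exterior algebra satisfies
  \<open>\<beta> (u\<^sub>1 \<and> \<dots> \<and> u\<^sub>k) (v\<^sub>1 \<and> \<dots> \<and> v\<^sub>k) = det (\<beta> u\<^sub>i v\<^sub>j)\<close>, different degrees being orthogonal.\<close>

definition ext_bform :: "'a::field mat \<Rightarrow> (nat set \<Rightarrow> 'a) \<Rightarrow> (nat set \<Rightarrow> 'a) \<Rightarrow> 'a"
  where "ext_bform G \<alpha> \<gamma> =
    (\<Sum>I\<in>Pow {..<dim_row G}. \<Sum>J\<in>{J \<in> Pow {..<dim_row G}. card J = card I}.
       \<alpha> I * \<gamma> J * det (submatrix G I J))"

text \<open>The last clause says that the form pairs the eigenlines of \<open>l\<close> and \<open>inverse l\<close> (so that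
  those of \<open>1\<close> and \<open>-1\<close> are self-paired), all other pairs of eigenlines being orthogonal.\<close>

definition invariant_form :: "'a::field mat \<Rightarrow> 'a mat \<Rightarrow> bool"
  where "invariant_form C G \<longleftrightarrow>
    G \<in> carrier_mat (dim_row C) (dim_row C) \<and>
    (\<forall>u\<in>carrier_vec (dim_row C). \<forall>v\<in>carrier_vec (dim_row C). bform G u v = bform G v u) \<and>
    (\<forall>u\<in>carrier_vec (dim_row C).
       (\<forall>v\<in>carrier_vec (dim_row C). bform G u v = 0) \<longrightarrow> u = 0\<^sub>v (dim_row C)) \<and>
    (\<forall>u\<in>carrier_vec (dim_row C). \<forall>v\<in>carrier_vec (dim_row C).
       bform G (C *\<^sub>v u) (C *\<^sub>v v) = bform G u v) \<and>
    (\<forall>u v l l'. eigenvector C u l \<and> eigenvector C v l' \<longrightarrow> (bform G u v \<noteq> 0 \<longleftrightarrow> l * l' = 1))"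

definition hodge_data :: "nat \<Rightarrow> (nat \<Rightarrow> 'a::field) \<Rightarrow> 'a mat \<Rightarrow> (nat set \<Rightarrow> 'a) \<Rightarrow> bool"
  where "hodge_data m a G vol \<longleftrightarrow>
    invariant_form (companion_q m a) G \<and> vol \<in> ext_power (2*m) (2*m) \<and> ext_bform G vol vol = 1"

definition is_hodge_dual ::
    "nat \<Rightarrow> 'a::field mat \<Rightarrow> (nat set \<Rightarrow> 'a) \<Rightarrow> (nat set \<Rightarrow> 'a) \<Rightarrow> (nat set \<Rightarrow> 'a) \<Rightarrow> bool"
  where "is_hodge_dual m G vol \<gamma> \<delta> \<longleftrightarrow> \<delta> \<in> ext_power (2*m) m \<and>
    (\<forall>\<alpha>\<in>ext_power (2*m) m. wedge \<alpha> \<delta> = scale_fun (ext_bform G \<alpha> \<gamma>) vol)"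

definition hodge_star ::
    "nat \<Rightarrow> 'a::field mat \<Rightarrow> (nat set \<Rightarrow> 'a) \<Rightarrow> (nat set \<Rightarrow> 'a) \<Rightarrow> nat set \<Rightarrow> 'a"
  where "hodge_star m G vol \<gamma> = (THE \<delta>. is_hodge_dual m G vol \<gamma> \<delta>)"

definition hodge_eigenspace ::
    "nat \<Rightarrow> 'a::field mat \<Rightarrow> (nat set \<Rightarrow> 'a) \<Rightarrow> 'a \<Rightarrow> (nat set \<Rightarrow> 'a) set"
  where "hodge_eigenspace m G vol c =
    {\<omega> \<in> ext_power (2*m) m. hodge_star m G vol \<omega> = scale_fun c \<omega>}"


subsection \<open>Ternary weights\<close>

definition ternary_weights :: "nat \<Rightarrow> (nat \<Rightarrow> int) set"
  where "ternary_weights m = {1..<m} \<rightarrow>\<^sub>E {-1, 0, 1}"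

definition weight_value :: "nat \<Rightarrow> (nat \<Rightarrow> 'a::field) \<Rightarrow> (nat \<Rightarrow> 'a) \<Rightarrow> (nat \<Rightarrow> int) \<Rightarrow> 'a"
  where "weight_value m a x \<epsilon> = a m ^ 2 * (\<Prod>i=1..<m. x i powi (2 * \<epsilon> i))"

text \<open>\<open>T\<^sup>2\<close> multiplies the wedge of the eigenvectors with eigenvalue set \<open>S\<close> by
  \<open>a\<^sub>m\<^sup>2\<close> times the product of the \<open>l\<^sup>2\<close> for \<open>l \<in> S\<close>; a pair \<open>x\<^sub>i, x\<^sub>i\<^sup>-\<^sup>1\<close> contained in \<open>S\<close> cancels,
  as do the roots \<open>1\<close> and \<open>-1\<close>, which do not enter the weight of \<open>S\<close>.\<close>

definition squared_weight :: "nat \<Rightarrow> (nat \<Rightarrow> 'a::field) \<Rightarrow> 'a set \<Rightarrow> nat \<Rightarrow> int"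
  where "squared_weight m x S = (\<lambda>i\<in>{1..<m}.
    if x i \<in> S \<and> inverse (x i) \<notin> S then 1
    else if x i \<notin> S \<and> inverse (x i) \<in> S then -1
    else 0)"

definition weight_space ::
    "nat \<Rightarrow> (nat \<Rightarrow> 'a::field) \<Rightarrow> (nat \<Rightarrow> 'a) \<Rightarrow> (nat \<Rightarrow> int) \<Rightarrow> (nat set \<Rightarrow> 'a) set"
  where "weight_space m a x \<epsilon> = fun_span
    {wedge_list vs | vs ls. length ls = m \<and> distinct ls \<and>
       list_all2 (eigenvector (companion_q m a)) vs ls \<and> squared_weight m x (set ls) = \<epsilon>}"

definition weight_mult :: "nat \<Rightarrow> (nat \<Rightarrow> int) \<Rightarrow> nat"
  where "weight_mult m \<epsilon> =
    (let s = card {i\<in>{1..<m}. \<epsilon> i \<noteq> 0}; h = m - 1 - s in h choose (h div 2))"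


subsection \<open>Zariski-open sets of parameters\<close>

inductive_set poly_funs :: "nat \<Rightarrow> ((nat \<Rightarrow> 'a::field) \<Rightarrow> 'a) set" for m :: nat
  where
    const: "(\<lambda>b. c) \<in> poly_funs m"
  | coord: "i \<in> {1..m} \<Longrightarrow> (\<lambda>b. b i) \<in> poly_funs m"
  | add: "f \<in> poly_funs m \<Longrightarrow> g \<in> poly_funs m \<Longrightarrow> (\<lambda>b. f b + g b) \<in> poly_funs m"
  | mult: "f \<in> poly_funs m \<Longrightarrow> g \<in> poly_funs m \<Longrightarrow> (\<lambda>b. f b * g b) \<in> poly_funs m"

text \<open>Only the coordinates \<open>b\<^sub>1, \<dots>, b\<^sub>m\<close> matter for membership in such a set, so these are the Zariski-open
  subsets of affine \<open>m\<close>-space, pulled back along \<open>b \<mapsto> (b\<^sub>1, \<dots>, b\<^sub>m)\<close>.\<close>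

definition zariski_open :: "nat \<Rightarrow> (nat \<Rightarrow> 'a::field) set \<Rightarrow> bool"
  where "zariski_open m U \<longleftrightarrow> (\<exists>P \<subseteq> poly_funs m. U = {b. \<exists>f\<in>P. f b \<noteq> 0})"

end

theory Submission
  imports Defs
begin

text \<open>Over the algebraic closure the companion matrix \<open>C\<close> is diagonalised by the inverse of the
  Vandermonde matrix of its roots, hence \<open>\<And>C\<close> by the wedges \<open>e\<^sub>S\<close> of eigenvectors, \<open>S\<close> being a set
  of roots. The invariant form pairs each root with its inverse, so the Hodge star maps \<open>e\<^sub>S\<close> to a
  multiple of \<open>e\<^sub>R\<close>, where \<open>R\<close> is the complement of the set of inverses of \<open>S\<close>. The product of all
  roots is \<open>-1\<close>, so the eigenvalues of \<open>T\<close> at \<open>S\<close> and \<open>R\<close> are opposite: \<open>T\<close> anticommutes with the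
  star. The root \<open>1\<close> is its own inverse and therefore lies in exactly one of \<open>S\<close> and \<open>R\<close>, so each
  Hodge half has a basis indexed by the \<open>S\<close> containing \<open>1\<close>, and the multiplicities count such \<open>S\<close>
  of a given weight. Minimal polynomials are read off the eigenvalues. Distinctness of the weights is
  an open condition, since it means that \<open>T\<^sup>2\<close> has no annihilating polynomial of small degree, which
  is the nonvanishing of a Krylov determinant for a suitable fixed vector and suitable functionals.\<close>

text \<open>The roots are not rational functions of the parameters, so distinctness of the weights
  cannot be tested through the \<open>x i\<close>. Only \<open>T\<close> itself is polynomial in the
  parameters, up to powers of \<open>a m\<close> in the denominator that come from the companion
  matrix. The data of the Krylov determinant are therefore frozen at one parameter point, where it
  becomes a Vandermonde determinant in the weights. Such a point arises by choosing the roots one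
  after the other, each outside a finite set of coincidences. Admissibility is tested likewise, by a
  Sylvester determinant, and the open set is where both determinants and \<open>a m\<close> are
  nonzero.

  The signs of the star on wedges of eigenvectors are never worked out. With \<open>star0\<close>
  the star of the standard dot product, the single identity \<open>M star0 M^T = det M star0\<close>
  on the exterior algebra serves twice: for the change of basis it transports the star to the
  eigenbasis, and for the Gram matrix it gives the square of the star. That square ties the
  coefficient of the star at \<open>S\<close> to the one at \<open>R\<close>, which is all that the
  eigenspaces depend on.\<close>

interpretation fv: vector_space "scale_fun :: 'a::field \<Rightarrow> ('i \<Rightarrow> 'a) \<Rightarrow> _"
  by (rule vector_space_scale_fun)

interpretation fvp: vector_space_pair
  "scale_fun :: 'a::field \<Rightarrow> ('i \<Rightarrow> 'a) \<Rightarrow> _" "scale_fun :: 'a \<Rightarrow> ('j \<Rightarrow> 'a) \<Rightarrow> _"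
  by unfold_locales

section \<open>Linear maps between function spaces\<close>

abbreviation flinear :: "(('i \<Rightarrow> 'a::field) \<Rightarrow> ('j \<Rightarrow> 'a)) \<Rightarrow> bool"
  where "flinear \<equiv> Vector_Spaces.linear scale_fun scale_fun"

lemma scale_fun_apply [simp]: "scale_fun c f x = c * f x"
  by (simp add: scale_fun_def)

lemma sum_fun_eval: "(\<Sum>i\<in>A. f i) x = (\<Sum>i\<in>A. f i (x::'i) :: 'a::comm_monoid_add)"
  by (induction A rule: infinite_finite_induct) auto

lemma flinearI:
  assumes "\<And>u v. f (u + v) = f u + f v" "\<And>c u. f (scale_fun c u) = scale_fun c (f u)"
  shows "flinear f"
  by (simp add: Vector_Spaces.linear_iff assms vector_space_scale_fun)

lemma flinear_add: "flinear f \<Longrightarrow> f (u + v) = f u + f v"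
  by (rule fvp.linear_add)

lemma flinear_scale: "flinear f \<Longrightarrow> f (scale_fun c u) = scale_fun c (f u)"
  by (rule fvp.linear_scale)

lemma flinear_sum: "flinear f \<Longrightarrow> f (\<Sum>i\<in>A. g i) = (\<Sum>i\<in>A. f (g i))"
  by (rule fvp.linear_sum)

lemma flinear_0: "flinear f \<Longrightarrow> f 0 = 0"
  by (rule fvp.linear_0)

lemma flinear_lincomb:
  assumes "\<And>i. i \<in> A \<Longrightarrow> flinear (f i)"
  shows "flinear (\<lambda>u. \<Sum>i\<in>A. scale_fun (c i) (f i u))"
proof (rule flinearI)
  show "(\<Sum>i\<in>A. scale_fun (c i) (f i (u + v))) =
      (\<Sum>i\<in>A. scale_fun (c i) (f i u)) + (\<Sum>i\<in>A. scale_fun (c i) (f i v))" for u v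
    by (simp add: flinear_add[OF assms] sum.distrib fv.scale_right_distrib cong: sum.cong)
  show "(\<Sum>i\<in>A. scale_fun (c i) (f i (scale_fun k u))) =
      scale_fun k (\<Sum>i\<in>A. scale_fun (c i) (f i u))" for k u
    unfolding fv.scale_sum_right
    by (intro sum.cong) (auto simp: flinear_scale[OF assms] mult.left_commute fun_eq_iff)
qed

lemma sorted_list_of_set_insert_less:
  assumes "finite A" "\<And>a. a \<in> A \<Longrightarrow> b < a"
  shows "sorted_list_of_set (insert b A) = b # sorted_list_of_set A"
proof -
  have "b \<notin> A" using assms(2) by blast
  moreover have "Min (insert b A) = b"
    using assms by (intro Min_eqI) (auto intro: less_imp_le)
  ultimately show ?thesis
    using assms(1) by (simp add: sorted_list_of_set_nonempty)
qed


subsection \<open>Families of anticommuting operators\<close>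

text \<open>Both \<^const>\<open>wedge\<close> and \<^const>\<open>ext_map\<close> arise by letting basis monomials act through such a
  family, and multiplicativity of both follows from one reordering argument.\<close>

locale anticommuting =
  fixes Y :: "nat \<Rightarrow> ('i \<Rightarrow> 'a::field) \<Rightarrow> 'i \<Rightarrow> 'a"
  assumes linear: "flinear (Y i)"
    and anti: "Y i (Y j u) + Y j (Y i u) = 0"
    and sq: "Y i (Y i u) = 0"
begin

definition word :: "nat set \<Rightarrow> ('i \<Rightarrow> 'a) \<Rightarrow> 'i \<Rightarrow> 'a"
  where "word I u = foldr Y (sorted_list_of_set I) u"

lemma word_empty [simp]: "word {} u = u"
  by (simp add: word_def)

lemma word_insert_less:
  "finite A \<Longrightarrow> (\<And>a. a \<in> A \<Longrightarrow> b < a) \<Longrightarrow> word (insert b A) u = Y b (word A u)"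
  by (simp add: word_def sorted_list_of_set_insert_less del: sorted_list_of_set_insert_remove)

text \<open>\<open>Y i\<close> travels to its place in the increasing product: it passes the
  operators with index in \<open>{j\<in>I. j < i}\<close>, each at the cost of a sign, and gives
  zero when it meets itself. Peeling off the minimum of \<open>I\<close> makes this one
  transposition per induction step.\<close>

lemma op_word:
  assumes "finite I"
  shows "Y i (word I u) =
    (if i \<in> I then 0 else scale_fun ((-1) ^ card {j\<in>I. j < i}) (word (insert i I) u))"
  using assms
proof (induction I rule: finite_linorder_min_induct)
  case empty
  then show ?case using word_insert_less[of "{}" i u] by simp
next
  case (insert b A)
  have wb: "word (insert b A) u = Y b (word A u)"
    using insert by (intro word_insert_less) auto
  consider "i < b" | "i = b" | "b < i" by linarith
  then show ?case
  proof cases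
    case 1
    then have *: "i < a" if "a \<in> insert b A" for a
      using insert(2) that by auto
    then have e: "{j \<in> insert b A. j < i} = {}" by (metis (no_types, lifting) empty_Collect_eq less_asym)
    have n: "i \<notin> insert b A" using * by blast
    have "word (insert i (insert b A)) u = Y i (word (insert b A) u)"
      using * insert(1) by (intro word_insert_less) auto
    then show ?thesis unfolding e using n by simp
  next
    case 2
    then show ?thesis by (simp add: wb sq)
  next
    case 3
    have "Y i (word (insert b A) u) = - Y b (Y i (word A u))"
      using anti[of i b] by (simp add: wb eq_neg_iff_add_eq_0)
    also have "Y i (word A u) =
      (if i \<in> A then 0 else scale_fun ((-1) ^ card {j\<in>A. j < i}) (word (insert i A) u))"
      by (rule insert.IH)
    finally have *: "Y i (word (insert b A) u) = - Y b \<dots>" .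
    show ?thesis
    proof (cases "i \<in> A")
      case True
      then show ?thesis by (simp add: * flinear_0[OF linear])
    next
      case False
      have "{j \<in> insert b A. j < i} = insert b {j\<in>A. j < i}" using 3 by auto
      moreover have "b \<notin> A" using insert(2) by blast
      ultimately have c: "card {j \<in> insert b A. j < i} = Suc (card {j\<in>A. j < i})"
        using insert(1) by simp
      have "word (insert i (insert b A)) u = Y b (word (insert i A) u)"
        using insert 3 by (subst insert_commute, intro word_insert_less) auto
      then show ?thesis using False 3 unfolding * c
        by (simp add: flinear_scale[OF linear] fun_eq_iff)
    qed
  qed
qed

text \<open>Anticommuting operators of square zero make their space a module over the exterior
  algebra, by its universal property; this is the module action.\<close>

definition act :: "nat \<Rightarrow> (nat set \<Rightarrow> 'a) \<Rightarrow> ('i \<Rightarrow> 'a) \<Rightarrow> 'i \<Rightarrow> 'a"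
  where "act N \<omega> u = (\<Sum>I\<in>Pow {..<N}. scale_fun (\<omega> I) (word I u))"

lemma flinear_act: "flinear (\<lambda>\<omega>. act N \<omega> u)"
  by (intro flinearI) (simp_all add: act_def sum.distrib fv.scale_left_distrib fv.scale_sum_right)

end


subsection \<open>Exterior multiplication\<close>

text \<open>Left multiplication by the \<open>i\<close>-th basis vector. The guard
  \<open>finite J\<close> mirrors \<open>wedge\<close>, whose sum over an infinite
  \<open>Pow L\<close> is 0 by convention, so that the two agree at every index set.\<close>

definition lmul :: "nat \<Rightarrow> (nat set \<Rightarrow> 'a::field) \<Rightarrow> nat set \<Rightarrow> 'a"
  where "lmul i \<omega> =
    (\<lambda>J. if finite J \<and> i \<in> J then (-1) ^ card {j\<in>J. j < i} * \<omega> (J - {i}) else 0)"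

definition vmul :: "'a::field vec \<Rightarrow> (nat set \<Rightarrow> 'a) \<Rightarrow> nat set \<Rightarrow> 'a"
  where "vmul v \<omega> = (\<Sum>i<dim_vec v. scale_fun (v $ i) (lmul i \<omega>))"

lemma flinear_lmul: "flinear (lmul i)"
  by (intro flinearI) (auto simp: lmul_def fun_eq_iff algebra_simps)

lemma flinear_vmul: "flinear (vmul v)"
  unfolding vmul_def by (intro flinear_lincomb flinear_lmul)

lemma lmul_lmul: "lmul i (lmul i \<omega>) = 0"
  by (auto simp: lmul_def fun_eq_iff)

text \<open>Deleting the smaller index \<open>i\<close> from \<open>J\<close> lowers the rank of
  \<open>j\<close> by one, while deleting \<open>j\<close> leaves the rank of \<open>i\<close>
  alone. This one unit is the sign.\<close>

lemma lmul_anti_less: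
  assumes "i < j"
  shows "lmul i (lmul j \<omega>) + lmul j (lmul i \<omega>) = 0"
proof -
  have "lmul i (lmul j \<omega>) J + lmul j (lmul i \<omega>) J = 0" for J
  proof (cases "finite J \<and> i \<in> J \<and> j \<in> J")
    case True
    define k where "k = card ({a\<in>J. a < j} - {i})"
    have "{a \<in> J - {i}. a < j} = {a\<in>J. a < j} - {i}" by auto
    then have 1: "card {a \<in> J - {i}. a < j} = k" by (simp add: k_def)
    have 2: "{a \<in> J - {j}. a < i} = {a\<in>J. a < i}" using assms by auto
    have 3: "card {a\<in>J. a < j} = Suc k"
      unfolding k_def using True assms by (subst card_Suc_Diff1) auto
    have 4: "J - {i} - {j} = J - {j} - {i}" by auto
    have "lmul i (lmul j \<omega>) J = (-1) ^ card {a\<in>J. a < i} * ((-1) ^ k * \<omega> (J - {j} - {i}))"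
      unfolding lmul_def 1 4 using True assms by simp
    moreover have "lmul j (lmul i \<omega>) J = (-1) ^ Suc k * ((-1) ^ card {a\<in>J. a < i} * \<omega> (J - {j} - {i}))"
      unfolding lmul_def 2 3 using True assms by simp
    ultimately show ?thesis by simp
  next
    case False
    then show ?thesis
      by (cases "finite J"; cases "i \<in> J"; cases "j \<in> J") (simp_all add: lmul_def)
  qed
  then show ?thesis by (simp add: fun_eq_iff)
qed

lemma lmul_anti: "lmul i (lmul j \<omega>) + lmul j (lmul i \<omega>) = 0"
  using lmul_anti_less[of i j \<omega>] lmul_anti_less[of j i \<omega>] lmul_lmul[of i \<omega>]
  by (cases i j rule: linorder_cases) (auto simp: add.commute)

interpretation lm: anticommuting "lmul :: nat \<Rightarrow> (nat set \<Rightarrow> 'a::field) \<Rightarrow> _"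
  by (rule anticommuting.intro) (fact flinear_lmul lmul_anti lmul_lmul)+

lemma vmul_lmul_anti: "vmul v (lmul j \<omega>) + lmul j (vmul v \<omega>) = 0"
proof -
  have "vmul v (lmul j \<omega>) + lmul j (vmul v \<omega>) =
    (\<Sum>i<dim_vec v. scale_fun (v $ i) (lmul i (lmul j \<omega>) + lmul j (lmul i \<omega>)))"
    by (simp add: vmul_def flinear_sum[OF flinear_lmul] flinear_scale[OF flinear_lmul]
        fv.scale_right_distrib sum.distrib)
  then show ?thesis by (simp add: lmul_anti)
qed

lemma vmul_anti: "vmul u (vmul v \<omega>) + vmul v (vmul u \<omega>) = 0"
proof -
  have "vmul u (vmul v \<omega>) + vmul v (vmul u \<omega>) =
    (\<Sum>i<dim_vec u. scale_fun (u $ i) (lmul i (vmul v \<omega>) + vmul v (lmul i \<omega>)))"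
    by (simp add: vmul_def[of u] flinear_sum[OF flinear_vmul] flinear_scale[OF flinear_vmul]
        fv.scale_right_distrib sum.distrib)
  moreover have "lmul i (vmul v \<omega>) + vmul v (lmul i \<omega>) = 0" for i
    by (subst add.commute) (rule vmul_lmul_anti)
  ultimately show ?thesis by simp
qed

text \<open>In characteristic 2 the relation \<open>vmul_anti\<close> with equal vectors says
  nothing, so the square is expanded over the partial sums \<open>S n\<close>: mixed terms cancel by
  anticommutation and pure squares by \<open>lmul_lmul\<close>.\<close>

lemma vmul_vmul: "vmul v (vmul v \<omega>) = 0"
proof -
  define S where "S n \<omega> = (\<Sum>i<n. scale_fun (v $ i) (lmul i \<omega>))" for n and \<omega> :: "nat set \<Rightarrow> 'a"
  have lin: "flinear (S n)" for n
    unfolding S_def by (intro flinear_lincomb flinear_lmul)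
  have S_Suc: "S (Suc n) \<omega> = S n \<omega> + scale_fun (v $ n) (lmul n \<omega>)" for n \<omega>
    by (simp add: S_def)
  have anti: "S n (lmul j \<omega>) + lmul j (S n \<omega>) = 0" for n j \<omega>
  proof -
    have "S n (lmul j \<omega>) + lmul j (S n \<omega>) =
      (\<Sum>i<n. scale_fun (v $ i) (lmul i (lmul j \<omega>) + lmul j (lmul i \<omega>)))"
      by (simp add: S_def flinear_sum[OF flinear_lmul] flinear_scale[OF flinear_lmul]
          fv.scale_right_distrib sum.distrib)
    then show ?thesis by (simp add: lmul_anti)
  qed
  have "S n (S n \<omega>) = 0" for n
  proof (induction n)
    case 0
    then show ?case by (simp add: S_def)
  next
    case (Suc n)
    have "S (Suc n) (S (Suc n) \<omega>) =
      S n (S n \<omega>) + scale_fun (v $ n) (S n (lmul n \<omega>) + lmul n (S n \<omega>)) +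
      scale_fun (v $ n * v $ n) (lmul n (lmul n \<omega>))"
      by (simp add: S_Suc[of n] flinear_add[OF lin] flinear_scale[OF lin]
          flinear_add[OF flinear_lmul] flinear_scale[OF flinear_lmul] fv.scale_right_distrib
          algebra_simps)
    then show ?case by (simp add: Suc.IH anti lmul_lmul)
  qed
  then show ?thesis by (simp add: S_def vmul_def)
qed

lemma wedge_ext_basis_single: "wedge (ext_basis {i}) \<omega> = lmul i \<omega>"
proof
  fix L
  show "wedge (ext_basis {i}) \<omega> L = lmul i \<omega> L"
  proof (cases "finite L")
    case True
    have "wedge (ext_basis {i}) \<omega> L = (\<Sum>I\<in>Pow L. if I = {i} then
      (-1) ^ card {(i, j). i \<in> I \<and> j \<in> L - I \<and> j < i} * \<omega> (L - I) else 0)"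
      by (auto simp: wedge_def ext_basis_def intro!: sum.cong)
    also have "\<dots> = (if {i} \<in> Pow L then
      (-1) ^ card {(i', j). i' \<in> {i} \<and> j \<in> L - {i} \<and> j < i'} * \<omega> (L - {i}) else 0)"
      using True by (subst sum.delta) auto
    also have "{(i', j). i' \<in> {i} \<and> j \<in> L - {i} \<and> j < i'} = Pair i ` {j\<in>L. j < i}"
      by auto
    also have "card \<dots> = card {j\<in>L. j < i}"
      by (intro card_image) (auto simp: inj_on_def)
    finally show ?thesis using True by (simp add: lmul_def)
  qed (simp add: wedge_def lmul_def)
qed

lemma wedge_lincomb_left:
  "wedge (\<Sum>i\<in>A. scale_fun (c i) (\<alpha> i)) \<gamma> = (\<Sum>i\<in>A. scale_fun (c i) (wedge (\<alpha> i) \<gamma>))"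
proof -
  have "wedge (\<Sum>i\<in>A. scale_fun (c i) (\<alpha> i)) \<gamma> L = (\<Sum>i\<in>A. scale_fun (c i) (wedge (\<alpha> i) \<gamma>)) L" for L
    unfolding wedge_def sum_fun_eval scale_fun_apply sum_distrib_left sum_distrib_right
    by (subst sum.swap) (simp add: mult_ac)
  then show ?thesis by blast
qed

lemma wedge_ext_of_vec: "wedge (ext_of_vec v) \<omega> = vmul v \<omega>"
  by (simp add: ext_of_vec_def wedge_lincomb_left wedge_ext_basis_single vmul_def)

lemma wedge_list_conv: "wedge_list vs = foldr vmul vs (ext_basis {})"
  by (simp add: wedge_list_def wedge_ext_of_vec)

text \<open>The whole exterior algebra, all degrees together, so that products and induced maps can
  be handled without tracking degrees.\<close>

definition ext_space :: "nat \<Rightarrow> (nat set \<Rightarrow> 'a::field) set"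
  where "ext_space N = {\<omega>. \<forall>I. \<omega> I \<noteq> 0 \<longrightarrow> I \<subseteq> {..<N}}"

lemma ext_space_expand:
  assumes "\<omega> \<in> ext_space N"
  shows "\<omega> = (\<Sum>I\<in>Pow {..<N}. scale_fun (\<omega> I) (ext_basis I))"
proof
  fix J
  show "\<omega> J = (\<Sum>I\<in>Pow {..<N}. scale_fun (\<omega> I) (ext_basis I)) J"
    using assms unfolding sum_fun_eval scale_fun_apply ext_basis_def
    by (auto simp: ext_space_def if_distrib[of "(*) _"] cong: if_cong)
qed

lemma ext_basis_in_space: "I \<subseteq> {..<N} \<Longrightarrow> ext_basis I \<in> ext_space N"
  by (auto simp: ext_space_def ext_basis_def)

lemma subspace_ext_space: "fun_subspace (ext_space N)"
  unfolding fv.subspace_def ext_space_def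
  by (auto, metis add.right_neutral subsetD lessThan_iff)

lemma lmul_in_space: "\<omega> \<in> ext_space N \<Longrightarrow> i < N \<Longrightarrow> lmul i \<omega> \<in> ext_space N"
  by (fastforce simp: lmul_def ext_space_def split: if_splits)

lemma vmul_in_space: "\<omega> \<in> ext_space N \<Longrightarrow> dim_vec v \<le> N \<Longrightarrow> vmul v \<omega> \<in> ext_space N"
  unfolding vmul_def
  by (intro fv.subspace_sum[OF subspace_ext_space] fv.subspace_scale[OF subspace_ext_space]
      lmul_in_space) auto

lemma lmul_ext_basis_less:
  assumes "finite A" "\<And>a. a \<in> A \<Longrightarrow> b < a"
  shows "lmul b (ext_basis A) = ext_basis (insert b A)"
proof -
  have "b \<notin> A" using assms(2) by blast
  have e: "{j \<in> insert b A. j < b} = {}" using assms(2) by force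
  show ?thesis
  proof
    fix J
    show "lmul b (ext_basis A) J = ext_basis (insert b A) J"
    proof (cases "J = insert b A")
      case True
      show ?thesis unfolding True lmul_def e using assms(1) \<open>b \<notin> A\<close> by (simp add: ext_basis_def)
    next
      case False
      then have "\<not> (b \<in> J \<and> J - {b} = A)" by auto
      with False show ?thesis by (auto simp: lmul_def ext_basis_def)
    qed
  qed
qed

lemma lm_word_one: "finite I \<Longrightarrow> lm.word I (ext_basis {}) = ext_basis I"
  by (induction I rule: finite_linorder_min_induct)
     (simp_all add: lm.word_insert_less lmul_ext_basis_less)

text \<open>Adding a new minimum \<open>b\<close> to \<open>A\<close> splits the inversions counted
  by \<open>wedge\<close> into two kinds: the elements of \<open>L\<close> below \<open>b\<close>,
  which give the sign of \<open>lmul b\<close>, and the inversions of \<open>A\<close> inside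
  \<open>L - {b}\<close>, which belong to the induction hypothesis.\<close>

lemma wedge_ext_basis_left:
  assumes "finite I" "\<gamma> \<in> ext_space N"
  shows "wedge (ext_basis I) \<gamma> = lm.word I \<gamma>"
  using assms(1)
proof (induction I rule: finite_linorder_min_induct)
  case empty
  have "wedge (ext_basis {}) \<gamma> L = \<gamma> L" for L
  proof (cases "finite L")
    case True
    have "wedge (ext_basis {}) \<gamma> L = (\<Sum>I\<in>Pow L. if I = {} then \<gamma> L else 0)"
      by (auto simp: wedge_def ext_basis_def intro!: sum.cong)
    then show ?thesis using True by simp
  next
    \<comment> \<open>At infinite \<open>L\<close> the wedge is a sum over an infinite set, hence 0,
      and membership in \<open>ext_space N\<close> makes the other side vanish as well.\<close>
    case False
    then have "\<gamma> L = 0" using assms(2) finite_subset[of L "{..<N}"] by (auto simp: ext_space_def)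
    with False show ?thesis by (simp add: wedge_def)
  qed
  then show ?case by auto
next
  case (insert b A)
  have b: "b \<notin> A" using insert(2) by blast
  have ev: "wedge (ext_basis I) \<gamma> L = (if finite L \<and> I \<subseteq> L then
      (-1) ^ card {(i, j). i \<in> I \<and> j \<in> L - I \<and> j < i} * \<gamma> (L - I) else 0)"
    for I L
  proof (cases "finite L")
    case True
    have "wedge (ext_basis I) \<gamma> L = (\<Sum>I'\<in>Pow L. if I' = I then
      (-1) ^ card {(i, j). i \<in> I' \<and> j \<in> L - I' \<and> j < i} * \<gamma> (L - I') else 0)"
      by (auto simp: wedge_def ext_basis_def intro!: sum.cong)
    then show ?thesis using True by (simp add: sum.delta)
  qed (simp add: wedge_def)
  have "wedge (ext_basis (insert b A)) \<gamma> L = lmul b (wedge (ext_basis A) \<gamma>) L" for L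
  proof (cases "finite L \<and> insert b A \<subseteq> L")
    case True
    have d: "L - insert b A = L - {b} - A" by auto
    have AL: "A \<subseteq> L - {b}" using True b by auto
    have "{(i, j). i \<in> insert b A \<and> j \<in> L - insert b A \<and> j < i} =
      Pair b ` {j\<in>L. j < b} \<union> {(i, j). i \<in> A \<and> j \<in> L - {b} - A \<and> j < i}"
      using b insert(2) by fastforce
    moreover have "card (Pair b ` {j\<in>L. j < b}) = card {j\<in>L. j < b}"
      by (intro card_image) (auto simp: inj_on_def)
    moreover have "card (Pair b ` {j\<in>L. j < b} \<union> {(i, j). i \<in> A \<and> j \<in> L - {b} - A \<and> j < i}) =
      card (Pair b ` {j\<in>L. j < b}) + card {(i, j). i \<in> A \<and> j \<in> L - {b} - A \<and> j < i}"
      using b True by (intro card_Un_disjoint)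
        (auto intro: finite_subset[of _ "A \<times> L"] simp: insert(1))
    ultimately show ?thesis
      using True b AL by (simp add: ev lmul_def d power_add)
  next
    case False
    then show ?thesis using b by (auto simp: ev lmul_def)
  qed
  then show ?case using insert by (auto simp: lm.word_insert_less)
qed

lemma wedge_eq_act:
  assumes "\<alpha> \<in> ext_space N" "\<gamma> \<in> ext_space N"
  shows "wedge \<alpha> \<gamma> = lm.act N \<alpha> \<gamma>"
proof -
  have "wedge \<alpha> \<gamma> = (\<Sum>I\<in>Pow {..<N}. scale_fun (\<alpha> I) (wedge (ext_basis I) \<gamma>))"
    by (subst ext_space_expand[OF assms(1)]) (simp add: wedge_lincomb_left)
  also have "\<dots> = lm.act N \<alpha> \<gamma>"
    unfolding lm.act_def using assms(2)
    by (intro sum.cong) (auto simp: wedge_ext_basis_left finite_subset)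
  finally show ?thesis .
qed

context anticommuting
begin

text \<open>The sign that \<open>lmul\<close> puts on the coefficient at \<open>J\<close> is the
  sign that \<open>op_word\<close> produces when \<open>Y i\<close> is absorbed into the word of
  \<open>J - {i}\<close>. Reindexing by \<open>J = insert i I\<close> therefore matches the two sums
  term by term.\<close>

lemma act_lmul:
  assumes "i < N"
  shows "act N (lmul i \<omega>) u = Y i (act N \<omega> u)"
proof -
  have "act N (lmul i \<omega>) u = (\<Sum>J\<in>{J\<in>Pow {..<N}. i \<in> J}. scale_fun (lmul i \<omega> J) (word J u))"
    unfolding act_def by (intro sum.mono_neutral_right) (auto simp: lmul_def)
  also have "\<dots> = (\<Sum>I\<in>{I\<in>Pow {..<N}. i \<notin> I}. scale_fun (\<omega> I) (Y i (word I u)))"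
  proof (intro sum.reindex_bij_witness[of _ "insert i" "\<lambda>J. J - {i}"])
    fix J assume J: "J \<in> {J\<in>Pow {..<N}. i \<in> J}"
    then have f: "finite J" by (auto simp: finite_subset)
    have "Y i (word (J - {i}) u) = scale_fun ((-1) ^ card {j\<in>J - {i}. j < i}) (word J u)"
      using J f by (subst op_word) (auto simp: insert_absorb)
    moreover have "{j\<in>J - {i}. j < i} = {j\<in>J. j < i}" by auto
    ultimately show "scale_fun (\<omega> (J - {i})) (Y i (word (J - {i}) u)) =
        scale_fun (lmul i \<omega> J) (word J u)"
      using J f by (simp add: lmul_def fun_eq_iff)
  qed (use assms in auto)
  also have "\<dots> = (\<Sum>I\<in>Pow {..<N}. scale_fun (\<omega> I) (Y i (word I u)))"
    by (intro sum.mono_neutral_left) (auto simp: op_word finite_subset)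
  also have "\<dots> = Y i (act N \<omega> u)"
    by (simp add: act_def flinear_sum[OF linear] flinear_scale[OF linear])
  finally show ?thesis .
qed

lemma act_vmul:
  assumes "dim_vec v \<le> N"
  shows "act N (vmul v \<omega>) u = (\<Sum>i<dim_vec v. scale_fun (v $ i) (Y i (act N \<omega> u)))"
  using assms by (simp add: vmul_def flinear_sum[OF flinear_act] flinear_scale[OF flinear_act] act_lmul)

end

text \<open>Associativity of the wedge for a left factor of degree one: it is
  \<open>act_vmul\<close> for the operators \<open>lmul\<close>.\<close>

lemma wedge_vmul:
  assumes "\<alpha> \<in> ext_space N" "\<gamma> \<in> ext_space N" "dim_vec v = N"
  shows "wedge (vmul v \<alpha>) \<gamma> = vmul v (wedge \<alpha> \<gamma>)"
  using assms
  by (simp add: wedge_eq_act[of _ N] vmul_in_space lm.act_vmul) (simp add: vmul_def)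

lemma foldr_vmul_in_space:
  assumes "\<gamma> \<in> ext_space N" "\<And>v. v \<in> set vs \<Longrightarrow> dim_vec v = N"
  shows "foldr vmul vs \<gamma> \<in> ext_space N"
  using assms(2) by (induction vs) (auto simp: assms(1) vmul_in_space)

lemma wedge_list_in_space:
  "(\<And>v. v \<in> set vs \<Longrightarrow> dim_vec v = N) \<Longrightarrow> wedge_list vs \<in> ext_space N"
  by (simp add: wedge_list_conv foldr_vmul_in_space ext_basis_in_space)

lemma wedge_wedge_list:
  assumes "\<gamma> \<in> ext_space N" "\<And>v. v \<in> set vs \<Longrightarrow> dim_vec v = N"
  shows "wedge (wedge_list vs) \<gamma> = foldr vmul vs \<gamma>"
  using assms(2)
proof (induction vs)
  case Nil
  then show ?case using wedge_ext_basis_left[of "{}", OF _ assms(1)] by (simp add: wedge_list_conv)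
next
  case (Cons v vs)
  have "wedge (wedge_list (v # vs)) \<gamma> = wedge (vmul v (wedge_list vs)) \<gamma>"
    by (simp add: wedge_list_conv)
  also have "\<dots> = vmul v (wedge (wedge_list vs) \<gamma>)"
    using assms(1) Cons.prems by (intro wedge_vmul[where N = N] wedge_list_in_space) auto
  finally show ?case using Cons by simp
qed


subsection \<open>Functoriality of the exterior power\<close>

lemma flinear_ext_map: "flinear (ext_map C)"
  by (intro flinearI)
     (simp_all add: ext_map_def sum.distrib fv.scale_left_distrib fv.scale_sum_right)

text \<open>The generator with index \<open>i\<close> is replaced by multiplication with column
  \<open>i\<close> of \<open>M\<close>. Letting the resulting action hit the unit
  \<open>ext_basis {}\<close> yields \<open>ext_map M\<close>.\<close>

definition mat_op :: "'a::field mat \<Rightarrow> nat \<Rightarrow> (nat set \<Rightarrow> 'a) \<Rightarrow> nat set \<Rightarrow> 'a"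
  where "mat_op M i = vmul (col M i)"

interpretation mo: anticommuting "mat_op M" for M :: "'a::field mat"
  unfolding mat_op_def
  by (rule anticommuting.intro) (fact flinear_vmul vmul_anti vmul_vmul)+

lemma mo_word: "mo.word M I u = foldr vmul (map (col M) (sorted_list_of_set I)) u"
  unfolding mo.word_def by (simp add: mat_op_def [abs_def] foldr_map o_def)

lemma ext_map_eq_act: "ext_map M \<omega> = mo.act M (dim_col M) \<omega> (ext_basis {})"
  by (simp add: ext_map_def mo.act_def mo_word wedge_list_conv)

lemma vmul_mult_mat_vec:
  assumes "M \<in> carrier_mat n N" "v \<in> carrier_vec N"
  shows "vmul (M *\<^sub>v v) \<omega> = (\<Sum>i<N. scale_fun (v $ i) (vmul (col M i) \<omega>))"
proof -
  have "(\<Sum>k<n. (\<Sum>i<N. M $$ (k, i) * v $ i) * lmul k \<omega> J) =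
     (\<Sum>i<N. v $ i * (\<Sum>k<n. M $$ (k, i) * lmul k \<omega> J))" for J
    unfolding sum_distrib_left sum_distrib_right by (subst sum.swap) (simp add: mult_ac)
  moreover have "(M *\<^sub>v v) $ k = (\<Sum>i<N. M $$ (k, i) * v $ i)" if "k < n" for k
    using assms that by (auto simp: scalar_prod_def atLeast0LessThan intro!: sum.cong)
  moreover have "col M i $ k = M $$ (k, i)" if "k < n" "i < N" for k i
    using assms that by auto
  ultimately show ?thesis
    using assms by (auto simp: fun_eq_iff vmul_def sum_fun_eval)
qed

text \<open>\<open>M v\<close> is the combination of the columns of \<open>M\<close> with the
  coefficients of \<open>v\<close>, so this is \<open>act_vmul\<close> for the column operators.
  Functoriality and compatibility with \<open>wedge\<close> both reduce to it.\<close>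

lemma ext_map_vmul:
  assumes "M \<in> carrier_mat n N" "v \<in> carrier_vec N"
  shows "ext_map M (vmul v \<omega>) = vmul (M *\<^sub>v v) (ext_map M \<omega>)"
  using assms by (simp add: ext_map_eq_act mo.act_vmul vmul_mult_mat_vec mat_op_def)

lemma ext_map_one: 
  assumes "M \<in> carrier_mat n N"
  shows "ext_map M (ext_basis {}) = ext_basis {}"
proof -
  have "ext_map M (ext_basis {}) = (\<Sum>I\<in>Pow {..<N}. if I = {} then wedge_list [] else 0)"
    using assms unfolding ext_map_def
    by (intro sum.cong) (auto simp: ext_basis_def fun_eq_iff)
  then show ?thesis by (simp add: wedge_list_def)
qed

lemma ext_map_foldr:
  assumes "M \<in> carrier_mat n N" "set vs \<subseteq> carrier_vec N"
  shows "ext_map M (foldr vmul vs \<gamma>) = foldr vmul (map ((*\<^sub>v) M) vs) (ext_map M \<gamma>)"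
  using assms(2) by (induction vs) (auto simp: ext_map_vmul[OF assms(1)])

lemma ext_map_wedge_list:
  assumes "M \<in> carrier_mat n N" "set vs \<subseteq> carrier_vec N"
  shows "ext_map M (wedge_list vs) = wedge_list (map ((*\<^sub>v) M) vs)"
  using ext_map_foldr[OF assms] by (simp add: wedge_list_conv ext_map_one[OF assms(1)])

lemma ext_map_in_space:
  assumes "M \<in> carrier_mat n N"
  shows "ext_map M \<omega> \<in> ext_space n"
  unfolding ext_map_def using assms
  by (intro fv.subspace_sum[OF subspace_ext_space] fv.subspace_scale[OF subspace_ext_space]
      wedge_list_in_space) auto

lemma ext_map_mult:
  assumes "A \<in> carrier_mat n k" "B \<in> carrier_mat k N"
  shows "ext_map (A * B) \<omega> = ext_map A (ext_map B \<omega>)"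
proof -
  have "ext_map A (wedge_list (map (col B) (sorted_list_of_set I))) =
      wedge_list (map (col (A * B)) (sorted_list_of_set I))" if "I \<subseteq> {..<N}" for I
  proof -
    have "set (map (col B) (sorted_list_of_set I)) \<subseteq> carrier_vec k"
      using assms by auto
    moreover have "i < N" if "i \<in> set (sorted_list_of_set I)" for i
      using that \<open>I \<subseteq> {..<N}\<close> finite_subset[of I "{..<N}"] by auto
    then have "map (\<lambda>i. A *\<^sub>v col B i) (sorted_list_of_set I) = map (col (A * B)) (sorted_list_of_set I)"
      using assms by (intro map_cong) (auto simp: col_mult2)
    ultimately show ?thesis
      by (subst ext_map_wedge_list[OF assms(1)]) (simp_all only: map_map o_def)
  qed
  then show ?thesis using assms
    by (simp add: ext_map_def[of B] ext_map_def[of "A * B"] flinear_sum[OF flinear_ext_map]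
        flinear_scale[OF flinear_ext_map])
qed

lemma mult_mat_unit_vec:
  fixes M :: "'a::field mat"
  shows "M \<in> carrier_mat n N \<Longrightarrow> i < N \<Longrightarrow> M *\<^sub>v unit_vec N i = col M i"
  by (intro eq_vecI) auto

lemma vmul_unit_vec: "i < N \<Longrightarrow> vmul (unit_vec N i) \<omega> = lmul i \<omega>"
proof -
  assume "i < N"
  then have "vmul (unit_vec N i) \<omega> = (\<Sum>k<N. if k = i then lmul i \<omega> else 0)"
    unfolding vmul_def by (intro sum.cong) (auto simp: fun_eq_iff)
  then show ?thesis using \<open>i < N\<close> by simp
qed

lemma ext_map_basis:
  assumes "I \<subseteq> {..<dim_col M}"
  shows "ext_map M (ext_basis I) = wedge_list (map (col M) (sorted_list_of_set I))"
proof -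
  have "ext_map M (ext_basis I) = (\<Sum>J\<in>Pow {..<dim_col M}. if J = I then
     wedge_list (map (col M) (sorted_list_of_set J)) else 0)"
    unfolding ext_map_def by (intro sum.cong) (auto simp: ext_basis_def fun_eq_iff)
  then show ?thesis using assms by simp
qed

lemma ext_map_id:
  fixes \<omega> :: "nat set \<Rightarrow> 'a::field"
  assumes "\<omega> \<in> ext_space N"
  shows "ext_map (1\<^sub>m N) \<omega> = \<omega>"
proof -
  have "wedge_list (map (col (1\<^sub>m N)) (sorted_list_of_set I)) = (ext_basis I :: nat set \<Rightarrow> 'a)" if "I \<subseteq> {..<N}" for I
  proof -
    have f: "finite I" using that finite_subset by blast
    have "foldr vmul (map (col (1\<^sub>m N)) ks) u = foldr lmul ks u" if "set ks \<subseteq> {..<N}"  for ks and u :: "nat set \<Rightarrow> 'a"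
      using that by (induction ks) (auto simp: vmul_unit_vec)
    from this[of "sorted_list_of_set I"] show ?thesis using that f lm_word_one[OF f, where 'a = 'a]
      by (simp add: wedge_list_conv lm.word_def)
  qed
  then show ?thesis
    by (subst (2) ext_space_expand[OF assms]) (simp add: ext_map_def)
qed

lemma ext_map_wedge:
  fixes M :: "'a::field mat"
  assumes M: "M \<in> carrier_mat N N" and "\<alpha> \<in> ext_space N" "\<gamma> \<in> ext_space N"
  shows "ext_map M (wedge \<alpha> \<gamma>) = wedge (ext_map M \<alpha>) (ext_map M \<gamma>)"
proof -
  have eq: "ext_map M (lm.word I \<gamma>) = wedge (ext_map M (ext_basis I)) (ext_map M \<gamma>)" if I: "I \<subseteq> {..<N}" for I
  proof -
    have I': "set (sorted_list_of_set I) \<subseteq> {..<N}"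
      using I finite_subset[of I "{..<N}"] by simp
    have "foldr lmul ks u = foldr vmul (map (unit_vec N) ks) u" if "set ks \<subseteq> {..<N}"  for ks and u :: "nat set \<Rightarrow> 'a"
      using that by (induction ks) (auto simp: vmul_unit_vec)
    then have "ext_map M (lm.word I \<gamma>) =
       ext_map M (foldr vmul (map (unit_vec N) (sorted_list_of_set I)) \<gamma>)"
      using I' by (simp add: lm.word_def)
    also have "\<dots> = foldr vmul (map ((*\<^sub>v) M) (map (unit_vec N) (sorted_list_of_set I))) (ext_map M \<gamma>)"
      by (intro ext_map_foldr[OF M]) auto
    also have "map ((*\<^sub>v) M) (map (unit_vec N) (sorted_list_of_set I)) = map (col M) (sorted_list_of_set I)"
      using I' M by (auto intro!: mult_mat_unit_vec)
    also have "foldr vmul \<dots> (ext_map M \<gamma>) = wedge (wedge_list (map (col M) (sorted_list_of_set I))) (ext_map M \<gamma>)"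
      using M by (intro wedge_wedge_list[symmetric, where N = N] ext_map_in_space) auto
    finally show ?thesis using I M by (simp add: ext_map_basis)
  qed
  have "ext_map M (wedge \<alpha> \<gamma>) = (\<Sum>I\<in>Pow {..<N}. scale_fun (\<alpha> I) (ext_map M (lm.word I \<gamma>)))"
    using assms by (simp add: wedge_eq_act[of _ N] lm.act_def flinear_sum[OF flinear_ext_map]
        flinear_scale[OF flinear_ext_map])
  also have "\<dots> = wedge (\<Sum>I\<in>Pow {..<N}. scale_fun (\<alpha> I) (ext_map M (ext_basis I))) (ext_map M \<gamma>)"
    by (simp add: eq wedge_lincomb_left)
  also have "(\<Sum>I\<in>Pow {..<N}. scale_fun (\<alpha> I) (ext_map M (ext_basis I))) = ext_map M \<alpha>"
    by (subst (2) ext_space_expand[OF assms(2)])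
       (simp add: flinear_sum[OF flinear_ext_map] flinear_scale[OF flinear_ext_map])
  finally show ?thesis .
qed


subsection \<open>Exterior powers of matrices in terms of minors\<close>

text \<open>A bridge between two enumerations of an index set: \<open>ext_map\<close> runs through
  sorted lists, \<open>submatrix\<close> uses \<open>pick\<close>.\<close>

lemma sorted_list_of_set_nth_pick:
  assumes "finite J" "k < card J"
  shows "sorted_list_of_set J ! k = pick J k"
proof -
  have in_J: "pick J i \<in> J" if "i < card J" for i
    using that by (simp add: pick_in_set)
  have mono: "pick J i < pick J j" if "i < j" "j < card J" for i j
    using that by (simp add: pick_mono)
  have s: "sorted_wrt (<) (map (pick J) [0..<card J])"
    by (auto simp: sorted_wrt_iff_nth_less mono)
  have d: "distinct (map (pick J) [0..<card J])"
    using s strict_sorted_iff by blast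
  have "set (map (pick J) [0..<card J]) = J"
    using in_J distinct_card[OF d]
    by (intro card_subset_eq assms(1)) (auto simp only: set_map length_map length_upt, auto)
  then have "sorted_list_of_set J = map (pick J) [0..<card J]"
    using s assms(1) by (intro sorted_distinct_set_unique) (auto simp: strict_sorted_iff d)
  then show ?thesis using assms(2) by simp
qed

text \<open>An element is recognised by its rank, the number of smaller elements of the set, and
  deleting the \<open>r\<close>-th element lowers exactly the ranks beyond \<open>r\<close>. This is
  the row renumbering done by \<open>mat_delete\<close>.\<close>

lemma pick_delete:
  assumes "r < card I" "k < card I - 1"
  shows "pick (I - {pick I r}) k = pick I (if k < r then k else Suc k)"
proof -
  define k' where "k' = (if k < r then k else Suc k)"
  have fin: "finite I" using assms(1) card_ge_0_finite by force
  have k': "k' < card I" "k' \<noteq> r" using assms by (auto simp: k'_def)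
  have pk: "pick I k' \<in> I" "pick I r \<in> I" using k' assms(1) by (simp_all add: pick_in_set)
  have ne: "pick I k' \<noteq> pick I r"
    using pick_mono[of r I k'] pick_mono[of k' I r] k' assms(1) by (cases "r < k'") fastforce+
  have c: "card {a\<in>I. a < pick I k'} = k'" using k' by (simp add: card_pick)
  have "{a\<in>I - {pick I r}. a < pick I k'} = {a\<in>I. a < pick I k'} - {pick I r}" by auto
  moreover have "pick I r < pick I k'" if "r < k'"
    using pick_mono[of k' I r] that k'(1) by simp
  moreover have "\<not> pick I r < pick I k'" if "\<not> r < k'"
    using pick_mono[of r I k'] that k' assms(1) by fastforce
  ultimately have "card {a\<in>I - {pick I r}. a < pick I k'} = k"
    using c pk fin by (auto simp: card_Diff_singleton_if k'_def split: if_splits)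
  then show ?thesis
    using pick_card_in_set[of "pick I k'" "I - {pick I r}"] pk ne by (simp add: k'_def)
qed

lemma pick_less:
  assumes "I \<subseteq> {..<N}" "r < card I"
  shows "pick I r < N"
  using pick_in_set[of r I] assms by auto

lemma bij_betw_pick: "finite I \<Longrightarrow> bij_betw (pick I) {..<card I} I"
  by (rule bij_betw_byWitness[where f' = "\<lambda>i. card {a\<in>I. a < i}"])
     (auto simp: card_pick pick_card_in_set pick_in_set intro!: psubset_card_mono)

lemma ext_power_sub_space: "ext_power N k \<subseteq> ext_space N"
  by (auto simp: ext_power_def ext_space_def)

lemma vmul_eval:
  assumes "v \<in> carrier_vec N" "I \<subseteq> {..<N}"
  shows "vmul v \<omega> I = (\<Sum>i\<in>I. v $ i * ((-1) ^ card {j\<in>I. j < i} * \<omega> (I - {i})))"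
proof -
  have f: "finite I" using assms(2) finite_subset by blast
  have "vmul v \<omega> I = (\<Sum>i<N. v $ i * lmul i \<omega> I)"
    using assms by (simp add: vmul_def sum_fun_eval)
  also have "\<dots> = (\<Sum>i\<in>I. v $ i * lmul i \<omega> I)"
    using assms(2) by (intro sum.mono_neutral_right) (auto simp: lmul_def)
  finally show ?thesis using f by (simp add: lmul_def)
qed

text \<open>Multiplying by \<open>v\<close> on the left sums over the index taken away from
  \<open>I\<close>, signed by its rank in \<open>I\<close>. This is the Laplace expansion along the
  first column.\<close>

lemma wedge_list_eval:
  assumes "set vs \<subseteq> carrier_vec N" "I \<subseteq> {..<N}" "card I = length vs"
  shows "wedge_list vs I = det (mat (length vs) (length vs) (\<lambda>(i, j). (vs ! j) $ (pick I i)))"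
  using assms
proof (induction vs arbitrary: I)
  case Nil
  then have "I = {}" using finite_subset[of I "{..<N}"] by auto
  then show ?case by (simp add: wedge_list_def ext_basis_def)
next
  case (Cons v vs)
  define n where "n = length vs"
  define A where "A = mat (Suc n) (Suc n) (\<lambda>(i, j). ((v # vs) ! j) $ (pick I i))"
  have f: "finite I" using Cons.prems(2) finite_subset by blast
  have cI: "card I = Suc n" using Cons.prems by (simp add: n_def)
  have cof: "cofactor A r 0 = (-1) ^ r * wedge_list vs (I - {pick I r})" if r: "r < Suc n" for r
  proof -
    have pr: "pick I r \<in> I" using r cI by (simp add: pick_in_set)
    have "wedge_list vs (I - {pick I r}) =
        det (mat n n (\<lambda>(i, j). (vs ! j) $ (pick (I - {pick I r}) i)))"
      using Cons.prems pr f cI unfolding n_def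
      by (intro Cons.IH) (auto simp: card_Diff_singleton)
    also have "mat n n (\<lambda>(i, j). (vs ! j) $ (pick (I - {pick I r}) i)) = mat_delete A r 0"
      using r cI by (intro eq_matI) (auto simp: A_def mat_delete_def pick_delete)
    finally show ?thesis by (simp add: cofactor_def)
  qed
  have A0: "A $$ (r, 0) = v $ pick I r" if "r < Suc n" for r
    using that by (simp add: A_def)
  have "wedge_list (v # vs) I =
      (\<Sum>i\<in>I. v $ i * ((-1) ^ card {j\<in>I. j < i} * wedge_list vs (I - {i})))"
    using Cons.prems by (simp add: wedge_list_conv vmul_eval[of _ N])
  also have "\<dots> = (\<Sum>r<card I. v $ pick I r * ((-1) ^ card {j\<in>I. j < pick I r} * wedge_list vs (I - {pick I r})))"
    by (rule sum.reindex_bij_betw[OF bij_betw_pick[OF f], symmetric])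
  also have "\<dots> = (\<Sum>r<Suc n. A $$ (r, 0) * cofactor A r 0)"
    by (intro sum.cong) (simp_all add: cI cof A0 card_pick)
  also have "\<dots> = det A"
    by (rule laplace_expansion_column[symmetric]) (auto simp: A_def)
  finally show ?case by (simp add: A_def n_def)
qed

lemma vmul_in_power:
  assumes "\<omega> \<in> ext_power N k" "v \<in> carrier_vec N"
  shows "vmul v \<omega> \<in> ext_power N (Suc k)"
proof -
  have "lmul i \<omega> J \<noteq> 0 \<Longrightarrow> J \<subseteq> {..<N} \<and> card J = Suc k" if "i < N" for i J
  proof -
    assume "lmul i \<omega> J \<noteq> 0"
    then have J: "finite J" "i \<in> J" "\<omega> (J - {i}) \<noteq> 0" by (auto simp: lmul_def split: if_splits)
    then have "J - {i} \<subseteq> {..<N}" "card (J - {i}) = k" using assms(1) by (auto simp: ext_power_def)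
    moreover have "card J = Suc (card (J - {i}))" using card_Suc_Diff1[OF J(1,2)] by simp
    ultimately show ?thesis using that by auto
  qed
  moreover have "\<exists>i<N. lmul i \<omega> J \<noteq> 0" if "vmul v \<omega> J \<noteq> 0" for J
  proof (rule ccontr)
    assume "\<not> ?thesis"
    then have "vmul v \<omega> J = 0" using assms(2) by (simp add: vmul_def sum_fun_eval)
    with that show False by simp
  qed
  ultimately show ?thesis by (auto simp: ext_power_def) blast+
qed

lemma wedge_list_in_power:
  "set vs \<subseteq> carrier_vec N \<Longrightarrow> wedge_list vs \<in> ext_power N (length vs)"
  by (induction vs)
     (auto simp: wedge_list_conv intro: vmul_in_power, auto simp: ext_power_def ext_basis_def)

lemma wedge_cols_eval:
  assumes M: "M \<in> carrier_mat N K" and "I \<subseteq> {..<N}" "J \<subseteq> {..<K}"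
  shows "wedge_list (map (col M) (sorted_list_of_set J)) I =
    (if card I = card J then det (submatrix M I J) else 0)"
proof -
  have fJ: "finite J" using assms(3) finite_subset by blast
  have len: "length (map (col M) (sorted_list_of_set J)) = card J" by simp
  have cols: "set (map (col M) (sorted_list_of_set J)) \<subseteq> carrier_vec N" using M by auto
  show ?thesis
  proof (cases "card I = card J")
    case True
    have 1: "{i. i < N \<and> i \<in> I} = I" "{j. j < K \<and> j \<in> J} = J"
      using assms by auto
    have "mat (card J) (card J) (\<lambda>(i, j). (map (col M) (sorted_list_of_set J) ! j) $ (pick I i)) =
        submatrix M I J"
      using True assms pick_less[of I N] pick_less[of J K] M fJ
      by (intro eq_matI) (auto simp: submatrix_def 1 sorted_list_of_set_nth_pick)
    then show ?thesis
      using wedge_list_eval[OF cols assms(2)] len True by simp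
  next
    case False
    then show ?thesis using wedge_list_in_power[OF cols] by (auto simp: ext_power_def)
  qed
qed

text \<open>In the monomial basis \<open>ext_map M\<close> is the compound matrix of
  \<open>M\<close>; each of its columns is a wedge of columns of \<open>M\<close>, evaluated in
  \<open>wedge_cols_eval\<close>.\<close>

lemma ext_map_eval:
  assumes M: "M \<in> carrier_mat N K" and "I \<subseteq> {..<N}"
  shows "ext_map M \<omega> I = (\<Sum>J | J \<subseteq> {..<K} \<and> card J = card I. \<omega> J * det (submatrix M I J))"
proof -
  have "ext_map M \<omega> I =
      (\<Sum>J\<in>Pow {..<K}. if card I = card J then \<omega> J * det (submatrix M I J) else 0)"
    using assms unfolding ext_map_def sum_fun_eval
    by (intro sum.cong) (auto simp: wedge_cols_eval[OF M])
  also have "\<dots> = (\<Sum>J\<in>{J\<in>Pow {..<K}. card I = card J}. \<omega> J * det (submatrix M I J))"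
    by (rule sum.inter_filter[symmetric]) simp
  finally show ?thesis by (simp add: Pow_def conj_commute eq_commute[of "card I"])
qed

lemma ext_map_in_power:
  assumes M: "M \<in> carrier_mat N N" and "\<omega> \<in> ext_power N k"
  shows "ext_map M \<omega> \<in> ext_power N k"
  unfolding ext_power_def
proof safe
  fix I i assume nz: "ext_map M \<omega> I \<noteq> 0"
  then show *: "i \<in> I \<Longrightarrow> i < N"
    using ext_map_in_space[OF M, of \<omega>] by (auto simp: ext_space_def)
  have I: "I \<subseteq> {..<N}"
    using nz ext_map_in_space[OF M, of \<omega>] by (auto simp: ext_space_def)
  show "card I = k"
  proof (rule ccontr)
    assume "card I \<noteq> k"
    then have "\<omega> J = 0" if "card J = card I" for J
      using that assms(2) by (auto simp: ext_power_def)
    then have "ext_map M \<omega> I = 0"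
      unfolding ext_map_eval[OF M I] by (intro sum.neutral) auto
    with nz show False by simp
  qed
qed

lemma submatrix_all:
  assumes "M \<in> carrier_mat N K"
  shows "submatrix M {..<N} {..<K} = M"
proof -
  have "pick {..<n} i = i" if "i < n" for n i :: nat
  proof -
    have "{a \<in> {..<n}. a < i} = {..<i}" using that by auto
    then show ?thesis using pick_card_in_set[of i "{..<n}"] that by simp
  qed
  moreover have "{i. i < dim_row M \<and> i \<in> {..<N}} = {..<N}" "{j. j < dim_col M \<and> j \<in> {..<K}} = {..<K}"
    using assms by auto
  ultimately show ?thesis using assms
    by (intro eq_matI) (simp_all add: submatrix_def)
qed

lemma submatrix_transpose:
  "submatrix (transpose_mat M) J I = transpose_mat (submatrix M I J)"
  by (intro eq_matI) (auto simp: submatrix_def pick_le)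

lemma det_submatrix_transpose:
  assumes "M \<in> carrier_mat N K" "I \<subseteq> {..<N}" "J \<subseteq> {..<K}" "card I = card J"
  shows "det (submatrix (transpose_mat M) J I) = det (submatrix M I J)"
proof -
  have 1: "{i. i < dim_row M \<and> i \<in> I} = I" "{j. j < dim_col M \<and> j \<in> J} = J"
    using assms by auto
  have "submatrix M I J \<in> carrier_mat (card J) (card J)"
    using assms(4) by (auto simp: submatrix_def 1)
  then show ?thesis unfolding submatrix_transpose by (rule det_transpose)
qed

lemma ext_map_top:
  assumes M: "M \<in> carrier_mat N N"
  shows "ext_map M \<omega> {..<N} = det M * \<omega> {..<N}"
proof -
  have "{J. J \<subseteq> {..<N} \<and> card J = card {..<N}} = {{..<N}}"
    by (auto dest: card_subset_eq[rotated])
  then show ?thesis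
    by (subst ext_map_eval[OF M]) (simp_all add: submatrix_all[OF M])
qed

definition ext_dot :: "nat \<Rightarrow> (nat set \<Rightarrow> 'a::field) \<Rightarrow> (nat set \<Rightarrow> 'a) \<Rightarrow> 'a"
  where "ext_dot N \<alpha> \<omega> = (\<Sum>I\<in>Pow {..<N}. \<alpha> I * \<omega> I)"

text \<open>Minors of the transpose are minors of \<open>M\<close> with row and column sets
  exchanged, so transposition commutes with forming the compound matrix.\<close>

lemma ext_dot_transpose:
  assumes M: "M \<in> carrier_mat N N"
  shows "ext_dot N (ext_map M \<alpha>) \<omega> = ext_dot N \<alpha> (ext_map (transpose_mat M) \<omega>)"
proof -
  have Mt: "transpose_mat M \<in> carrier_mat N N" using M by simp
  have L: "ext_dot N (ext_map M \<alpha>) \<omega> = (\<Sum>I\<in>Pow {..<N}. \<Sum>J\<in>Pow {..<N}.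
      if card J = card I then \<alpha> J * \<omega> I * det (submatrix M I J) else 0)"
    unfolding ext_dot_def
  proof (intro sum.cong refl)
    fix I assume "I \<in> Pow {..<N}"
    then have "ext_map M \<alpha> I * \<omega> I = (\<Sum>J\<in>{J\<in>Pow {..<N}. card J = card I}. \<alpha> J * \<omega> I * det (submatrix M I J))"
      by (simp add: ext_map_eval[OF M] sum_distrib_left sum_distrib_right mult_ac Pow_def)
    then show "ext_map M \<alpha> I * \<omega> I = (\<Sum>J\<in>Pow {..<N}.
      if card J = card I then \<alpha> J * \<omega> I * det (submatrix M I J) else 0)"
      by (subst sum.inter_filter[symmetric]) auto
  qed
  have R: "ext_dot N \<alpha> (ext_map (transpose_mat M) \<omega>) = (\<Sum>J\<in>Pow {..<N}. \<Sum>I\<in>Pow {..<N}.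
      if card J = card I then \<alpha> J * \<omega> I * det (submatrix M I J) else 0)"
    unfolding ext_dot_def
  proof (intro sum.cong refl)
    fix J assume J: "J \<in> Pow {..<N}"
    have "\<alpha> J * ext_map (transpose_mat M) \<omega> J =
        (\<Sum>I\<in>{I\<in>Pow {..<N}. card J = card I}. \<alpha> J * \<omega> I * det (submatrix M I J))"
      unfolding ext_map_eval[OF Mt PowD[OF J]] sum_distrib_left using J
      by (intro sum.cong) (auto simp: det_submatrix_transpose[OF M])
    then show "\<alpha> J * ext_map (transpose_mat M) \<omega> J = (\<Sum>I\<in>Pow {..<N}.
      if card J = card I then \<alpha> J * \<omega> I * det (submatrix M I J) else 0)"
      by (subst sum.inter_filter[symmetric]) auto
  qed
  show ?thesis unfolding L R by (rule sum.swap)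
qed


subsection \<open>The Hodge star in coordinates\<close>

text \<open>The shuffle sign: the monomial of \<open>I\<close> wedged with that of its complement is
  this multiple of the top monomial.\<close>

definition compl_sign :: "nat \<Rightarrow> nat set \<Rightarrow> 'a::field"
  where "compl_sign N I = (-1) ^ card {(i, j). i \<in> I \<and> j \<in> {..<N} - I \<and> j < i}"

text \<open>The Hodge star of the standard dot product with the top monomial as volume, as
  \<open>wedge_star0_top\<close> confirms. The sign is taken at the source monomial, which is the
  complement of the target index \<open>K\<close>.\<close>

definition star0 :: "nat \<Rightarrow> (nat set \<Rightarrow> 'a::field) \<Rightarrow> nat set \<Rightarrow> 'a"
  where "star0 N \<omega> = (\<lambda>K. if K \<subseteq> {..<N}
    then compl_sign N ({..<N} - K) * \<omega> ({..<N} - K) else 0)"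

lemma compl_sign_square [simp]: "compl_sign N I * compl_sign N I = 1"
  by (simp add: compl_sign_def flip: power_mult_distrib)

lemma compl_sign_nonzero [simp]: "compl_sign N I \<noteq> 0"
  by (simp add: compl_sign_def)

lemma flinear_star0: "flinear (star0 N)"
  by (intro flinearI) (auto simp: star0_def fun_eq_iff algebra_simps)

lemma star0_in_space: "star0 N \<omega> \<in> ext_space N"
  by (auto simp: star0_def ext_space_def)

lemma wedge_top:
  "wedge \<alpha> \<delta> {..<N} = (\<Sum>I\<in>Pow {..<N}. compl_sign N I * \<alpha> I * \<delta> ({..<N} - I))"
  by (simp add: wedge_def compl_sign_def)

lemma wedge_star0_top: "wedge \<alpha> (star0 N \<omega>) {..<N} = ext_dot N \<alpha> \<omega>"
  unfolding wedge_top ext_dot_def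
proof (intro sum.cong refl)
  fix I assume "I \<in> Pow {..<N}"
  then have "{..<N} - ({..<N} - I) = I" by auto
  then have "compl_sign N I * \<alpha> I * star0 N \<omega> ({..<N} - I) =
      compl_sign N I * compl_sign N I * (\<alpha> I * \<omega> I)"
    by (simp add: star0_def mult_ac del: compl_sign_square)
  then show "compl_sign N I * \<alpha> I * star0 N \<omega> ({..<N} - I) = \<alpha> I * \<omega> I"
    by simp
qed

lemma wedge_top_basis:
  assumes "I \<subseteq> {..<N}"
  shows "wedge (ext_basis I) \<delta> {..<N} = compl_sign N I * \<delta> ({..<N} - I)"
proof -
  have "wedge (ext_basis I) \<delta> {..<N} =
      (\<Sum>J\<in>Pow {..<N}. if J = I then compl_sign N I * \<delta> ({..<N} - I) else 0)"
    unfolding wedge_top by (intro sum.cong) (auto simp: ext_basis_def)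
  then show ?thesis using assms by simp
qed

text \<open>Wedging with the monomial of \<open>I\<close> and taking the top coefficient reads off,
  up to sign, the coordinate at the complement of \<open>I\<close>; so this pairing separates
  points.\<close>

lemma ext_space_eqI:
  assumes "\<delta> \<in> ext_space N" "\<delta>' \<in> ext_space N"
    "\<And>I. I \<subseteq> {..<N} \<Longrightarrow> wedge (ext_basis I) \<delta> {..<N} = wedge (ext_basis I) \<delta>' {..<N}"
  shows "\<delta> = \<delta>'"
proof
  fix K
  show "\<delta> K = \<delta>' K"
  proof (cases "K \<subseteq> {..<N}")
    case True
    then have "{..<N} - ({..<N} - K) = K" by auto
    then show ?thesis
      using assms(3)[of "{..<N} - K"] by (simp add: wedge_top_basis)
  next
    case False
    then have "\<delta> K = 0" "\<delta>' K = 0" using assms(1,2) unfolding ext_space_def by blast+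
    then show ?thesis by simp
  qed
qed

text \<open>Both sides are tested against the perfect pairing that sends \<open>\<alpha>, \<delta>\<close> to the top coefficient of
  \<open>\<alpha> \<and> \<delta>\<close>, which \<^term>\<open>ext_map M\<close> multiplies by \<^term>\<open>det M\<close>.\<close>

lemma star0_ext_map:
  assumes M: "M \<in> carrier_mat N N" and Mi: "Mi \<in> carrier_mat N N" and "M * Mi = 1\<^sub>m N"
    and \<omega>: "\<omega> \<in> ext_space N"
  shows "ext_map M (star0 N (ext_map (transpose_mat M) \<omega>)) = scale_fun (det M) (star0 N \<omega>)"
proof (rule ext_space_eqI)
  show "ext_map M (star0 N (ext_map (transpose_mat M) \<omega>)) \<in> ext_space N"
    by (rule ext_map_in_space[OF M])
  show "scale_fun (det M) (star0 N \<omega>) \<in> ext_space N"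
    by (intro fv.subspace_scale[OF subspace_ext_space] star0_in_space)
  fix I assume I: "I \<subseteq> {..<N}"
  \<comment> \<open>Since \<open>M\<close> is invertible, the test monomial can be written as the
    image of some \<open>\<alpha>\<close>. Multiplicativity then pulls \<open>ext_map M\<close> out
    of the wedge, and on the top coefficient it acts as \<open>det M\<close>.\<close>
  define \<alpha> where "\<alpha> = ext_map Mi (ext_basis I)"
  have \<alpha>: "\<alpha> \<in> ext_space N" unfolding \<alpha>_def by (rule ext_map_in_space[OF Mi])
  have e: "ext_basis I = ext_map M \<alpha>"
    unfolding \<alpha>_def using I
    by (simp add: ext_map_mult[OF M Mi, symmetric] assms(3) ext_map_id ext_basis_in_space)
  have "wedge (ext_basis I) (ext_map M (star0 N (ext_map (transpose_mat M) \<omega>))) {..<N} =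
     ext_map M (wedge \<alpha> (star0 N (ext_map (transpose_mat M) \<omega>))) {..<N}"
    unfolding e by (subst ext_map_wedge[OF M \<alpha> star0_in_space]) simp
  also have "\<dots> = det M * ext_dot N (ext_map M \<alpha>) \<omega>"
    by (simp add: ext_map_top[OF M] wedge_star0_top ext_dot_transpose[OF M])
  also have "\<dots> = wedge (ext_basis I) (scale_fun (det M) (star0 N \<omega>)) {..<N}"
    unfolding e[symmetric] wedge_star0_top[symmetric] wedge_top
    by (simp add: sum_distrib_left mult_ac)
  finally show "wedge (ext_basis I) (ext_map M (star0 N (ext_map (transpose_mat M) \<omega>))) {..<N} =
      wedge (ext_basis I) (scale_fun (det M) (star0 N \<omega>)) {..<N}" .
qed

text \<open>The inversions of \<open>K\<close> against its complement and those of the complement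
  against \<open>K\<close> together exhaust the product of the two sets.\<close>

lemma compl_sign_compl:
  assumes "K \<subseteq> {..<N}"
  shows "compl_sign N K * compl_sign N ({..<N} - K) = ((-1) ^ (card K * (N - card K)) :: 'a::field)"
proof -
  let ?A = "{(i, j). i \<in> K \<and> j \<in> {..<N} - K \<and> j < i}"
  let ?B = "{(i, j). i \<in> {..<N} - K \<and> j \<in> {..<N} - ({..<N} - K) \<and> j < i}"
  have f: "finite K" using assms finite_subset by blast
  have BB: "?B = prod.swap ` {(i, j). i \<in> K \<and> j \<in> {..<N} - K \<and> i < j}"
    using assms by auto
  have "card ?B = card {(i, j). i \<in> K \<and> j \<in> {..<N} - K \<and> i < j}"
    unfolding BB by (intro card_image) auto
  then have "card ?A + card ?B = card (?A \<union> {(i, j). i \<in> K \<and> j \<in> {..<N} - K \<and> i < j})"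
    using f by (subst card_Un_disjoint) (auto intro: finite_subset[of _ "K \<times> {..<N}"])
  also have "?A \<union> {(i, j). i \<in> K \<and> j \<in> {..<N} - K \<and> i < j} = K \<times> ({..<N} - K)"
    by auto (metis linorder_neqE_nat)
  also have "card \<dots> = card K * (N - card K)"
    using assms f by (simp add: card_cartesian_product card_Diff_subset)
  finally show ?thesis by (simp add: compl_sign_def flip: power_add)
qed

text \<open>In the middle degree the two shuffle signs multiply to \<open>(-1) ^ (m * m)\<close>,
  and \<open>m * m\<close> has the parity of \<open>m\<close>.\<close>

lemma star0_star0:
  assumes "\<omega> \<in> ext_power (2 * m) m"
  shows "star0 (2 * m) (star0 (2 * m) \<omega>) = scale_fun ((-1) ^ m) \<omega>"
proof
  fix K
  show "star0 (2 * m) (star0 (2 * m) \<omega>) K = scale_fun ((-1) ^ m) \<omega> K"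
  proof (cases "K \<subseteq> {..<2 * m} \<and> card K = m")
    case True
    then have "{..<2 * m} - ({..<2 * m} - K) = K" by auto
    moreover have "compl_sign (2 * m) ({..<2 * m} - K) * compl_sign (2 * m) K = ((-1) ^ m :: 'a)"
      using True compl_sign_compl[of K "2 * m", where 'a = 'a]
      by (simp add: mult.commute uminus_power_if)
    ultimately show ?thesis using True
      by (simp add: star0_def flip: mult.assoc)
  next
    case False
    then have "\<omega> K = 0" using assms by (auto simp: ext_power_def)
    moreover have "{..<2 * m} - ({..<2 * m} - K) = K" if "K \<subseteq> {..<2 * m}"
      using that by auto
    ultimately show ?thesis by (simp add: star0_def)
  qed
qed

lemma star0_in_power:
  assumes "\<omega> \<in> ext_power (2 * m) m"
  shows "star0 (2 * m) \<omega> \<in> ext_power (2 * m) m"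
  unfolding ext_power_def
proof (intro CollectI allI impI)
  fix K assume "star0 (2 * m) \<omega> K \<noteq> 0"
  then have "K \<subseteq> {..<2 * m}" "\<omega> ({..<2 * m} - K) \<noteq> 0"
    by (auto simp: star0_def split: if_splits)
  moreover have "card ({..<2 * m} - K) = m"
    using calculation(2) assms by (auto simp: ext_power_def)
  ultimately show "K \<subseteq> {..<2 * m} \<and> card K = m"
    using finite_subset[of K "{..<2 * m}"] card_mono[of "{..<2 * m}" K] by (simp add: card_Diff_subset)
qed

lemma ext_bform_eq_dot:
  assumes G: "G \<in> carrier_mat N N"
  shows "ext_bform G \<alpha> \<gamma> = ext_dot N \<alpha> (ext_map G \<gamma>)"
  unfolding ext_bform_def ext_dot_def using G
  by (intro sum.cong)
     (auto simp: ext_map_eval[OF G] sum_distrib_left mult_ac Pow_def intro!: sum.cong)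

lemma wedge_in_power:
  assumes "\<alpha> \<in> ext_power N k" "\<delta> \<in> ext_power N l"
  shows "wedge \<alpha> \<delta> \<in> ext_power N (k + l)"
  unfolding ext_power_def
proof (intro CollectI allI impI)
  fix L assume "wedge \<alpha> \<delta> L \<noteq> 0"
  then obtain I where I: "I \<in> Pow L" "\<alpha> I \<noteq> 0" "\<delta> (L - I) \<noteq> 0" and f: "finite L"
    unfolding wedge_def by (metis (no_types, lifting) finite_Pow_iff mult_zero_left mult_zero_right
        sum.infinite sum.not_neutral_contains_not_neutral)
  then have "I \<subseteq> {..<N}" "card I = k" "L - I \<subseteq> {..<N}" "card (L - I) = l"
    using assms by (auto simp: ext_power_def)
  moreover have "card L = card I + card (L - I)"
    using I f by (metis PowD card_Diff_subset card_mono finite_subset le_add_diff_inverse)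
  ultimately show "L \<subseteq> {..<N} \<and> card L = k + l" by auto
qed

text \<open>The defining equation lives in the one-dimensional top power, so it is one scalar
  equation for every \<open>\<alpha>\<close>. In terms of \<open>ext_dot\<close> it is solved by a
  multiple of \<open>star0\<close>, and the top pairing leaves no second solution.\<close>

lemma is_hodge_dual_iff:
  fixes \<gamma> :: "nat set \<Rightarrow> 'a::field"
  assumes G: "G \<in> carrier_mat (2 * m) (2 * m)" and vol: "vol \<in> ext_power (2 * m) (2 * m)"
    and \<gamma>: "\<gamma> \<in> ext_power (2 * m) m"
  shows "is_hodge_dual m G vol \<gamma> \<delta> \<longleftrightarrow>
    \<delta> = scale_fun (vol {..<2 * m}) (star0 (2 * m) (ext_map G \<gamma>))"
proof -
  let ?N = "{..<2 * m}"
  have sub: "fun_subspace (ext_power (2 * m) m :: (nat set \<Rightarrow> 'a) set)"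
    unfolding fv.subspace_def ext_power_def by (auto, (metis add.right_neutral subsetD lessThan_iff)+)
  have lin: "wedge \<alpha> (scale_fun (vol ?N) (star0 (2 * m) (ext_map G \<gamma>))) ?N =
      ext_bform G \<alpha> \<gamma> * vol ?N" for \<alpha>
  proof -
    have "wedge \<alpha> (scale_fun (vol ?N) (star0 (2 * m) (ext_map G \<gamma>))) ?N =
        vol ?N * wedge \<alpha> (star0 (2 * m) (ext_map G \<gamma>)) ?N"
      unfolding wedge_top by (simp add: sum_distrib_left mult_ac)
    then show ?thesis by (simp add: wedge_star0_top ext_bform_eq_dot[OF G] mult.commute)
  qed
  have top: "\<omega> = \<omega>'" if "\<omega> \<in> ext_power (2 * m) (2 * m)" "\<omega>' \<in> ext_power (2 * m) (2 * m)"
    "\<omega> ?N = \<omega>' ?N" for \<omega> \<omega>' :: "nat set \<Rightarrow> 'a"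
  proof
    fix L
    show "\<omega> L = \<omega>' L"
    proof (cases "L = ?N")
      case False
      then have "\<not> (L \<subseteq> ?N \<and> card L = 2 * m)" using card_subset_eq[of ?N L] by auto
      then have "\<omega> L = 0" "\<omega>' L = 0" using that by (auto simp: ext_power_def)
      then show ?thesis by simp
    qed (use that in simp)
  qed
  have vol_sc: "scale_fun c vol \<in> ext_power (2 * m) (2 * m)" for c
    using vol by (auto simp: ext_power_def)
  show ?thesis
  proof
    assume h: "is_hodge_dual m G vol \<gamma> \<delta>"
    show "\<delta> = scale_fun (vol ?N) (star0 (2 * m) (ext_map G \<gamma>))"
    proof (rule ext_space_eqI)
      show "\<delta> \<in> ext_space (2 * m)"
        using h ext_power_sub_space unfolding is_hodge_dual_def by blast
      show "scale_fun (vol ?N) (star0 (2 * m) (ext_map G \<gamma>)) \<in> ext_space (2 * m)"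
        by (intro fv.subspace_scale[OF subspace_ext_space] star0_in_space)
      fix I assume I: "I \<subseteq> ?N"
      show "wedge (ext_basis I) \<delta> ?N =
          wedge (ext_basis I) (scale_fun (vol ?N) (star0 (2 * m) (ext_map G \<gamma>))) ?N"
      proof (cases "card I = m")
        case True
        then have "(ext_basis I :: nat set \<Rightarrow> 'a) \<in> ext_power (2 * m) m"
          using I by (auto simp: ext_power_def ext_basis_def)
        then have "wedge (ext_basis I) \<delta> = scale_fun (ext_bform G (ext_basis I) \<gamma>) vol"
          using h by (simp add: is_hodge_dual_def)
        then show ?thesis by (simp add: lin)
      next
        \<comment> \<open>Hodge duality gives equations in degree \<open>m\<close> only. For other
          \<open>I\<close> the pairing reads a coordinate outside degree \<open>m\<close>, where
          both candidates vanish.\<close>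
        case False
        then have "card (?N - I) \<noteq> m"
          using I finite_subset[OF I] card_mono[of ?N I] by (simp add: card_Diff_subset)
        moreover have "scale_fun (vol ?N) (star0 (2 * m) (ext_map G \<gamma>)) \<in> ext_power (2 * m) m"
          by (intro fv.subspace_scale[OF sub] star0_in_power ext_map_in_power G \<gamma>)
        moreover have "\<delta> \<in> ext_power (2 * m) m" using h by (simp add: is_hodge_dual_def)
        ultimately have "\<delta> (?N - I) = 0"
          "scale_fun (vol ?N) (star0 (2 * m) (ext_map G \<gamma>)) (?N - I) = 0"
          unfolding ext_power_def by blast+
        then show ?thesis unfolding wedge_top_basis[OF I] by simp
      qed
    qed
  next
    assume d: "\<delta> = scale_fun (vol ?N) (star0 (2 * m) (ext_map G \<gamma>))"
    have \<delta>: "\<delta> \<in> ext_power (2 * m) m"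
      unfolding d by (intro fv.subspace_scale[OF sub] star0_in_power ext_map_in_power G \<gamma>)
    moreover have "wedge \<alpha> \<delta> = scale_fun (ext_bform G \<alpha> \<gamma>) vol" if "\<alpha> \<in> ext_power (2 * m) m" for \<alpha>
      using wedge_in_power[OF that \<delta>] vol_sc lin[of \<alpha>]
      by (intro top) (auto simp: d mult_2)
    ultimately show "is_hodge_dual m G vol \<gamma> \<delta>" by (simp add: is_hodge_dual_def)
  qed
qed


subsection \<open>The symbol polynomial\<close>

lemma coeff_symbol_poly:
  "coeff (symbol_poly m a) k = skew_ext m a (int k - int m)"
proof -
  have "coeff (symbol_poly m a) k =
      (\<Sum>s = - int m..int m. if s = int k - int m then skew_ext m a s else 0)"
    unfolding symbol_poly_def coeff_sum coeff_monom by (intro sum.cong) auto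
  also have "\<dots> = (if int k - int m \<in> {- int m..int m} then skew_ext m a (int k - int m) else 0)"
    by simp
  also have "\<dots> = skew_ext m a (int k - int m)"
    by (auto simp: skew_ext_def)
  finally show ?thesis .
qed

lemma degree_symbol_poly:
  assumes "a m \<noteq> 0" "m \<ge> 1"
  shows "degree (symbol_poly m a) = 2 * m" "lead_coeff (symbol_poly m a) = a m"
proof -
  show d: "degree (symbol_poly m a) = 2 * m"
  proof (rule antisym)
    show "degree (symbol_poly m a) \<le> 2 * m"
      by (rule degree_le) (auto simp: coeff_symbol_poly skew_ext_def)
    show "2 * m \<le> degree (symbol_poly m a)"
      using assms by (intro le_degree) (auto simp: coeff_symbol_poly skew_ext_def)
  qed
  show "lead_coeff (symbol_poly m a) = a m"
    unfolding d using assms by (auto simp: coeff_symbol_poly skew_ext_def)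
qed

text \<open>The self-inverse roots 1 and -1 take the indices 0 and 1, and the pair of
  \<open>x i\<close> takes \<open>2 * i\<close> and \<open>2 * i + 1\<close>. Sets of roots thereby
  become index sets of the exterior algebra in the eigenbasis.\<close>

definition root_at :: "(nat \<Rightarrow> 'a::field) \<Rightarrow> nat \<Rightarrow> 'a"
  where "root_at x k = (if k = 0 then 1 else if k = 1 then -1
    else if even k then x (k div 2) else inverse (x (k div 2)))"

text \<open>Inversion of roots on the level of indices; the fixed points 0 and 1 are the indices of
  the self-inverse roots.\<close>

definition partner :: "nat \<Rightarrow> nat"
  where "partner k = (if k < 2 then k else if even k then Suc k else k - 1)"

lemma partner_partner [simp]: "partner (partner k) = k"
  by (auto simp: partner_def elim!: oddE)

lemma partner_less: "k < 2 * m \<Longrightarrow> partner k < 2 * m"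
  by (auto simp: partner_def elim!: evenE)

lemma partner_0 [simp]: "partner 0 = 0"
  by (simp add: partner_def)

lemma inj_partner: "inj partner"
  by (metis injI partner_partner)

lemma root_at_even: "i \<ge> 1 \<Longrightarrow> root_at x (2 * i) = x i"
  by (simp add: root_at_def)

lemma root_at_odd: "i \<ge> 1 \<Longrightarrow> root_at x (Suc (2 * i)) = inverse (x i)"
  by (simp add: root_at_def)

lemma prod_pairs: "(\<Prod>k<2 * n. f k) = (\<Prod>i<n. f (2 * i) * f (Suc (2 * i)))"
  for f :: "nat \<Rightarrow> 'b::comm_monoid_mult"
  by (induction n) (simp_all add: mult_ac)

lemma sum_pairs: "(\<Sum>k<2 * n. f k) = (\<Sum>i<n. f (2 * i) + f (Suc (2 * i)))"
  for f :: "nat \<Rightarrow> 'b::comm_monoid_add"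
  by (induction n) (simp_all add: add_ac)

lemma lessThan_eq_insert_0: "m \<ge> 1 \<Longrightarrow> {..<m} = insert 0 {1..<m}" for m :: nat
  by auto

lemma ball_pairs: "(\<forall>k<2 * m. P k) \<longleftrightarrow> (\<forall>i<m. P (2 * i) \<and> P (Suc (2 * i)))"
proof
  assume r: "\<forall>i<m. P (2 * i) \<and> P (Suc (2 * i))"
  show "\<forall>k<2 * m. P k"
  proof (intro allI impI)
    fix k assume "k < 2 * m"
    then have "k div 2 < m" by auto
    with r have "P (2 * (k div 2))" "P (Suc (2 * (k div 2)))" by auto
    then show "P k" by (cases "even k") (simp_all add: odd_two_times_div_two_succ)
  qed
qed auto

lemma prod_root_factors:
  assumes "m \<ge> 1"
  shows "(\<Prod>k<2 * m. [:- root_at x k, 1:]) =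
    [:-1, 0, 1:] * (\<Prod>i=1..<m. [:- x i, 1:] * [:- inverse (x i), 1:])"
proof -
  let ?f = "\<lambda>k. [:- root_at x k, 1:]"
  have "(\<Prod>k<2 * m. ?f k) = ?f 0 * ?f 1 * (\<Prod>i=1..<m. ?f (2 * i) * ?f (Suc (2 * i)))"
    unfolding prod_pairs lessThan_eq_insert_0[OF assms] by (subst prod.insert) simp_all
  also have "?f 0 * ?f 1 = [:-1, 0, 1:]" by (simp add: root_at_def)
  also have "(\<Prod>i=1..<m. ?f (2 * i) * ?f (Suc (2 * i))) =
      (\<Prod>i=1..<m. [:- x i, 1:] * [:- inverse (x i), 1:])"
    by (intro prod.cong) (simp_all only: atLeastLessThan_iff root_at_even root_at_odd)
  finally show ?thesis .
qed

lemma root_pairs_iff: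
  assumes "m \<ge> 1"
  shows "root_pairs m a x \<longleftrightarrow> (\<forall>i\<in>{1..<m}. x i \<noteq> 0) \<and>
    symbol_poly m a = smult (a m) (\<Prod>k<2 * m. [:- root_at x k, 1:])"
  unfolding root_pairs_def prod_root_factors[OF assms] ..

text \<open>The index set reached from \<open>S\<close> by the star: the Gram matrix moves the
  monomial of \<open>S\<close> to the partners of \<open>S\<close>, and the coordinate star takes
  the complement.\<close>

definition partner_compl :: "nat \<Rightarrow> nat set \<Rightarrow> nat set"
  where "partner_compl m S = {..<2 * m} - partner ` S"

lemma partner_image_subset: "S \<subseteq> {..<2 * m} \<Longrightarrow> partner ` S \<subseteq> {..<2 * m}"
  using partner_less by auto

lemma partner_compl_subset: "partner_compl m S \<subseteq> {..<2 * m}"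
  by (auto simp: partner_compl_def)

lemma mem_partner_compl:
  "k \<in> partner_compl m S \<longleftrightarrow> k < 2 * m \<and> partner k \<notin> S"
  unfolding partner_compl_def by (auto simp: image_iff)

lemma partner_compl_twice: "S \<subseteq> {..<2 * m} \<Longrightarrow> partner_compl m (partner_compl m S) = S"
  using partner_less by (auto simp: mem_partner_compl)

lemma card_partner_image: "card (partner ` S) = card S"
  by (intro card_image inj_on_subset[OF inj_partner]) auto

lemma card_partner_compl:
  assumes "S \<subseteq> {..<2 * m}" "card S = m"
  shows "card (partner_compl m S) = m"
  unfolding partner_compl_def using assms partner_image_subset[OF assms(1)]
    finite_subset[OF assms(1)]
  by (subst card_Diff_subset) (auto simp: card_partner_image)

definition middle_sets :: "nat \<Rightarrow> nat set set"
  where "middle_sets m = {S. S \<subseteq> {..<2 * m} \<and> card S = m}"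

lemma finite_middle_sets: "finite (middle_sets m)"
  by (rule finite_subset[of _ "Pow {..<2 * m}"]) (auto simp: middle_sets_def)

lemma partner_compl_middle: "S \<in> middle_sets m \<Longrightarrow> partner_compl m S \<in> middle_sets m"
  by (simp add: middle_sets_def card_partner_compl partner_compl_subset)

lemma partner_compl_middle_twice: "S \<in> middle_sets m \<Longrightarrow> partner_compl m (partner_compl m S) = S"
  by (simp add: middle_sets_def partner_compl_twice)

lemma zero_mem_partner_compl:
  "m \<ge> 1 \<Longrightarrow> 0 \<in> partner_compl m S \<longleftrightarrow> 0 \<notin> S"
  by (simp add: mem_partner_compl)

lemma ext_power_middle: "ext_power (2 * m) m = {\<omega>. \<forall>S. \<omega> S \<noteq> 0 \<longrightarrow> S \<in> middle_sets m}"
  by (auto simp: ext_power_def middle_sets_def)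

lemma subspace_ext_power: "fun_subspace (ext_power N k)"
  unfolding fv.subspace_def ext_power_def by (auto, (metis add.right_neutral subsetD lessThan_iff)+)


subsection \<open>Wedges of multiples of basis vectors\<close>

lemma vmul_smult: "vmul (c \<cdot>\<^sub>v v) \<omega> = scale_fun c (vmul v \<omega>)"
  by (simp add: vmul_def fv.scale_sum_right)

lemma lmul_ext_basis:
  assumes "finite A" "b \<notin> A"
  shows "\<exists>c. lmul b (ext_basis A) = scale_fun c (ext_basis (insert b A))"
  using lm.op_word[OF assms(1), of b "ext_basis {}"] assms by (auto simp: lm_word_one)

lemma wedge_list_smult:
  fixes s :: "nat \<Rightarrow> 'a::field"
  assumes "\<And>k. k \<in> set ks \<Longrightarrow> p k < N"
  shows "wedge_list (map (\<lambda>k. s k \<cdot>\<^sub>v unit_vec N (p k)) ks) =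
    scale_fun (\<Prod>k\<leftarrow>ks. s k) (foldr lmul (map p ks) (ext_basis {}))"
  using assms unfolding wedge_list_conv
  by (induction ks) (auto simp: vmul_smult vmul_unit_vec flinear_scale[OF flinear_lmul])

lemma foldr_lmul_one:
  "distinct ks \<Longrightarrow>
    \<exists>c::'a::field. foldr lmul ks (ext_basis {}) = scale_fun c (ext_basis (set ks))"
proof (induction ks)
  case Nil
  have "foldr lmul [] (ext_basis {}) = scale_fun 1 (ext_basis (set []))" by simp
  then show ?case by blast
next
  case (Cons k ks)
  then obtain c :: 'a where c: "foldr lmul ks (ext_basis {}) = scale_fun c (ext_basis (set ks))"
    by (metis distinct.simps(2))
  obtain d :: 'a where "lmul k (ext_basis (set ks)) = scale_fun d (ext_basis (insert k (set ks)))"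
    using lmul_ext_basis[of "set ks" k] Cons.prems by auto
  then have "foldr lmul (k # ks) (ext_basis {}) = scale_fun (c * d) (ext_basis (set (k # ks)))"
    using c by (simp add: flinear_scale[OF flinear_lmul])
  then show ?case by blast
qed

text \<open>The constant is the product of the \<open>s k\<close> times a sorting sign. It stays
  existential because the coefficients of the star are controlled later through
  \<open>hc_mult\<close>.\<close>

lemma wedge_list_monomial:
  fixes s :: "nat \<Rightarrow> 'a::field"
  assumes "distinct ks" "inj_on p (set ks)" "\<And>k. k \<in> set ks \<Longrightarrow> p k < N"
  shows "\<exists>c. wedge_list (map (\<lambda>k. s k \<cdot>\<^sub>v unit_vec N (p k)) ks) =
    scale_fun c (ext_basis (p ` set ks))"
proof -
  obtain c where "foldr lmul (map p ks) (ext_basis {}) = scale_fun c (ext_basis (p ` set ks) :: nat set \<Rightarrow> 'a)"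
    using foldr_lmul_one[of "map p ks", where 'a = 'a] assms by (auto simp: distinct_map)
  then have "wedge_list (map (\<lambda>k. s k \<cdot>\<^sub>v unit_vec N (p k)) ks) =
      scale_fun (\<Prod>k\<leftarrow>ks. s k) (scale_fun c (ext_basis (p ` set ks)))"
    using assms(3) by (simp only: wedge_list_smult)
  then show ?thesis by (metis fv.scale_scale)
qed

lemma star0_ext_basis:
  assumes "S \<subseteq> {..<N}"
  shows "star0 N (ext_basis S) = scale_fun (compl_sign N S) (ext_basis ({..<N} - S))"
proof
  fix K
  show "star0 N (ext_basis S) K = scale_fun (compl_sign N S) (ext_basis ({..<N} - S)) K"
  proof (cases "K = {..<N} - S")
    case True
    then have "{..<N} - K = S" using assms by auto
    then show ?thesis using True by (simp add: star0_def ext_basis_def)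
  next
    case False
    then have "K \<subseteq> {..<N} \<Longrightarrow> {..<N} - K \<noteq> S" by auto
    then show ?thesis using False by (simp add: star0_def ext_basis_def)
  qed
qed


subsection \<open>The eigenbasis of the companion matrix\<close>

lemma mult_mat_zero_vec:
  fixes A :: "'a::field mat"
  shows "A \<in> carrier_mat n k \<Longrightarrow> A *\<^sub>v 0\<^sub>v k = 0\<^sub>v n"
  by (intro eq_vecI) (auto simp: scalar_prod_def)

lemma adj_mat_inverse:
  fixes A :: "'a::field mat"
  assumes "A \<in> carrier_mat n n" "det A \<noteq> 0"
  shows "\<exists>B\<in>carrier_mat n n. A * B = 1\<^sub>m n \<and> B * A = 1\<^sub>m n"
proof (intro bexI conjI)
  note adj = adj_mat[OF assms(1)]
  show "inverse (det A) \<cdot>\<^sub>m adj_mat A \<in> carrier_mat n n" using adj by simp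
  show "A * (inverse (det A) \<cdot>\<^sub>m adj_mat A) = 1\<^sub>m n"
    using adj assms by (simp add: mult_smult_distrib[OF assms(1) adj(1)]) (auto intro!: eq_matI)
  show "(inverse (det A) \<cdot>\<^sub>m adj_mat A) * A = 1\<^sub>m n"
    using adj assms by (simp add: mult_smult_assoc_mat[OF adj(1) assms(1)]) (auto intro!: eq_matI)
qed

lemma companion_q_carrier:
  "a m \<noteq> 0 \<Longrightarrow> m \<ge> 1 \<Longrightarrow> companion_q m a \<in> carrier_mat (2 * m) (2 * m)"
  by (simp add: companion_q_def companion_def degree_symbol_poly)

text \<open>A nonzero kernel vector would be the coefficient vector of a nonzero polynomial of
  degree below \<open>n\<close> with \<open>n\<close> distinct roots.\<close>

lemma det_vandermonde:
  fixes y :: "nat \<Rightarrow> 'a::field"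
  assumes "inj_on y {..<n}"
  shows "det (mat n n (\<lambda>(k, j). y k ^ j)) \<noteq> 0"
proof
  let ?V = "mat n n (\<lambda>(k, j). y k ^ j)"
  assume "det ?V = 0"
  then obtain u where u: "u \<in> carrier_vec n" "u \<noteq> 0\<^sub>v n" "?V *\<^sub>v u = 0\<^sub>v n"
    using det_0_iff_vec_prod_zero_field[of ?V n] by auto
  define p where "p = (\<Sum>j<n. monom (u $ j) j)"
  have c: "coeff p j = (if j < n then u $ j else 0)" for j
    by (simp add: p_def coeff_sum if_distrib cong: if_cong)
  have "poly p (y k) = 0" if "k < n" for k
  proof -
    have "poly p (y k) = (\<Sum>j<n. y k ^ j * u $ j)"
      by (simp add: p_def poly_sum poly_monom mult.commute)
    also have "\<dots> = (?V *\<^sub>v u) $ k"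
      using that u(1) by (simp add: scalar_prod_def atLeast0LessThan)
    finally show ?thesis using u(3) that by simp
  qed
  moreover have p0: "p \<noteq> 0"
  proof
    assume "p = 0"
    then have "u $ j = 0" if "j < n" for j using c[of j] that by simp
    then have "u = 0\<^sub>v n" using u(1) by auto
    with u(2) show False by simp
  qed
  ultimately have "card (y ` {..<n}) \<le> card {z. poly p z = 0}"
    by (intro card_mono poly_roots_finite) auto
  then have "n \<le> degree p"
    using card_poly_roots_bound[OF p0] by (simp add: card_image assms)
  moreover have "coeff p (degree p) \<noteq> 0" using p0 by simp
  ultimately show False using c[of "degree p"] by simp
qed

locale skew_symbol =
  fixes m :: nat and a :: "nat \<Rightarrow> 'a::alg_closed_field" and x :: "nat \<Rightarrow> 'a"
  assumes m: "m \<ge> 1" and adm: "admissible m a" and rp: "root_pairs m a x"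
begin

abbreviation ev :: "nat \<Rightarrow> 'a" where "ev \<equiv> root_at x"

lemma am: "a m \<noteq> 0"
  using adm by (simp add: admissible_def)

lemma x_nonzero: "i \<in> {1..<m} \<Longrightarrow> x i \<noteq> 0"
  using rp by (simp add: root_pairs_def)

lemma symbol_factor: "symbol_poly m a = smult (a m) (\<Prod>k<2 * m. [:- ev k, 1:])"
  using rp m by (simp add: root_pairs_iff)

lemma roots: "{z. poly (symbol_poly m a) z = 0} = ev ` {..<2 * m}"
  using am by (auto simp: symbol_factor poly_prod)

lemma inj_ev: "inj_on ev {..<2 * m}"
  using adm by (intro eq_card_imp_inj_on) (auto simp: admissible_def roots)

lemma ev_eq_iff: "k < 2 * m \<Longrightarrow> l < 2 * m \<Longrightarrow> ev k = ev l \<longleftrightarrow> k = l"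
  using inj_ev by (auto simp: inj_on_def)

lemma ev_partner: "k < 2 * m \<Longrightarrow> ev k * ev (partner k) = 1"
proof -
  have "\<forall>k<2 * m. ev k * ev (partner k) = 1"
    unfolding ball_pairs
  proof (intro allI impI)
    fix i assume "i < m"
    then show "ev (2 * i) * ev (partner (2 * i)) = 1 \<and>
        ev (Suc (2 * i)) * ev (partner (Suc (2 * i))) = 1"
      using x_nonzero[of i] by (cases "i = 0") (auto simp: partner_def root_at_def)
  qed
  then show "k < 2 * m \<Longrightarrow> ev k * ev (partner k) = 1" by blast
qed

lemma ev_nonzero: "k < 2 * m \<Longrightarrow> ev k \<noteq> 0"
  using ev_partner[of k] by auto

lemma ev_mult_eq_1_iff:
  assumes "k < 2 * m" "l < 2 * m"
  shows "ev k * ev l = 1 \<longleftrightarrow> l = partner k"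
proof
  assume "ev k * ev l = 1"
  then have "ev l = ev (partner k)"
    using ev_partner[OF assms(1)] ev_nonzero[OF assms(1)] by (metis mult_left_cancel)
  then show "l = partner k" using assms partner_less by (simp add: ev_eq_iff)
qed (simp add: ev_partner assms)

lemma prod_ev: "(\<Prod>k<2 * m. ev k) = -1"
proof -
  have "(\<Prod>k<2 * m. ev k) = ev 0 * ev 1 * (\<Prod>i=1..<m. ev (2 * i) * ev (Suc (2 * i)))"
    unfolding prod_pairs lessThan_eq_insert_0[OF m] by (subst prod.insert) simp_all
  also have "(\<Prod>i=1..<m. ev (2 * i) * ev (Suc (2 * i))) = 1"
    by (intro prod.neutral) (auto simp: root_at_even root_at_odd x_nonzero)
  finally show ?thesis by (simp add: root_at_def)
qed

text \<open>The product of all roots is split between \<open>partner_compl m S\<close> and the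
  partners of \<open>S\<close>, and the second factor is the inverse of the product over
  \<open>S\<close>.\<close>

lemma prod_ev_partner_compl:
  assumes "S \<subseteq> {..<2 * m}"
  shows "(\<Prod>k\<in>partner_compl m S. ev k) = - (\<Prod>k\<in>S. ev k)"
proof -
  have f: "finite S" using assms finite_subset by blast
  have "(\<Prod>k<2 * m. ev k) = (\<Prod>k\<in>partner_compl m S. ev k) * (\<Prod>k\<in>partner ` S. ev k)"
    unfolding partner_compl_def
    by (rule prod.subset_diff) (simp_all add: partner_image_subset[OF assms])
  also have "(\<Prod>k\<in>partner ` S. ev k) = (\<Prod>k\<in>S. ev (partner k))"
    by (rule prod.reindex_cong[of partner]) (auto intro: inj_on_subset[OF inj_partner])
  finally have e: "-1 = (\<Prod>k\<in>partner_compl m S. ev k) * (\<Prod>k\<in>S. ev (partner k))"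
    by (simp add: prod_ev)
  have "- (\<Prod>k\<in>S. ev k) = -1 * (\<Prod>k\<in>S. ev k)" by simp
  also have "\<dots> = (\<Prod>k\<in>partner_compl m S. ev k) * (\<Prod>k\<in>S. ev (partner k)) * (\<Prod>k\<in>S. ev k)"
    by (simp only: e)
  also have "\<dots> = (\<Prod>k\<in>partner_compl m S. ev k) * (\<Prod>k\<in>S. ev k * ev (partner k))"
    by (simp add: prod.distrib mult_ac)
  also have "(\<Prod>k\<in>S. ev k * ev (partner k)) = 1"
    using assms by (intro prod.neutral) (auto simp: ev_partner)
  finally show ?thesis by simp
qed

definition C :: "'a mat" where "C = companion_q m a"

text \<open>Its rows are left eigenvectors of the companion matrix, so the columns of its inverse
  \<open>Pm\<close> are right eigenvectors.\<close>

definition Vm :: "'a mat" where "Vm = mat (2 * m) (2 * m) (\<lambda>(k, j). ev k ^ j)"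

definition D :: "'a mat" where "D = mat (2 * m) (2 * m) (\<lambda>(k, l). if k = l then ev k else 0)"

lemma Vm_carrier [simp]: "Vm \<in> carrier_mat (2 * m) (2 * m)"
  by (simp add: Vm_def)

lemma D_carrier [simp]: "D \<in> carrier_mat (2 * m) (2 * m)"
  by (simp add: D_def)

lemma C_carrier [simp]: "C \<in> carrier_mat (2 * m) (2 * m)"
  unfolding C_def using am m by (rule companion_q_carrier)

lemma det_Vm: "det Vm \<noteq> 0"
  unfolding Vm_def by (rule det_vandermonde[OF inj_ev])

definition Pm :: "'a mat"
  where "Pm = (SOME B. B \<in> carrier_mat (2 * m) (2 * m) \<and> Vm * B = 1\<^sub>m (2 * m) \<and> B * Vm = 1\<^sub>m (2 * m))"

lemma Pm: "Pm \<in> carrier_mat (2 * m) (2 * m)" "Vm * Pm = 1\<^sub>m (2 * m)" "Pm * Vm = 1\<^sub>m (2 * m)"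
  using someI_ex[OF adj_mat_inverse[OF Vm_carrier det_Vm, unfolded Bex_def]]
  unfolding Pm_def by blast+

lemma Pm_carrier [simp]: "Pm \<in> carrier_mat (2 * m) (2 * m)"
  by (rule Pm)

text \<open>Column \<open>j\<close> of \<open>C\<close> holds the coefficients of
  \<open>z * z^j\<close> modulo the symbol, and a row of \<open>Vm\<close> evaluates polynomials at
  a root. Only the last column involves a reduction, and there the value is right because
  \<open>ev k\<close> is a root.\<close>

lemma Vm_C: "Vm * C = D * Vm"
proof (rule eq_matI)
  let ?p = "smult (inverse (a m)) (symbol_poly m a)"
  have dp: "degree ?p = 2 * m" using am m by (simp add: degree_symbol_poly)
  fix k j assume "k < dim_row (D * Vm)" "j < dim_col (D * Vm)"
  then have k: "k < 2 * m" and j: "j < 2 * m" by (simp_all add: D_def Vm_def)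
  have "(D * Vm) $$ (k, j) = (\<Sum>i<2 * m. (if k = i then ev k else 0) * ev i ^ j)"
    using k j by (simp add: D_def Vm_def scalar_prod_def atLeast0LessThan)
  also have "\<dots> = (\<Sum>i<2 * m. if i = k then ev k ^ Suc j else 0)"
    by (intro sum.cong) auto
  also have "\<dots> = ev k ^ Suc j" using k by simp
  finally have R: "(D * Vm) $$ (k, j) = ev k ^ Suc j" .
  have L: "(Vm * C) $$ (k, j) = (\<Sum>i<2 * m. ev k ^ i *
      (if Suc j = 2 * m then - coeff ?p i else if i = Suc j then 1 else 0))"
  proof -
    have "(Vm * C) $$ (k, j) = (\<Sum>i<2 * m. Vm $$ (k, i) * C $$ (i, j))"
      using k j carrier_matD[OF C_carrier] carrier_matD[OF Vm_carrier]
      by (simp add: scalar_prod_def atLeast0LessThan)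
    moreover have "C $$ (i, j) =
        (if Suc j = 2 * m then - coeff ?p i else if i = Suc j then 1 else 0)" if "i < 2 * m" for i
      unfolding C_def companion_q_def companion_def dp using that j by simp
    ultimately show ?thesis using k by (auto simp: Vm_def intro!: sum.cong)
  qed
  show "(Vm * C) $$ (k, j) = (D * Vm) $$ (k, j)"
  proof (cases "Suc j = 2 * m")
    case True
    have "poly ?p (ev k) = 0" using roots k by auto
    then have "(\<Sum>i\<le>2 * m. coeff ?p i * ev k ^ i) = 0"
      by (simp only: poly_altdef dp)
    moreover have "coeff ?p (2 * m) = 1"
      using am degree_symbol_poly[of a m] m by simp
    ultimately have "(\<Sum>i<2 * m. coeff ?p i * ev k ^ i) = - (ev k ^ (2 * m))"
      by (simp add: lessThan_Suc_atMost[symmetric] eq_neg_iff_add_eq_0)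
    then show ?thesis
      unfolding L R using True by (simp add: sum_negf mult.commute del: coeff_smult power_Suc)
  next
    case False
    then have "(Vm * C) $$ (k, j) = (\<Sum>i<2 * m. if i = Suc j then ev k ^ Suc j else 0)"
      unfolding L by (intro sum.cong) auto
    then show ?thesis using False j unfolding R by simp
  qed
qed (use C_carrier Vm_carrier D_carrier in \<open>auto simp del: C_carrier Vm_carrier D_carrier\<close>)

lemma C_factor: "C = Pm * (D * Vm)"
proof -
  have "Pm * (Vm * C) = (Pm * Vm) * C" by (rule assoc_mult_mat[of _ "2 * m" "2 * m" _ "2 * m" _ "2 * m", symmetric])
      (auto intro!: mult_carrier_mat[of _ _ "2 * m"])
  then show ?thesis using left_mult_one_mat[OF C_carrier] by (simp add: Vm_C Pm)
qed

lemma C_Pm: "C * Pm = Pm * D"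
proof -
  have "C * Pm = Pm * (D * Vm) * Pm" by (simp add: C_factor)
  also have "\<dots> = Pm * (D * Vm * Pm)" by (rule assoc_mult_mat[of _ "2 * m" "2 * m" _ "2 * m" _ "2 * m"])
      (auto intro!: mult_carrier_mat[of _ _ "2 * m"])
  also have "D * Vm * Pm = D * (Vm * Pm)" by (rule assoc_mult_mat[of _ "2 * m" "2 * m" _ "2 * m" _ "2 * m"])
      (auto intro!: mult_carrier_mat[of _ _ "2 * m"])
  also have "\<dots> = D" using right_mult_one_mat[OF D_carrier] by (simp add: Pm)
  finally show ?thesis .
qed

lemma col_D: "k < 2 * m \<Longrightarrow> col D k = ev k \<cdot>\<^sub>v unit_vec (2 * m) k"
  by (intro eq_vecI) (auto simp: D_def)

lemma Vm_col_Pm: "k < 2 * m \<Longrightarrow> Vm *\<^sub>v col Pm k = unit_vec (2 * m) k"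
  using col_mult2[OF Vm_carrier Pm_carrier, of k] by (simp add: Pm)

lemma Pm_Vm_vec: "v \<in> carrier_vec (2 * m) \<Longrightarrow> Pm *\<^sub>v (Vm *\<^sub>v v) = v"
  using assoc_mult_mat_vec[OF Pm_carrier Vm_carrier, of v] by (simp add: Pm)

lemma col_Pm_carrier [simp]: "col Pm k \<in> carrier_vec (2 * m)"
  using col_dim Pm_carrier by (metis carrier_matD(1))

lemma eigenvector_col_Pm:
  assumes "k < 2 * m"
  shows "eigenvector C (col Pm k) (ev k)"
proof -
  have "C *\<^sub>v col Pm k = col (Pm * D) k"
    using assms by (simp add: col_mult2[OF C_carrier Pm_carrier, symmetric] C_Pm)
  also have "\<dots> = Pm *\<^sub>v (ev k \<cdot>\<^sub>v unit_vec (2 * m) k)"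
    using assms by (simp add: col_mult2[OF Pm_carrier D_carrier] col_D)
  also have "\<dots> = ev k \<cdot>\<^sub>v col Pm k"
    using assms by (simp add: mult_mat_vec[OF Pm_carrier] mult_mat_unit_vec[OF Pm_carrier])
  finally have "C *\<^sub>v col Pm k = ev k \<cdot>\<^sub>v col Pm k" .
  moreover have "col Pm k \<noteq> 0\<^sub>v (2 * m)"
  proof
    assume "col Pm k = 0\<^sub>v (2 * m)"
    then have "unit_vec (2 * m) k = (0\<^sub>v (2 * m) :: 'a vec)"
      using Vm_col_Pm[OF assms] by (simp add: mult_mat_zero_vec[OF Vm_carrier])
    then show False using assms unit_vec_nonzero[of k "2 * m"] by simp
  qed
  ultimately show ?thesis using C_carrier unfolding eigenvector_def
    by (simp add: carrier_matD(1)[OF C_carrier])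
qed

text \<open>In the coordinates \<open>w = Vm v\<close> the matrix is diagonal with distinct entries,
  so a single coordinate of \<open>w\<close> survives. This reduces arbitrary eigenvectors, as they
  occur in \<open>weight_space\<close> and \<open>invariant_form\<close>, to the fixed
  basis.\<close>

lemma eigenvector_C:
  assumes "eigenvector C v l"
  obtains k s where "k < 2 * m" "s \<noteq> 0" "l = ev k" "v = s \<cdot>\<^sub>v col Pm k"
    "Vm *\<^sub>v v = s \<cdot>\<^sub>v unit_vec (2 * m) k"
proof -
  have v: "v \<in> carrier_vec (2 * m)" "v \<noteq> 0\<^sub>v (2 * m)" "C *\<^sub>v v = l \<cdot>\<^sub>v v"
    using assms unfolding eigenvector_def by (simp_all add: carrier_matD(1)[OF C_carrier])
  define w where "w = Vm *\<^sub>v v"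
  have w: "w \<in> carrier_vec (2 * m)" unfolding w_def using v(1) by (rule mult_mat_vec_carrier[OF Vm_carrier])
  have "D *\<^sub>v w = (Vm * C) *\<^sub>v v"
    unfolding w_def Vm_C by (rule assoc_mult_mat_vec[OF D_carrier Vm_carrier v(1), symmetric])
  also have "\<dots> = Vm *\<^sub>v (l \<cdot>\<^sub>v v)"
    using v by (simp add: assoc_mult_mat_vec[OF Vm_carrier C_carrier])
  also have "\<dots> = l \<cdot>\<^sub>v w" unfolding w_def using v(1) by (simp add: mult_mat_vec[OF Vm_carrier])
  finally have Dw: "D *\<^sub>v w = l \<cdot>\<^sub>v w" .
  have entry: "ev k * w $ k = l * w $ k" if "k < 2 * m" for k
  proof -
    have "(D *\<^sub>v w) $ k = (\<Sum>i<2 * m. (if k = i then ev k else 0) * w $ i)"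
      using that w by (simp add: D_def scalar_prod_def atLeast0LessThan)
    also have "\<dots> = (\<Sum>i<2 * m. if i = k then ev k * w $ k else 0)"
      by (intro sum.cong) auto
    finally have "(D *\<^sub>v w) $ k = ev k * w $ k" using that by simp
    then show ?thesis using that w Dw by auto
  qed
  have "w \<noteq> 0\<^sub>v (2 * m)"
  proof
    assume "w = 0\<^sub>v (2 * m)"
    then have "v = 0\<^sub>v (2 * m)" using Pm_Vm_vec[OF v(1)] by (simp add: w_def mult_mat_zero_vec[OF Pm_carrier])
    with v(2) show False by simp
  qed
  then obtain k where k: "k < 2 * m" "w $ k \<noteq> 0"
    using w by (metis carrier_vecD eq_vecI index_zero_vec)
  then have l: "l = ev k" using entry[OF k(1)] by simp
  have "w $ i = 0" if "i < 2 * m" "i \<noteq> k" for i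
    using entry[OF that(1)] that k l by (auto simp: ev_eq_iff)
  then have wk: "w = w $ k \<cdot>\<^sub>v unit_vec (2 * m) k"
    using w k by (intro eq_vecI) auto
  have "v = Pm *\<^sub>v w" using Pm_Vm_vec[OF v(1)] by (simp add: w_def)
  also have "Pm *\<^sub>v w = Pm *\<^sub>v (w $ k \<cdot>\<^sub>v unit_vec (2 * m) k)"
    by (rule arg_cong[OF wk])
  also have "\<dots> = w $ k \<cdot>\<^sub>v col Pm k"
    by (simp add: k mult_mat_vec[OF Pm_carrier] mult_mat_unit_vec[OF Pm_carrier])
  finally have "v = w $ k \<cdot>\<^sub>v col Pm k" .
  moreover have "Vm *\<^sub>v v = w $ k \<cdot>\<^sub>v unit_vec (2 * m) k"
    using wk unfolding w_def .
  ultimately show thesis by (rule that[OF k l])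
qed


subsection \<open>Coordinates in the eigenbasis\<close>

text \<open>\<open>Q\<close> leads from coordinates in the wedges of eigenvectors to standard
  coordinates, and \<open>Qi\<close> leads back.\<close>

abbreviation Q :: "(nat set \<Rightarrow> 'a) \<Rightarrow> nat set \<Rightarrow> 'a" where "Q \<equiv> ext_map Pm"

abbreviation Qi :: "(nat set \<Rightarrow> 'a) \<Rightarrow> nat set \<Rightarrow> 'a" where "Qi \<equiv> ext_map Vm"

abbreviation E :: "(nat set \<Rightarrow> 'a) set" where "E \<equiv> ext_power (2 * m) m"

lemma E_space: "\<omega> \<in> E \<Longrightarrow> \<omega> \<in> ext_space (2 * m)"
  using ext_power_sub_space by blast

lemma Q_Qi: "\<omega> \<in> ext_space (2 * m) \<Longrightarrow> Q (Qi \<omega>) = \<omega>"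
  by (simp add: ext_map_mult[OF Pm_carrier Vm_carrier, symmetric] Pm ext_map_id)

lemma Qi_Q: "\<omega> \<in> ext_space (2 * m) \<Longrightarrow> Qi (Q \<omega>) = \<omega>"
  by (simp add: ext_map_mult[OF Vm_carrier Pm_carrier, symmetric] Pm ext_map_id)

lemma Q_in_E: "\<omega> \<in> E \<Longrightarrow> Q \<omega> \<in> E"
  by (rule ext_map_in_power[OF Pm_carrier])

lemma Qi_in_E: "\<omega> \<in> E \<Longrightarrow> Qi \<omega> \<in> E"
  by (rule ext_map_in_power[OF Vm_carrier])

lemma Q_inj: "\<omega> \<in> ext_space (2 * m) \<Longrightarrow> \<omega>' \<in> ext_space (2 * m) \<Longrightarrow> Q \<omega> = Q \<omega>' \<longleftrightarrow> \<omega> = \<omega>'"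
  using Qi_Q by metis

lemma ext_map_D:
  assumes "\<omega> \<in> ext_space (2 * m)"
  shows "ext_map D \<omega> = (\<lambda>S. (\<Prod>k\<in>S. ev k) * \<omega> S)"
proof -
  have "ext_map D (ext_basis S) = scale_fun (\<Prod>k\<in>S. ev k) (ext_basis S)" if S: "S \<subseteq> {..<2 * m}" for S
  proof -
    have f: "finite S" using S finite_subset by blast
    have "ext_map D (ext_basis S) =
        wedge_list (map (\<lambda>k. ev k \<cdot>\<^sub>v unit_vec (2 * m) k) (sorted_list_of_set S))"
      using S f by (subst ext_map_basis) (auto simp: D_def[THEN arg_cong, of dim_col] col_D subset_iff
        intro!: arg_cong[of _ _ wedge_list])
    also have "\<dots> = scale_fun (\<Prod>k\<leftarrow>sorted_list_of_set S. ev k)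
        (foldr lmul (map (\<lambda>k. k) (sorted_list_of_set S)) (ext_basis {}))"
      using S f by (intro wedge_list_smult) auto
    also have "foldr lmul (map (\<lambda>k. k) (sorted_list_of_set S)) (ext_basis {}) = (ext_basis S :: nat set \<Rightarrow> 'a)"
      using lm_word_one[OF f] by (simp add: lm.word_def)
    also have "(\<Prod>k\<leftarrow>sorted_list_of_set S. ev k) = (\<Prod>k\<in>S. ev k)"
      using f by (simp add: prod.distinct_set_conv_list[symmetric])
    finally show ?thesis .
  qed
  then have "ext_map D \<omega> = (\<Sum>S\<in>Pow {..<2 * m}. scale_fun (\<omega> S) (scale_fun (\<Prod>k\<in>S. ev k) (ext_basis S)))"
    by (subst ext_space_expand[OF assms])
       (auto simp: flinear_sum[OF flinear_ext_map] flinear_scale[OF flinear_ext_map] intro!: sum.cong)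
  also have "\<dots> = (\<Sum>S\<in>Pow {..<2 * m}. scale_fun ((\<Prod>k\<in>S. ev k) * \<omega> S) (ext_basis S))"
    by (simp add: mult.commute)
  also have "\<dots> = (\<lambda>S. (\<Prod>k\<in>S. ev k) * \<omega> S)"
    using assms by (subst ext_space_expand[of "\<lambda>S. (\<Prod>k\<in>S. ev k) * \<omega> S" "2 * m"]) (auto simp: ext_space_def)
  finally show ?thesis .
qed

definition tau :: "nat set \<Rightarrow> 'a"
  where "tau S = (-1) ^ m * a m * (\<Prod>k\<in>S. ev k)"

lemma transfer_Q:
  assumes "\<omega> \<in> ext_space (2 * m)"
  shows "transfer m a (Q \<omega>) = Q (\<lambda>S. tau S * \<omega> S)"
proof -
  have "ext_map C (Q \<omega>) = ext_map (Pm * D) \<omega>"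
    by (simp add: ext_map_mult[OF C_carrier Pm_carrier, symmetric] C_Pm)
  also have "\<dots> = Q (\<lambda>S. (\<Prod>k\<in>S. ev k) * \<omega> S)"
    by (simp add: ext_map_mult[OF Pm_carrier D_carrier] ext_map_D[OF assms])
  finally have "transfer m a (Q \<omega>) = Q (scale_fun ((-1) ^ m * a m) (\<lambda>S. (\<Prod>k\<in>S. ev k) * \<omega> S))"
    by (simp add: transfer_def C_def flinear_scale[OF flinear_ext_map])
  then show ?thesis by (simp add: tau_def scale_fun_def mult.assoc)
qed

lemma tau_nonzero: "S \<subseteq> {..<2 * m} \<Longrightarrow> tau S \<noteq> 0"
  using am ev_nonzero finite_subset[of S "{..<2 * m}"] by (auto simp: tau_def)

lemma tau_partner_compl: "S \<subseteq> {..<2 * m} \<Longrightarrow> tau (partner_compl m S) = - tau S"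
  by (simp add: tau_def prod_ev_partner_compl)

end


lemma sum_of_bool_card: "finite A \<Longrightarrow> (\<Sum>i\<in>A. of_bool (P i)) = card {i\<in>A. P i}"
  by (simp add: of_bool_def sum.inter_filter[symmetric])

context skew_symbol
begin

lemma wedge_list_eigenvectors:
  assumes "length ls = n" "distinct ls" "list_all2 (eigenvector C) vs ls"
  shows "\<exists>c S. S \<subseteq> {..<2 * m} \<and> card S = n \<and> ev ` S = set ls \<and> wedge_list vs = Q (scale_fun c (ext_basis S))"
proof -
  have len: "length vs = n" using assms by (simp add: list_all2_lengthD)
  have "\<forall>j<n. \<exists>k s. k < 2 * m \<and> ls ! j = ev k \<and> Vm *\<^sub>v (vs ! j) = s \<cdot>\<^sub>v unit_vec (2 * m) k \<and>
      vs ! j \<in> carrier_vec (2 * m)"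
  proof (intro allI impI)
    fix j assume "j < n"
    then have e: "eigenvector C (vs ! j) (ls ! j)"
      using assms(1,3) len by (simp add: list_all2_conv_all_nth)
    then have "vs ! j \<in> carrier_vec (2 * m)"
      by (simp add: eigenvector_def carrier_matD(1)[OF C_carrier])
    with e show "\<exists>k s. k < 2 * m \<and> ls ! j = ev k \<and> Vm *\<^sub>v (vs ! j) = s \<cdot>\<^sub>v unit_vec (2 * m) k \<and>
      vs ! j \<in> carrier_vec (2 * m)"
      by (metis eigenvector_C)
  qed
  then obtain p s where ps: "\<And>j. j < n \<Longrightarrow> p j < 2 * m" "\<And>j. j < n \<Longrightarrow> ls ! j = ev (p j)"
    "\<And>j. j < n \<Longrightarrow> Vm *\<^sub>v (vs ! j) = s j \<cdot>\<^sub>v unit_vec (2 * m) (p j)"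
    "\<And>j. j < n \<Longrightarrow> vs ! j \<in> carrier_vec (2 * m)"
    by metis
  have vs_car: "set vs \<subseteq> carrier_vec (2 * m)"
    using ps(4) len by (auto simp: in_set_conv_nth)
  have inj: "inj_on p {..<n}"
  proof (rule inj_onI)
    fix i j assume "i \<in> {..<n}" "j \<in> {..<n}" "p i = p j"
    then show "i = j" using assms(1,2) ps(2) nth_eq_iff_index_eq[of ls i j] by simp
  qed
  have "map ((*\<^sub>v) Vm) vs = map (\<lambda>j. s j \<cdot>\<^sub>v unit_vec (2 * m) (p j)) [0..<n]"
    by (rule nth_equalityI) (auto simp: len ps)
  moreover obtain c where
    "wedge_list (map (\<lambda>j. s j \<cdot>\<^sub>v unit_vec (2 * m) (p j)) [0..<n]) = scale_fun c (ext_basis (p ` set [0..<n]))"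
    using wedge_list_monomial[of "[0..<n]" p "2 * m" s] inj ps(1) by (auto simp: atLeast0LessThan)
  ultimately have "Qi (wedge_list vs) = scale_fun c (ext_basis (p ` {..<n}))"
    by (simp add: ext_map_wedge_list[OF Vm_carrier vs_car] atLeast0LessThan)
  moreover have "wedge_list vs \<in> ext_space (2 * m)"
    using vs_car by (intro wedge_list_in_space) auto
  ultimately have "wedge_list vs = Q (scale_fun c (ext_basis (p ` {..<n})))"
    using Q_Qi by metis
  moreover have "ev ` p ` {..<n} = set ls"
    using ps(2) assms(1) by (force simp: set_conv_nth)
  ultimately show ?thesis
    using ps(1) by (intro exI[of _ c] exI[of _ "p ` {..<n}"]) (auto simp: card_image inj)
qed

lemma Q_basis_wedge_list:
  assumes "S \<subseteq> {..<2 * m}"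
  shows "Q (ext_basis S) = wedge_list (map (col Pm) (sorted_list_of_set S))"
    "list_all2 (eigenvector C) (map (col Pm) (sorted_list_of_set S)) (map ev (sorted_list_of_set S))"
    "distinct (map ev (sorted_list_of_set S))" "set (map ev (sorted_list_of_set S)) = ev ` S"
proof -
  have f: "finite S" using assms finite_subset by blast
  show "Q (ext_basis S) = wedge_list (map (col Pm) (sorted_list_of_set S))"
    using assms by (intro ext_map_basis) (simp add: carrier_matD(2)[OF Pm_carrier])
  show "list_all2 (eigenvector C) (map (col Pm) (sorted_list_of_set S)) (map ev (sorted_list_of_set S))"
    using assms f nth_mem[of _ "sorted_list_of_set S"]
    by (auto simp: list_all2_conv_all_nth subset_iff intro!: eigenvector_col_Pm)
  show "distinct (map ev (sorted_list_of_set S))"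
    using assms f inj_on_subset[OF inj_ev assms] by (simp add: distinct_map)
  show "set (map ev (sorted_list_of_set S)) = ev ` S" using f by simp
qed

section \<open>Weight spaces in eigenbasis coordinates\<close>

definition wt :: "nat set \<Rightarrow> nat \<Rightarrow> int"
  where "wt S = squared_weight m x (ev ` S)"

definition supported :: "nat set set \<Rightarrow> (nat set \<Rightarrow> 'a) set"
  where "supported F = {\<omega>. \<forall>S. \<omega> S \<noteq> 0 \<longrightarrow> S \<in> F}"

lemma E_supported: "E = supported (middle_sets m)"
  by (simp add: supported_def ext_power_middle)

lemma supported_mono: "F \<subseteq> F' \<Longrightarrow> supported F \<subseteq> supported F'"
  by (auto simp: supported_def)

lemma supported_expand:
  assumes "finite F" "\<omega> \<in> supported F"
  shows "\<omega> = (\<Sum>S\<in>F. scale_fun (\<omega> S) (ext_basis S))"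
proof
  fix J
  show "\<omega> J = (\<Sum>S\<in>F. scale_fun (\<omega> S) (ext_basis S)) J"
    using assms unfolding sum_fun_eval scale_fun_apply ext_basis_def supported_def
    by (auto simp: if_distrib[of "(*) _"] cong: if_cong)
qed

lemma subspace_supported: "fun_subspace (supported F)"
  unfolding fv.subspace_def supported_def by (auto, metis add.right_neutral)

definition weight_sets :: "(nat \<Rightarrow> int) \<Rightarrow> nat set set"
  where "weight_sets \<epsilon> = {S\<in>middle_sets m. wt S = \<epsilon>}"

lemma weight_sets_middle: "weight_sets \<epsilon> \<subseteq> middle_sets m"
  by (auto simp: weight_sets_def)

lemma weight_space_eq: "weight_space m a x \<epsilon> = Q ` supported (weight_sets \<epsilon>)"
proof
  have "fun_subspace (Q ` supported (weight_sets \<epsilon>))"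
    using fvp.linear_subspace_image[OF flinear_ext_map subspace_supported] .
  then show "weight_space m a x \<epsilon> \<subseteq> Q ` supported (weight_sets \<epsilon>)"
    unfolding weight_space_def
  proof (intro fv.span_minimal subsetI)
    fix w assume "w \<in> {wedge_list vs | vs ls. length ls = m \<and> distinct ls \<and>
       list_all2 (eigenvector (companion_q m a)) vs ls \<and> squared_weight m x (set ls) = \<epsilon>}"
    then obtain vs ls where h: "w = wedge_list vs" "length ls = m" "distinct ls"
      "list_all2 (eigenvector C) vs ls" "squared_weight m x (set ls) = \<epsilon>"
      unfolding C_def by blast
    then obtain c S where cS: "S \<subseteq> {..<2 * m}" "card S = m" "ev ` S = set ls"
      "wedge_list vs = Q (scale_fun c (ext_basis S))"
      using wedge_list_eigenvectors[of ls m vs] by metis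
    moreover have "scale_fun c (ext_basis S) \<in> supported (weight_sets \<epsilon>)"
      using cS h by (auto simp: supported_def ext_basis_def weight_sets_def middle_sets_def wt_def)
    ultimately show "w \<in> Q ` supported (weight_sets \<epsilon>)"
      using h(1) by blast
  qed
  show "Q ` supported (weight_sets \<epsilon>) \<subseteq> weight_space m a x \<epsilon>"
  proof safe
    fix \<omega> assume \<omega>: "\<omega> \<in> supported (weight_sets \<epsilon>)"
    have "Q \<omega> = (\<Sum>S\<in>weight_sets \<epsilon>. scale_fun (\<omega> S) (Q (ext_basis S)))"
      using finite_subset[OF weight_sets_middle finite_middle_sets]
      by (subst supported_expand[OF _ \<omega>])
         (auto simp: flinear_sum[OF flinear_ext_map] flinear_scale[OF flinear_ext_map])
    also have "\<dots> \<in> weight_space m a x \<epsilon>"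
      unfolding weight_space_def
    proof (intro fv.span_sum fv.span_scale fv.span_base CollectI)
      fix S assume "S \<in> weight_sets \<epsilon>"
      then have S: "S \<subseteq> {..<2 * m}" "card S = m" "wt S = \<epsilon>"
        by (auto simp: weight_sets_def middle_sets_def)
      note B = Q_basis_wedge_list[OF S(1)]
      show "\<exists>vs ls. Q (ext_basis S) = wedge_list vs \<and> length ls = m \<and> distinct ls \<and>
          list_all2 (eigenvector (companion_q m a)) vs ls \<and> squared_weight m x (set ls) = \<epsilon>"
        using B S finite_subset[OF S(1)] unfolding wt_def C_def[symmetric]
        by (intro exI[of _ "map (col Pm) (sorted_list_of_set S)"] exI[of _ "map ev (sorted_list_of_set S)"])
           simp
    qed
    finally show "Q \<omega> \<in> weight_space m a x \<epsilon>" .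
  qed
qed

lemma root_mem_image:
  assumes "i \<in> {1..<m}" "S \<subseteq> {..<2 * m}"
  shows "x i \<in> ev ` S \<longleftrightarrow> 2 * i \<in> S" "inverse (x i) \<in> ev ` S \<longleftrightarrow> Suc (2 * i) \<in> S"
proof -
  have "x i = ev (2 * i)" "inverse (x i) = ev (Suc (2 * i))"
    using assms(1) by (simp_all add: root_at_even root_at_odd)
  moreover have "2 * i < 2 * m" "Suc (2 * i) < 2 * m" using assms(1) by auto
  ultimately show "x i \<in> ev ` S \<longleftrightarrow> 2 * i \<in> S" "inverse (x i) \<in> ev ` S \<longleftrightarrow> Suc (2 * i) \<in> S"
    using inj_on_image_mem_iff[OF inj_ev _ assms(2)] by simp_all
qed

lemma wt_eq:
  assumes "S \<subseteq> {..<2 * m}"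
  shows "wt S = (\<lambda>i\<in>{1..<m}. of_bool (2 * i \<in> S) - of_bool (Suc (2 * i) \<in> S))"
  unfolding wt_def squared_weight_def
  by (intro restrict_ext) (auto simp: root_mem_image[OF _ assms])

lemma wt_ternary: "S \<subseteq> {..<2 * m} \<Longrightarrow> wt S \<in> ternary_weights m"
  by (auto simp: wt_eq ternary_weights_def)

text \<open>On each pair of reciprocal roots the membership values \<open>(p, q)\<close> become
  \<open>(1 - q, 1 - p)\<close>, with the same difference. Hence the star preserves every weight
  space.\<close>

lemma wt_partner_compl:
  assumes "S \<subseteq> {..<2 * m}"
  shows "wt (partner_compl m S) = wt S"
proof -
  have "2 * i \<in> partner_compl m S \<longleftrightarrow> Suc (2 * i) \<notin> S"
    "Suc (2 * i) \<in> partner_compl m S \<longleftrightarrow> 2 * i \<notin> S" if "i \<in> {1..<m}" for i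
    using that by (auto simp: mem_partner_compl partner_def)
  then show ?thesis
    unfolding wt_eq[OF assms] wt_eq[OF partner_compl_subset]
    by (intro restrict_ext) auto
qed

lemma weight_sets_partner_compl: "S \<in> weight_sets \<epsilon> \<Longrightarrow> partner_compl m S \<in> weight_sets \<epsilon>"
  using partner_compl_middle wt_partner_compl by (auto simp: weight_sets_def middle_sets_def)

lemma tau_square:
  assumes "S \<subseteq> {..<2 * m}"
  shows "tau S ^ 2 = weight_value m a x (wt S)"
proof -
  let ?g = "\<lambda>k. if k \<in> S then ev k ^ 2 else 1"
  have "(\<Prod>k\<in>S. ev k) ^ 2 = (\<Prod>k<2 * m. ?g k)"
    using assms by (subst prod.inter_restrict[symmetric])
      (auto simp: prod_power_distrib Int_absorb1)
  also have "\<dots> = ?g 0 * ?g 1 * (\<Prod>i=1..<m. ?g (2 * i) * ?g (Suc (2 * i)))"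
    unfolding prod_pairs lessThan_eq_insert_0[OF m] by (subst prod.insert) simp_all
  also have "?g 0 * ?g 1 = 1" by (simp add: root_at_def)
  also have "(\<Prod>i=1..<m. ?g (2 * i) * ?g (Suc (2 * i))) = (\<Prod>i=1..<m. x i powi (2 * wt S i))"
  proof (intro prod.cong refl)
    fix i assume i: "i \<in> {1..<m}"
    then have w: "wt S i = of_bool (2 * i \<in> S) - of_bool (Suc (2 * i) \<in> S)"
      and r: "ev (2 * i) = x i" "ev (Suc (2 * i)) = inverse (x i)"
      by (simp_all add: wt_eq[OF assms] root_at_even root_at_odd)
    have p: "x i powi 2 = x i ^ 2" "x i powi (-2) = inverse (x i) ^ 2"
      by (simp_all add: power_int_def power_inverse)
    have "x i ^ 2 * inverse (x i) ^ 2 = 1"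
      using x_nonzero[OF i] by (simp flip: power_mult_distrib)
    then show "?g (2 * i) * ?g (Suc (2 * i)) = x i powi (2 * wt S i)"
      using p by (cases "2 * i \<in> S"; cases "Suc (2 * i) \<in> S") (simp_all add: w r)
  qed
  finally show ?thesis
    by (simp add: tau_def weight_value_def power_mult_distrib flip: power_mult)
qed

end

text \<open>A basis vector \<open>e\<^sub>S\<close> of weight \<open>\<epsilon>\<close> is determined by the set of those pairs among the \<open>h\<close>
  pairs with \<open>\<epsilon>\<^sub>i = 0\<close> that are contained in \<open>S\<close>, together with \<open>S \<inter> {0, 1}\<close>; if \<open>0 \<in> S\<close>, then
  \<open>card S = m\<close> leaves \<open>h div 2\<close> such pairs and decides by parity whether \<open>1 \<in> S\<close>.\<close>

lemma (in skew_symbol) card_weight_sets_zero: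
  assumes \<epsilon>: "\<epsilon> \<in> ternary_weights m"
  shows "card {S\<in>weight_sets \<epsilon>. 0 \<in> S} = weight_mult m \<epsilon>"
proof -
  define Z where "Z = {i\<in>{1..<m}. \<epsilon> i = 0}"
  define s where "s = card {i\<in>{1..<m}. \<epsilon> i \<noteq> 0}"
  define h where "h = m - 1 - s"
  have "card {1..<m} = card (Z \<union> {i\<in>{1..<m}. \<epsilon> i \<noteq> 0})"
    by (rule arg_cong[of _ _ card]) (auto simp: Z_def)
  also have "\<dots> = card Z + s"
    unfolding s_def by (intro card_Un_disjoint) (auto simp: Z_def)
  finally have cZ: "card Z = h" "m = Suc (h + s)" using m by (auto simp: h_def)
  have fZ: "finite Z" by (simp add: Z_def)
  \<comment> \<open>The inverse of the map from \<open>S\<close> to its set of full pairs: pairs in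
    \<open>F\<close> are taken entirely, a pair of nonzero weight contributes the member that
    \<open>\<epsilon>\<close> selects, and the index 1 absorbs the parity of
    \<open>h\<close>.\<close>
  define build where "build F = {k. k < 2 * m \<and> (k = 0 \<or> k = 1 \<and> odd h \<or>
    k \<ge> 2 \<and> (k div 2 \<in> F \<or> \<epsilon> (k div 2) = (if even k then 1 else -1)))}" for F
  \<comment> \<open>Each of the \<open>s\<close> pairs of nonzero weight contributes one element,
    and each pair in \<open>Z\<close> contributes none or two.\<close>
  have card_eq: "card S = of_bool (0 \<in> S) + of_bool (1 \<in> S) + s + 2 * card {i\<in>Z. 2 * i \<in> S}"
    if S: "S \<subseteq> {..<2 * m}" and w: "wt S = \<epsilon>" for S
  proof -
    let ?g = "\<lambda>k. of_bool (k \<in> S) :: nat"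
    have e: "\<epsilon> i = of_bool (2 * i \<in> S) - of_bool (Suc (2 * i) \<in> S)" if "i \<in> {1..<m}" for i
      using that unfolding w[symmetric] wt_eq[OF S] by simp
    have "card S = (\<Sum>k<2 * m. ?g k)"
      using S by (subst sum_of_bool_card) (auto intro!: arg_cong[of _ _ card])
    also have "\<dots> = ?g 0 + ?g 1 + (\<Sum>i=1..<m. ?g (2 * i) + ?g (Suc (2 * i)))"
      unfolding sum_pairs lessThan_eq_insert_0[OF m] by (subst sum.insert) simp_all
    also have "(\<Sum>i=1..<m. ?g (2 * i) + ?g (Suc (2 * i))) =
        (\<Sum>i=1..<m. of_bool (\<epsilon> i \<noteq> 0) + 2 * of_bool (\<epsilon> i = 0 \<and> 2 * i \<in> S))"
      by (intro sum.cong) (auto simp: e)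
    also have "\<dots> = s + 2 * card {i\<in>Z. 2 * i \<in> S}"
    proof -
      have "(\<Sum>i=1..<m. of_bool (\<epsilon> i \<noteq> 0)) = s"
        unfolding s_def by (rule sum_of_bool_card) simp
      moreover have "(\<Sum>i=1..<m. of_bool (\<epsilon> i = 0 \<and> 2 * i \<in> S)) = card {i\<in>Z. 2 * i \<in> S}"
        by (subst sum_of_bool_card) (auto simp: Z_def intro!: arg_cong[of _ _ card])
      ultimately show ?thesis by (simp add: sum.distrib flip: sum_distrib_left)
    qed
    finally show ?thesis by simp
  qed
  have build_sub: "build F \<subseteq> {..<2 * m}" for F by (auto simp: build_def)
  have wt_build: "wt (build F) = \<epsilon>" if "F \<subseteq> Z" for F
  proof
    fix i
    show "wt (build F) i = \<epsilon> i"
    proof (cases "i \<in> {1..<m}")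
      case True
      then have "\<epsilon> i \<in> {-1, 0, 1}" using \<epsilon> by (auto simp: ternary_weights_def)
      moreover have "i \<in> F \<Longrightarrow> \<epsilon> i = 0" using that by (auto simp: Z_def)
      moreover have "2 * i \<in> build F \<longleftrightarrow> i \<in> F \<or> \<epsilon> i = 1" "Suc (2 * i) \<in> build F \<longleftrightarrow> i \<in> F \<or> \<epsilon> i = -1"
        using True by (auto simp: build_def)
      ultimately show ?thesis using True
        unfolding wt_eq[OF build_sub] by auto
    next
      case False
      then show ?thesis using \<epsilon> unfolding wt_eq[OF build_sub]
        by (auto simp: ternary_weights_def PiE_def extensional_def)
    qed
  qed
  have build_Z: "{i\<in>Z. 2 * i \<in> build F} = F" if "F \<subseteq> Z" for F
    using that by (auto simp: build_def Z_def)
  have "bij_betw (\<lambda>S. {i\<in>Z. 2 * i \<in> S}) {S\<in>weight_sets \<epsilon>. 0 \<in> S} {F. F \<subseteq> Z \<and> card F = h div 2}"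
  proof (rule bij_betw_byWitness[where f' = build])
    show "\<forall>F\<in>{F. F \<subseteq> Z \<and> card F = h div 2}. {i\<in>Z. 2 * i \<in> build F} = F"
      using build_Z by blast
    show "build ` {F. F \<subseteq> Z \<and> card F = h div 2} \<subseteq> {S\<in>weight_sets \<epsilon>. 0 \<in> S}"
    proof safe
      fix F assume F: "F \<subseteq> Z" "card F = h div 2"
      have 01: "0 \<in> build F" "1 \<in> build F \<longleftrightarrow> odd h" using m by (auto simp: build_def)
      then have "card (build F) = 1 + of_bool (odd h) + s + 2 * (h div 2)"
        using card_eq[OF build_sub wt_build[OF F(1)]] by (simp add: build_Z[OF F(1)] F(2))
      also have "\<dots> = m" using cZ(2) by (cases "even h") (auto elim!: evenE oddE)
      finally show "build F \<in> weight_sets \<epsilon>"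
        using build_sub wt_build[OF F(1)] by (simp add: weight_sets_def middle_sets_def)
      show "0 \<in> build F" by (fact 01)
    qed
    have *: "2 * card {i\<in>Z. 2 * i \<in> S} + of_bool (1 \<in> S) = h" if "S \<in> weight_sets \<epsilon>" "0 \<in> S" for S
    proof -
      have "S \<subseteq> {..<2 * m}" "wt S = \<epsilon>" "card S = m"
        using that(1) by (auto simp: weight_sets_def middle_sets_def)
      then show ?thesis using card_eq[of S] that(2) cZ(2) by simp
    qed
    show "(\<lambda>S. {i\<in>Z. 2 * i \<in> S}) ` {S\<in>weight_sets \<epsilon>. 0 \<in> S} \<subseteq> {F. F \<subseteq> Z \<and> card F = h div 2}"
    proof safe
      fix S assume "S \<in> weight_sets \<epsilon>" "0 \<in> S"
      from *[OF this] show "card {i\<in>Z. 2 * i \<in> S} = h div 2" by (auto split: if_splits)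
    qed
    show "\<forall>S\<in>{S\<in>weight_sets \<epsilon>. 0 \<in> S}. build {i\<in>Z. 2 * i \<in> S} = S"
    proof safe
      fix S k assume S: "S \<in> weight_sets \<epsilon>" "0 \<in> S"
      then have sub: "S \<subseteq> {..<2 * m}" and w: "wt S = \<epsilon>" by (auto simp: weight_sets_def middle_sets_def)
      have odd: "1 \<in> S \<longleftrightarrow> odd h" using *[OF S] by (auto split: if_splits)
      have e: "\<epsilon> i = of_bool (2 * i \<in> S) - of_bool (Suc (2 * i) \<in> S)" if "i \<in> {1..<m}" for i
        using that unfolding w[symmetric] wt_eq[OF sub] by simp
      have "\<forall>k<2 * m. k \<in> build {i\<in>Z. 2 * i \<in> S} \<longleftrightarrow> k \<in> S"
        unfolding ball_pairs
      proof (intro allI impI)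
        fix i assume "i < m"
        then show "(2 * i \<in> build {i\<in>Z. 2 * i \<in> S} \<longleftrightarrow> 2 * i \<in> S) \<and>
            (Suc (2 * i) \<in> build {i\<in>Z. 2 * i \<in> S} \<longleftrightarrow> Suc (2 * i) \<in> S)"
          using odd S(2) e[of i] by (cases "i = 0") (auto simp: build_def Z_def)
      qed
      then show "k \<in> build {i\<in>Z. 2 * i \<in> S} \<Longrightarrow> k \<in> S" "k \<in> S \<Longrightarrow> k \<in> build {i\<in>Z. 2 * i \<in> S}"
        using sub build_sub by blast+
    qed
  qed
  then have "card {S\<in>weight_sets \<epsilon>. 0 \<in> S} = card {F. F \<subseteq> Z \<and> card F = h div 2}"
    by (rule bij_betw_same_card)
  then show ?thesis
    using n_subsets[OF fZ, of "h div 2"] by (simp add: weight_mult_def cZ(1) h_def s_def Let_def)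
qed

text \<open>\<open>partner_compl\<close> exchanges the middle sets containing 0 with those avoiding
  it.\<close>

lemma card_middle_sets_zero:
  assumes "m \<ge> 1"
  shows "2 * card {S\<in>middle_sets m. 0 \<in> S} = 2 * m choose m"
proof -
  have "bij_betw (partner_compl m) {S\<in>middle_sets m. 0 \<in> S} {S\<in>middle_sets m. 0 \<notin> S}"
    using assms
    by (intro bij_betw_byWitness[where f' = "partner_compl m"])
       (auto simp: partner_compl_middle partner_compl_middle_twice zero_mem_partner_compl)
  then have "card {S\<in>middle_sets m. 0 \<in> S} = card {S\<in>middle_sets m. 0 \<notin> S}"
    by (rule bij_betw_same_card)
  moreover have "card (middle_sets m) = card ({S\<in>middle_sets m. 0 \<in> S} \<union> {S\<in>middle_sets m. 0 \<notin> S})"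
    by (rule arg_cong[of _ _ card]) auto
  moreover have "\<dots> = card {S\<in>middle_sets m. 0 \<in> S} + card {S\<in>middle_sets m. 0 \<notin> S}"
    using finite_middle_sets by (intro card_Un_disjoint) auto
  moreover have "card (middle_sets m) = 2 * m choose m"
    unfolding middle_sets_def by (simp add: n_subsets)
  ultimately show ?thesis by simp
qed


subsection \<open>Operators that are diagonal in a basis\<close>

lemma prod_linear_dvd:
  fixes q :: "'a::field poly"
  assumes "finite L" "\<And>l. l \<in> L \<Longrightarrow> poly q l = 0"
  shows "(\<Prod>l\<in>L. [:- l, 1:]) dvd q"
  using assms
proof (induction L rule: finite_induct)
  case (insert l L)
  then obtain r where r: "q = (\<Prod>l\<in>L. [:- l, 1:]) * r" by (auto elim: dvdE)
  have "poly (\<Prod>l\<in>L. [:- l, 1:]) l \<noteq> 0"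
    using insert.hyps by (auto simp: poly_prod)
  then have "poly r l = 0" using insert.prems[of l] by (simp add: r)
  then have "[:- l, 1:] dvd r" by (simp add: poly_eq_0_iff_dvd)
  then show ?case unfolding r prod.insert[OF insert.hyps]
    by (subst mult.commute) (intro mult_dvd_mono dvd_refl)
qed simp

lemma degree_prod_linear: "degree (\<Prod>l\<in>L. [:- l, 1:] :: 'a::field poly) = card L"
  by (subst degree_prod_sum_eq) auto

lemma monic_prod_linear: "monic (\<Prod>l\<in>L. [:- l, 1:] :: 'a::field poly)"
  by (intro monic_prod) auto

text \<open>Every fibre of squaring on \<open>A\<close> is a pair \<open>{t, - t}\<close>, and its
  two members differ since \<open>t\<close> is nonzero and the characteristic is not 2.\<close>

lemma card_square_image:
  fixes A :: "'a::field set"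
  assumes "finite A" "\<And>t. t \<in> A \<Longrightarrow> - t \<in> A" "0 \<notin> A" "(1::'a) \<noteq> -1"
  shows "card A = 2 * card ((\<lambda>t. t ^ 2) ` A)"
proof -
  have "card A = (\<Sum>y\<in>(\<lambda>t. t ^ 2) ` A. card {t. t \<in> A \<and> t ^ 2 = y})"
    using sum.image_gen[OF assms(1), of "\<lambda>_. 1::nat" "\<lambda>t. t ^ 2"] by simp
  also have "\<dots> = (\<Sum>y\<in>(\<lambda>t. t ^ 2) ` A. 2)"
  proof (intro sum.cong refl)
    fix y assume "y \<in> (\<lambda>t. t ^ 2) ` A"
    then obtain t where t: "t \<in> A" "y = t ^ 2" by auto
    then have "{s. s \<in> A \<and> s ^ 2 = y} = {t, - t}"
      using assms(2) by (auto simp: power2_eq_iff)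
    moreover have "t \<noteq> - t"
    proof
      assume "t = - t"
      then have "t * 1 = t * -1" by simp
      then show False using assms(3,4) t(1) by (metis mult_left_cancel)
    qed
    ultimately show "card {t. t \<in> A \<and> t ^ 2 = y} = 2" by simp
  qed
  finally show ?thesis by simp
qed

lemma finite_ternary: "finite (ternary_weights k)"
  unfolding ternary_weights_def by (intro finite_PiE) auto

lemma card_ternary: "card (ternary_weights m) = 3 ^ (m - 1)"
  unfolding ternary_weights_def by (subst card_PiE) (auto simp: numeral_3_eq_3)

text \<open>The coordinate functions \<open>phi\<close> yield injectivity of \<open>b\<close> and
  independence of its image at once: applied to a combination, \<open>phi S\<close> returns the
  coefficient at \<open>S\<close>.\<close>

lemma fun_dim_eq_card_coords:
  assumes "finite F" "\<And>S. S \<in> F \<Longrightarrow> b S \<in> V"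
    and "\<And>v. v \<in> V \<Longrightarrow> \<exists>u. v = (\<Sum>S\<in>F. scale_fun (u S) (b S))"
    and coords: "\<And>u S. S \<in> F \<Longrightarrow> phi S (\<Sum>S\<in>F. scale_fun (u S) (b S)) = u S"
  shows "fun_dim V = card F"
proof (rule fv.dim_unique)
  have inj: "inj_on b F"
  proof (rule inj_onI)
    fix S S' assume S: "S \<in> F" "S' \<in> F" "b S = b S'"
    have sg: "(\<Sum>R\<in>F. scale_fun (if R = S then 1 else 0) (b R)) = b S" if "S \<in> F" for S
    proof -
      have "(\<Sum>R\<in>F. scale_fun (if R = S then 1 else 0) (b R)) = (\<Sum>R\<in>F. if R = S then b S else 0)"
        by (intro sum.cong) (auto simp: fun_eq_iff)
      then show ?thesis using that assms(1) by simp
    qed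
    have "phi S (b S) = 1" using coords[OF S(1), of "\<lambda>R. if R = S then 1 else 0"] sg[OF S(1)] by simp
    moreover have "phi S (b S') = (if S = S' then 1 else 0)"
      using coords[OF S(1), of "\<lambda>R. if R = S' then 1 else 0"] sg[OF S(2)] by simp
    ultimately show "S = S'" using S(3) by (simp split: if_splits)
  qed
  show "b ` F \<subseteq> V" using assms(2) by auto
  show "V \<subseteq> fv.span (b ` F)"
  proof
    fix v assume "v \<in> V"
    then obtain u where "v = (\<Sum>S\<in>F. scale_fun (u S) (b S))" using assms(3) by blast
    then show "v \<in> fv.span (b ` F)"
      by (simp only:) (intro fv.span_sum fv.span_scale fv.span_base, blast)
  qed
  show "fv.independent (b ` F)"
  proof (rule fv.independent_if_scalars_zero)
    show "finite (b ` F)" using assms(1) by simp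
    fix f w assume h: "(\<Sum>w\<in>b ` F. scale_fun (f w) w) = 0" "w \<in> b ` F"
    then obtain S where S: "S \<in> F" "w = b S" by auto
    have "(\<Sum>S\<in>F. scale_fun (f (b S)) (b S)) = 0"
      using h(1) by (simp add: sum.reindex[OF inj])
    moreover have "phi S 0 = 0"
      using coords[OF S(1), of "\<lambda>_. 0"] by simp
    ultimately show "f w = 0" using coords[OF S(1), of "\<lambda>S. f (b S)"] S(2) by simp
  qed
  show "card (b ` F) = card F" by (rule card_image[OF inj])
qed

context skew_symbol
begin

definition diag :: "(nat set \<Rightarrow> 'a) \<Rightarrow> (nat set \<Rightarrow> 'a) \<Rightarrow> nat set \<Rightarrow> 'a"
  where "diag d \<omega> = (\<lambda>S. d S * \<omega> S)"

lemma diag_in_E: "\<omega> \<in> E \<Longrightarrow> diag d \<omega> \<in> E"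
  by (auto simp: E_supported supported_def diag_def)

text \<open>Admissibility excludes characteristic 2, since 1 and -1 are two of the
  \<open>2 * m\<close> distinct roots.\<close>

lemma one_neq_minus_one: "(1::'a) \<noteq> -1"
  using ev_eq_iff[of 0 1] m by (simp add: root_at_def)

lemma transfer_diag: "\<omega> \<in> E \<Longrightarrow> transfer m a (Q \<omega>) = Q (diag tau \<omega>)"
  using transfer_Q[OF E_space] by (simp add: diag_def)

lemma transfer2_diag: "\<omega> \<in> E \<Longrightarrow> (transfer m a \<circ> transfer m a) (Q \<omega>) = Q (diag (\<lambda>S. tau S ^ 2) \<omega>)"
  by (simp add: transfer_diag diag_in_E) (simp add: diag_def power2_eq_square mult.assoc)

lemma funpow_diag:
  assumes "\<And>\<omega>. \<omega> \<in> E \<Longrightarrow> f (Q \<omega>) = Q (diag d \<omega>)" "\<omega> \<in> E"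
  shows "(f ^^ k) (Q \<omega>) = Q (diag (\<lambda>S. d S ^ k) \<omega>)"
proof (induction k)
  case (Suc k)
  then have "(f ^^ Suc k) (Q \<omega>) = Q (diag d (diag (\<lambda>S. d S ^ k) \<omega>))"
    using assms by (simp add: diag_in_E)
  then show ?case by (simp add: diag_def mult_ac)
qed (simp add: diag_def)

lemma poly_diag:
  assumes "\<And>\<omega>. \<omega> \<in> E \<Longrightarrow> f (Q \<omega>) = Q (diag d \<omega>)" "\<omega> \<in> E"
  shows "(\<Sum>k\<le>degree p. scale_fun (coeff p k) ((f ^^ k) (Q \<omega>))) = Q (diag (\<lambda>S. poly p (d S)) \<omega>)"
proof -
  have "(\<Sum>k\<le>degree p. scale_fun (coeff p k) ((f ^^ k) (Q \<omega>))) =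
      Q (\<Sum>k\<le>degree p. scale_fun (coeff p k) (diag (\<lambda>S. d S ^ k) \<omega>))"
    by (simp add: funpow_diag[OF assms] flinear_sum[OF flinear_ext_map] flinear_scale[OF flinear_ext_map])
  also have "(\<Sum>k\<le>degree p. scale_fun (coeff p k) (diag (\<lambda>S. d S ^ k) \<omega>)) = diag (\<lambda>S. poly p (d S)) \<omega>"
    by (rule ext) (simp add: sum_fun_eval diag_def poly_altdef sum_distrib_right mult.assoc)
  finally show ?thesis .
qed

text \<open>A Hodge half contains no basis monomials, so eigenvectors inside \<open>W\<close> are
  asked for instead: a nonzero vector of \<open>W\<close> supported where \<open>d\<close> takes the
  value \<open>l\<close> forces \<open>l\<close> to be a root of every annihilating
  polynomial.\<close>

lemma min_poly_diag:
  assumes f: "\<And>\<omega>. \<omega> \<in> E \<Longrightarrow> f (Q \<omega>) = Q (diag d \<omega>)" and "W \<subseteq> E" "finite L"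
    and val: "\<And>S. S \<in> middle_sets m \<Longrightarrow> d S \<in> L"
    and ex: "\<And>l. l \<in> L \<Longrightarrow> \<exists>\<eta>\<in>W. \<eta> \<noteq> 0 \<and> (\<forall>S. \<eta> S \<noteq> 0 \<longrightarrow> d S = l)"
  shows "is_min_poly_on (\<Prod>l\<in>L. [:- l, 1:]) f (Q ` W)"
  unfolding is_min_poly_on_def
proof (intro conjI allI impI)
  show "monic (\<Prod>l\<in>L. [:- l, 1:])" by (rule monic_prod_linear)
  show "annihilates_on (\<Prod>l\<in>L. [:- l, 1:]) f (Q ` W)"
    unfolding annihilates_on_def
  proof (intro ballI)
    fix w assume "w \<in> Q ` W"
    then obtain \<eta> where \<eta>: "\<eta> \<in> W" "w = Q \<eta>" by auto
    then have "\<eta> \<in> E" using assms(2) by blast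
    then have "diag (\<lambda>S. poly (\<Prod>l\<in>L. [:- l, 1:]) (d S)) \<eta> = 0"
      using val assms(3) by (auto simp: diag_def fun_eq_iff poly_prod E_supported supported_def)
    then show "(\<Sum>k\<le>degree (\<Prod>l\<in>L. [:- l, 1:]). scale_fun (coeff (\<Prod>l\<in>L. [:- l, 1:]) k) ((f ^^ k) w)) = 0"
      using poly_diag[OF f \<open>\<eta> \<in> E\<close>] \<eta>(2) by (simp add: flinear_0[OF flinear_ext_map])
  qed
  fix q assume q: "annihilates_on q f (Q ` W)"
  show "(\<Prod>l\<in>L. [:- l, 1:]) dvd q"
  proof (rule prod_linear_dvd[OF assms(3)])
    fix l assume "l \<in> L"
    then obtain \<eta> where \<eta>: "\<eta> \<in> W" "\<eta> \<noteq> 0" "\<And>S. \<eta> S \<noteq> 0 \<Longrightarrow> d S = l" using ex by blast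
    then have E: "\<eta> \<in> E" using assms(2) by blast
    have "Q (diag (\<lambda>S. poly q (d S)) \<eta>) = 0"
      using q \<eta>(1) poly_diag[OF f E, of q] by (simp add: annihilates_on_def)
    then have "Q (diag (\<lambda>S. poly q (d S)) \<eta>) = Q 0"
      by (simp add: flinear_0[OF flinear_ext_map])
    then have z: "diag (\<lambda>S. poly q (d S)) \<eta> = 0"
      using E_space[OF diag_in_E[OF E]] fv.subspace_0[OF subspace_ext_space]
      by (subst (asm) Q_inj) auto
    obtain S where S: "\<eta> S \<noteq> 0" using \<eta>(2) by (auto simp: fun_eq_iff)
    have "poly q (d S) * \<eta> S = 0" using fun_cong[OF z, of S] by (simp add: diag_def)
    then show "poly q l = 0" using S \<eta>(3)[OF S] by simp
  qed
qed

lemma weight_mult_pos: "weight_mult m \<epsilon> > 0"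
  by (simp add: weight_mult_def Let_def zero_less_binomial)

lemma weight_sets_nonempty:
  assumes "\<epsilon> \<in> ternary_weights m"
  obtains S where "S \<in> weight_sets \<epsilon>" "0 \<in> S"
proof -
  have "card {S\<in>weight_sets \<epsilon>. 0 \<in> S} > 0"
    by (simp add: card_weight_sets_zero[OF assms] weight_mult_pos)
  then have "{S\<in>weight_sets \<epsilon>. 0 \<in> S} \<noteq> {}" by (auto simp: card_gt_0_iff)
  then show thesis using that by blast
qed

lemma tau_square_weight: "S \<in> weight_sets \<epsilon> \<Longrightarrow> tau S ^ 2 = weight_value m a x \<epsilon>"
  by (auto simp: weight_sets_def middle_sets_def tau_square)

lemma tau_squares: "(\<lambda>S. tau S ^ 2) ` middle_sets m = weight_value m a x ` ternary_weights m"
proof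
  show "(\<lambda>S. tau S ^ 2) ` middle_sets m \<subseteq> weight_value m a x ` ternary_weights m"
    using wt_ternary tau_square by (auto simp: middle_sets_def)
  show "weight_value m a x ` ternary_weights m \<subseteq> (\<lambda>S. tau S ^ 2) ` middle_sets m"
  proof safe
    fix \<epsilon> assume "\<epsilon> \<in> ternary_weights m"
    then obtain S where "S \<in> weight_sets \<epsilon>" by (rule weight_sets_nonempty)
    then show "weight_value m a x \<epsilon> \<in> (\<lambda>S. tau S ^ 2) ` middle_sets m"
      using tau_square_weight[of S \<epsilon>] weight_sets_middle[of \<epsilon>] by (intro image_eqI[of _ _ S]) auto
  qed
qed

text \<open>Taking \<open>partner_compl\<close> negates \<open>tau\<close>, so the eigenvalues of
  the transfer come in pairs of opposite sign and are twice as many as their squares.\<close>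

lemma transfer_min_poly:
  obtains p where "is_min_poly_on p (transfer m a) E"
    "degree p = 2 * card (weight_value m a x ` ternary_weights m)"
proof
  let ?L = "tau ` middle_sets m"
  have "Q ` E = E"
  proof
    show "Q ` E \<subseteq> E" using Q_in_E by blast
    show "E \<subseteq> Q ` E"
    proof
      fix \<omega> assume "\<omega> \<in> E"
      then show "\<omega> \<in> Q ` E" using Qi_in_E Q_Qi[OF E_space] by (metis imageI)
    qed
  qed
  moreover have "is_min_poly_on (\<Prod>l\<in>?L. [:- l, 1:]) (transfer m a) (Q ` E)"
  proof (rule min_poly_diag[where d = tau])
    fix l assume "l \<in> ?L"
    then obtain S where S: "S \<in> middle_sets m" "l = tau S" by auto
    then show "\<exists>\<eta>\<in>E. \<eta> \<noteq> 0 \<and> (\<forall>S. \<eta> S \<noteq> 0 \<longrightarrow> tau S = l)"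
      by (intro bexI[of _ "ext_basis S"])
         (auto simp: ext_basis_def E_supported supported_def fun_eq_iff)
  qed (use finite_middle_sets transfer_diag in auto)
  ultimately show "is_min_poly_on (\<Prod>l\<in>?L. [:- l, 1:]) (transfer m a) E" by simp
  have "card ?L = 2 * card ((\<lambda>t. t ^ 2) ` ?L)"
  proof (rule card_square_image)
    fix t assume "t \<in> ?L"
    then obtain S where S: "S \<in> middle_sets m" "t = tau S" by auto
    then have "- t = tau (partner_compl m S)" by (simp add: middle_sets_def tau_partner_compl)
    then show "- t \<in> ?L" using partner_compl_middle[OF S(1)] by simp
  qed (use finite_middle_sets tau_nonzero one_neq_minus_one in \<open>auto simp: middle_sets_def\<close>)
  then show "degree (\<Prod>l\<in>?L. [:- l, 1:]) = 2 * card (weight_value m a x ` ternary_weights m)"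
    by (simp add: degree_prod_linear image_image tau_squares)
qed

end


subsection \<open>The Hodge star in the eigenbasis\<close>

locale skew_hodge = skew_symbol +
  fixes G :: "'a mat" and vol :: "nat set \<Rightarrow> 'a"
  assumes hd: "hodge_data m a G vol"
begin

lemma form: "invariant_form C G"
  using hd by (simp add: hodge_data_def C_def)

lemma G_carrier [simp]: "G \<in> carrier_mat (2 * m) (2 * m)"
  using form by (simp add: invariant_form_def carrier_matD[OF C_carrier])

lemma G_sym: "u \<in> carrier_vec (2 * m) \<Longrightarrow> v \<in> carrier_vec (2 * m) \<Longrightarrow> bform G u v = bform G v u"
  using form by (simp add: invariant_form_def carrier_matD[OF C_carrier])

lemma vol_E: "vol \<in> ext_power (2 * m) (2 * m)"
  using hd by (simp add: hodge_data_def)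

definition v where "v = vol {..<2 * m}"

lemma vol_square: "v * v * det G = 1"
proof -
  have z: "vol I = 0" if "I \<subseteq> {..<2 * m}" "I \<noteq> {..<2 * m}" for I
  proof (rule ccontr)
    assume "vol I \<noteq> 0"
    then have "card I = card {..<2 * m}" using vol_E by (auto simp: ext_power_def)
    then show False using that card_subset_eq[of "{..<2 * m}" I] by auto
  qed
  have "ext_bform G vol vol = (\<Sum>I\<in>Pow {..<2 * m}. vol I * ext_map G vol I)"
    by (simp add: ext_bform_eq_dot[OF G_carrier] ext_dot_def)
  also have "\<dots> = (\<Sum>I\<in>{{..<2 * m}}. vol I * ext_map G vol I)"
    by (rule sum.mono_neutral_right) (auto simp: z)
  also have "\<dots> = v * v * det G" by (simp add: v_def ext_map_top[OF G_carrier])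
  finally show ?thesis using hd by (simp add: hodge_data_def)
qed

text \<open>The Gram matrix of the form in the eigenbasis. Its nonzero entries are exactly those at
  partner pairs, so it permutes the basis vectors up to scalars.\<close>

definition Gp where "Gp = transpose_mat Pm * (G * Pm)"

lemma G_Pm_carrier [simp]: "G * Pm \<in> carrier_mat (2 * m) (2 * m)"
  by (rule mult_carrier_mat[OF G_carrier Pm_carrier])

lemma Gp_carrier [simp]: "Gp \<in> carrier_mat (2 * m) (2 * m)"
  unfolding Gp_def by (rule mult_carrier_mat[OF _ G_Pm_carrier]) simp

lemma Gp_entry:
  assumes "k < 2 * m" "l < 2 * m"
  shows "Gp $$ (k, l) = bform G (col Pm k) (col Pm l)"
proof -
  have "Gp $$ (k, l) = row (transpose_mat Pm) k \<bullet> col (G * Pm) l"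
    unfolding Gp_def using assms carrier_matD[OF Pm_carrier] carrier_matD[OF G_Pm_carrier]
    by (intro index_mult_mat) auto
  also have "row (transpose_mat Pm) k = col Pm k"
    using assms carrier_matD[OF Pm_carrier] by simp
  also have "col (G * Pm) l = G *\<^sub>v col Pm l"
    by (rule col_mult2[OF G_carrier Pm_carrier assms(2)])
  finally show ?thesis by (simp add: bform_def)
qed

lemma Gp_transpose: "transpose_mat Gp = Gp"
proof (rule eq_matI)
  fix k l assume "k < dim_row Gp" "l < dim_col Gp"
  then have "k < 2 * m" "l < 2 * m" using carrier_matD[OF Gp_carrier] by simp_all
  then show "transpose_mat Gp $$ (k, l) = Gp $$ (k, l)"
    using carrier_matD[OF Gp_carrier] by (simp add: Gp_entry G_sym)
qed (use carrier_matD[OF Gp_carrier] in auto)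

lemma Gp_zero_iff:
  assumes "k < 2 * m" "l < 2 * m"
  shows "Gp $$ (k, l) \<noteq> 0 \<longleftrightarrow> l = partner k"
proof -
  have "bform G (col Pm k) (col Pm l) \<noteq> 0 \<longleftrightarrow> ev k * ev l = 1"
    using form eigenvector_col_Pm[OF assms(1)] eigenvector_col_Pm[OF assms(2)]
    unfolding invariant_form_def by blast
  then show ?thesis using assms by (simp add: Gp_entry ev_mult_eq_1_iff)
qed

lemma col_Gp:
  assumes "k < 2 * m"
  shows "col Gp k = Gp $$ (partner k, k) \<cdot>\<^sub>v unit_vec (2 * m) (partner k)"
proof (rule eq_vecI)
  fix i assume "i < dim_vec (Gp $$ (partner k, k) \<cdot>\<^sub>v unit_vec (2 * m) (partner k))"
  then have i: "i < 2 * m" by simp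
  have "Gp $$ (i, k) = 0" if "i \<noteq> partner k"
    using Gp_zero_iff[OF i assms] that by auto
  then show "col Gp k $ i = (Gp $$ (partner k, k) \<cdot>\<^sub>v unit_vec (2 * m) (partner k)) $ i"
    using i assms carrier_matD[OF Gp_carrier] by (cases "i = partner k") (simp_all add: partner_less)
qed (use carrier_matD[OF Gp_carrier] in simp)

lemma G_Pm: "G * Pm = transpose_mat Vm * Gp"
proof -
  have "transpose_mat Vm * transpose_mat Pm = 1\<^sub>m (2 * m)"
    using transpose_mult[OF Pm_carrier Vm_carrier] by (simp add: Pm)
  then have "transpose_mat Vm * Gp = 1\<^sub>m (2 * m) * (G * Pm)"
    unfolding Gp_def
    using assoc_mult_mat[of "transpose_mat Vm" "2 * m" "2 * m" "transpose_mat Pm" "2 * m" "G * Pm" "2 * m"]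
    by simp
  then show ?thesis using left_mult_one_mat[OF G_Pm_carrier] by simp
qed

text \<open>The coefficient of \<open>vol\<close> in the eigenbasis: the change of coordinates
  multiplies the top coefficient by \<open>det Vm\<close>.\<close>

definition kappa where "kappa = v * det Vm"

lemma kappa_square: "kappa * kappa * det Gp = 1"
proof -
  have "det Gp = det Pm * (det G * det Pm)"
    unfolding Gp_def
    by (subst det_mult[of _ "2 * m"]) (simp_all add: det_transpose[OF Pm_carrier] det_mult[OF G_carrier Pm_carrier])
  moreover have "det Vm * det Pm = 1"
    using det_mult[OF Vm_carrier Pm_carrier] by (simp add: Pm)
  ultimately have "kappa * kappa * det Gp = (det Vm * det Pm) * (det Vm * det Pm) * (v * v * det G)"
    by (simp add: kappa_def mult_ac)
  then show ?thesis using \<open>det Vm * det Pm = 1\<close> by (simp add: vol_square)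
qed

lemma dual_iff:
  "\<gamma> \<in> E \<Longrightarrow> is_hodge_dual m G vol \<gamma> \<delta> \<longleftrightarrow> \<delta> = scale_fun v (star0 (2 * m) (ext_map G \<gamma>))"
  unfolding v_def by (rule is_hodge_dual_iff[OF G_carrier vol_E])

lemma hodge_star_eq: "\<gamma> \<in> E \<Longrightarrow> hodge_star m G vol \<gamma> = scale_fun v (star0 (2 * m) (ext_map G \<gamma>))"
  unfolding hodge_star_def using dual_iff by (intro the_equality) auto

definition star1 :: "(nat set \<Rightarrow> 'a) \<Rightarrow> nat set \<Rightarrow> 'a"
  where "star1 \<omega> = scale_fun kappa (star0 (2 * m) (ext_map Gp \<omega>))"

lemma flinear_star1: "flinear star1"
  unfolding star1_def
  by (intro flinearI) (simp_all add: flinear_add[OF flinear_ext_map] flinear_scale[OF flinear_ext_map]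
      flinear_add[OF flinear_star0] flinear_scale[OF flinear_star0] fv.scale_right_distrib mult.commute)

text \<open>By \<open>G_Pm\<close> the Gram matrix contributes the transpose of \<open>Vm\<close>.
  This is what \<open>star0_ext_map\<close> absorbs, leaving the factor \<open>det Vm\<close> that
  turns \<open>v\<close> into \<open>kappa\<close>.\<close>

lemma star_Q_star1:
  assumes "\<omega> \<in> E"
  shows "hodge_star m G vol (Q \<omega>) = Q (star1 \<omega>)"
proof -
  define \<eta> where "\<eta> = ext_map Gp \<omega>"
  have \<eta>: "\<eta> \<in> ext_space (2 * m)" unfolding \<eta>_def by (rule ext_map_in_space[OF Gp_carrier])
  have "ext_map G (Q \<omega>) = ext_map (G * Pm) \<omega>"
    by (simp add: ext_map_mult[OF G_carrier Pm_carrier])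
  also have "\<dots> = ext_map (transpose_mat Vm) \<eta>"
    unfolding G_Pm \<eta>_def by (rule ext_map_mult[of _ "2 * m" "2 * m" _ "2 * m"]) simp_all
  finally have 1: "ext_map G (Q \<omega>) = ext_map (transpose_mat Vm) \<eta>" .
  have "Q (scale_fun (det Vm) (star0 (2 * m) \<eta>)) = Q (Qi (star0 (2 * m) (ext_map (transpose_mat Vm) \<eta>)))"
    using star0_ext_map[OF Vm_carrier Pm_carrier Pm(2) \<eta>] by simp
  also have "\<dots> = star0 (2 * m) (ext_map (transpose_mat Vm) \<eta>)"
    by (rule Q_Qi[OF star0_in_space])
  finally show ?thesis
    using assms by (simp add: hodge_star_eq Q_in_E 1 star1_def kappa_def \<eta>_def[symmetric]
        flinear_scale[OF flinear_ext_map] fv.scale_scale[symmetric] del: fv.scale_scale)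
qed

lemma star1_in_E: "\<omega> \<in> E \<Longrightarrow> star1 \<omega> \<in> E"
  unfolding star1_def
  by (intro fv.subspace_scale[OF subspace_ext_power] star0_in_power ext_map_in_power Gp_carrier)

text \<open>As \<open>Gp\<close> is symmetric, it can play both \<open>M\<close> and its transpose
  in \<open>star0_ext_map\<close>. The scalars then combine to
  \<open>kappa * kappa * det Gp\<close>, which the normalisation of \<open>vol\<close> makes
  1.\<close>

lemma star1_star1:
  assumes "\<omega> \<in> E"
  shows "star1 (star1 \<omega>) = scale_fun ((-1) ^ m) \<omega>"
proof -
  have "det Gp \<noteq> 0" using kappa_square by auto
  then obtain B where B: "B \<in> carrier_mat (2 * m) (2 * m)" "Gp * B = 1\<^sub>m (2 * m)"
    using adj_mat_inverse[OF Gp_carrier] by blast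
  have "ext_map Gp (star0 (2 * m) (ext_map Gp \<omega>)) = scale_fun (det Gp) (star0 (2 * m) \<omega>)"
    using star0_ext_map[OF Gp_carrier B E_space[OF assms]] by (simp add: Gp_transpose)
  then have "star1 (star1 \<omega>) = scale_fun (kappa * kappa * det Gp) (star0 (2 * m) (star0 (2 * m) \<omega>))"
    by (simp add: star1_def flinear_scale[OF flinear_ext_map] flinear_scale[OF flinear_star0] mult_ac)
  then show ?thesis by (simp add: kappa_square star0_star0[OF assms])
qed

lemma star1_basis:
  assumes "S \<in> middle_sets m"
  shows "\<exists>c. star1 (ext_basis S) = scale_fun c (ext_basis (partner_compl m S))"
proof -
  have S: "S \<subseteq> {..<2 * m}" "finite S" using assms finite_subset by (auto simp: middle_sets_def)
  have "ext_map Gp (ext_basis S) = wedge_list (map (col Gp) (sorted_list_of_set S))"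
    using S carrier_matD[OF Gp_carrier] by (intro ext_map_basis) simp
  also have "map (col Gp) (sorted_list_of_set S) =
      map (\<lambda>k. Gp $$ (partner k, k) \<cdot>\<^sub>v unit_vec (2 * m) (partner k)) (sorted_list_of_set S)"
    using S by (auto intro!: col_Gp)
  finally have "ext_map Gp (ext_basis S) = wedge_list
      (map (\<lambda>k. Gp $$ (partner k, k) \<cdot>\<^sub>v unit_vec (2 * m) (partner k)) (sorted_list_of_set S))" .
  moreover have "partner k < 2 * m" if "k \<in> set (sorted_list_of_set S)" for k
    using that S by (auto intro: partner_less)
  ultimately obtain c where "ext_map Gp (ext_basis S) = scale_fun c (ext_basis (partner ` S))"
    using wedge_list_monomial[of "sorted_list_of_set S" partner "2 * m" "\<lambda>k. Gp $$ (partner k, k)"] S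
      inj_on_subset[OF inj_partner] by auto
  then have "star1 (ext_basis S) =
      scale_fun (kappa * (c * compl_sign (2 * m) (partner ` S))) (ext_basis (partner_compl m S))"
    by (simp add: star1_def flinear_scale[OF flinear_star0] star0_ext_basis[OF partner_image_subset[OF S(1)]]
        partner_compl_def)
  then show ?thesis by blast
qed

definition hc :: "nat set \<Rightarrow> 'a"
  where "hc S = (SOME c. star1 (ext_basis S) = scale_fun c (ext_basis (partner_compl m S)))"

lemma hc: "S \<in> middle_sets m \<Longrightarrow> star1 (ext_basis S) = scale_fun (hc S) (ext_basis (partner_compl m S))"
  unfolding hc_def by (rule someI_ex[OF star1_basis])

lemma hc_mult: 
  assumes "S \<in> middle_sets m"
  shows "hc S * hc (partner_compl m S) = (-1) ^ m"
proof -
  have "(ext_basis S :: nat set \<Rightarrow> 'a) \<in> E"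
    using assms by (auto simp: E_supported supported_def ext_basis_def)
  then have "scale_fun ((-1) ^ m) (ext_basis S) = star1 (star1 (ext_basis S))"
    by (simp add: star1_star1)
  also have "\<dots> = scale_fun (hc S * hc (partner_compl m S)) (ext_basis S)"
    using assms by (simp add: hc partner_compl_middle flinear_scale[OF flinear_star1] partner_compl_middle_twice)
  finally have e: "scale_fun ((-1) ^ m) (ext_basis S) = scale_fun (hc S * hc (partner_compl m S)) (ext_basis S)" .
  show ?thesis using fun_cong[OF e, of S] by (simp add: ext_basis_def)
qed

lemma star1_eval:
  assumes "\<omega> \<in> E" "K \<in> middle_sets m"
  shows "star1 \<omega> K = hc (partner_compl m K) * \<omega> (partner_compl m K)"
proof -
  have "star1 \<omega> = (\<Sum>S\<in>middle_sets m. scale_fun (\<omega> S) (star1 (ext_basis S)))"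
    using assms(1) unfolding E_supported
    by (subst supported_expand[OF finite_middle_sets])
       (auto simp: flinear_sum[OF flinear_star1] flinear_scale[OF flinear_star1])
  then have "star1 \<omega> K = (\<Sum>S\<in>middle_sets m. \<omega> S * (hc S * ext_basis (partner_compl m S) K))"
    by (simp add: sum_fun_eval hc mult.assoc)
  also have "\<dots> = (\<Sum>S\<in>middle_sets m. if S = partner_compl m K then
      hc (partner_compl m K) * \<omega> (partner_compl m K) else 0)"
    using assms(2) partner_compl_middle_twice by (intro sum.cong) (auto simp: ext_basis_def)
  also have "\<dots> = hc (partner_compl m K) * \<omega> (partner_compl m K)"
    using assms(2) finite_middle_sets by (simp add: partner_compl_middle)
  finally show ?thesis .
qed

definition Hc :: "'a \<Rightarrow> (nat set \<Rightarrow> 'a) set"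
  where "Hc c = {\<eta>\<in>E. star1 \<eta> = scale_fun c \<eta>}"

lemma Hc_subset: "Hc c \<subseteq> E" by (auto simp: Hc_def)

lemma Hc_iff:
  "\<eta> \<in> Hc c \<longleftrightarrow> \<eta> \<in> E \<and>
    (\<forall>K\<in>middle_sets m. hc (partner_compl m K) * \<eta> (partner_compl m K) = c * \<eta> K)"
proof -
  have "star1 \<eta> = scale_fun c \<eta> \<longleftrightarrow> (\<forall>K\<in>middle_sets m. star1 \<eta> K = c * \<eta> K)" if "\<eta> \<in> E"
    using star1_in_E[OF that] that by (auto simp: fun_eq_iff E_supported supported_def) (metis mult_zero_right)
  then show ?thesis by (auto simp: Hc_def star1_eval)
qed

lemma hodge_eigenspace_eq: "hodge_eigenspace m G vol c = Q ` Hc c"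
proof -
  have "hodge_star m G vol (Q \<eta>) = scale_fun c (Q \<eta>) \<longleftrightarrow> star1 \<eta> = scale_fun c \<eta>" if "\<eta> \<in> E" for \<eta>
    using that E_space[OF star1_in_E[OF that]] fv.subspace_scale[OF subspace_ext_space E_space[OF that]]
    by (simp add: star_Q_star1 Q_inj flip: flinear_scale[OF flinear_ext_map])
  note eq = this
  show ?thesis
  proof (intro equalityI subsetI)
    fix \<omega> assume "\<omega> \<in> hodge_eigenspace m G vol c"
    then have \<omega>: "\<omega> \<in> E" "hodge_star m G vol \<omega> = scale_fun c \<omega>"
      by (auto simp: hodge_eigenspace_def)
    then have "\<omega> = Q (Qi \<omega>)" "Qi \<omega> \<in> E" using Qi_in_E Q_Qi[OF E_space] by auto
    then show "\<omega> \<in> Q ` Hc c" using \<omega>(2) eq[of "Qi \<omega>"] by (auto simp: Hc_def)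
  next
    fix \<omega> assume "\<omega> \<in> Q ` Hc c"
    then show "\<omega> \<in> hodge_eigenspace m G vol c"
      using eq Q_in_E by (auto simp: hodge_eigenspace_def Hc_def)
  qed
qed

lemma subspace_Hc: "fun_subspace (Hc c)"
  using subspace_ext_power[of "2 * m" m] unfolding fv.subspace_def Hc_def
  by (auto simp: flinear_0[OF flinear_star1] flinear_add[OF flinear_star1]
      flinear_scale[OF flinear_star1] fv.scale_right_distrib mult.commute)

text \<open>A diagonal operator whose entries are odd under \<open>partner_compl\<close>
  anticommutes with the star. It is applied to \<open>tau\<close> and to its inverse.\<close>

lemma diag_Hc_neg:
  assumes "\<eta> \<in> Hc c" "\<And>S. S \<in> middle_sets m \<Longrightarrow> d (partner_compl m S) = - d S"
  shows "diag d \<eta> \<in> Hc (- c)"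
  using assms by (simp add: Hc_iff diag_in_E) (simp add: diag_def mult.left_commute)

lemma diag_Hc:
  assumes "\<eta> \<in> Hc c" "\<And>S. S \<in> middle_sets m \<Longrightarrow> d (partner_compl m S) = d S"
  shows "diag d \<eta> \<in> Hc c"
  using assms by (simp add: Hc_iff diag_in_E) (simp add: diag_def mult.left_commute)

text \<open>Since \<open>tau\<close> vanishes on no middle set, division by it is defined there and
  again odd under \<open>partner_compl\<close>; this supplies the preimages.\<close>

lemma transfer_Hc: "transfer m a ` Q ` Hc c = Q ` Hc (- c)"
proof
  show "transfer m a ` Q ` Hc c \<subseteq> Q ` Hc (- c)"
  proof safe
    fix \<eta> assume \<eta>: "\<eta> \<in> Hc c"
    then have "diag tau \<eta> \<in> Hc (- c)"
      by (rule diag_Hc_neg) (simp add: middle_sets_def tau_partner_compl)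
    then show "transfer m a (Q \<eta>) \<in> Q ` Hc (- c)"
      using \<eta> Hc_subset by (subst transfer_diag) auto
  qed
  show "Q ` Hc (- c) \<subseteq> transfer m a ` Q ` Hc c"
  proof safe
    fix \<eta> assume \<eta>: "\<eta> \<in> Hc (- c)"
    then have d: "diag (\<lambda>S. inverse (tau S)) \<eta> \<in> Hc c"
      using diag_Hc_neg[OF \<eta>, of "\<lambda>S. inverse (tau S)"] by (simp add: middle_sets_def tau_partner_compl)
    have "diag tau (diag (\<lambda>S. inverse (tau S)) \<eta>) = \<eta>"
    proof
      fix S
      have "\<eta> S \<noteq> 0 \<Longrightarrow> S \<in> middle_sets m"
        using \<eta> Hc_subset unfolding E_supported supported_def by blast
      then show "diag tau (diag (\<lambda>S. inverse (tau S)) \<eta>) S = \<eta> S"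
        using tau_nonzero[of S] by (cases "\<eta> S = 0") (auto simp: diag_def middle_sets_def)
    qed
    then have "transfer m a (Q (diag (\<lambda>S. inverse (tau S)) \<eta>)) = Q \<eta>"
      using d Hc_subset by (subst transfer_diag) auto
    then show "Q \<eta> \<in> transfer m a ` Q ` Hc c" using d by (metis imageI)
  qed
qed

lemma direct_sum_Hc:
  assumes c: "c * c = (-1) ^ m"
  shows "is_direct_sum E (Q ` Hc c) (Q ` Hc (- c))"
proof -
  have c0: "c \<noteq> 0" using c by auto
  have two: "(2::'a) \<noteq> 0"
    using one_neq_minus_one by (metis add.inverse_unique one_add_one)
  have "w = 0" if "w \<in> Q ` Hc c" "w \<in> Q ` Hc (- c)" for w
  proof -
    from that obtain \<eta> \<eta>' where h: "\<eta> \<in> Hc c" "\<eta>' \<in> Hc (- c)" "w = Q \<eta>" "w = Q \<eta>'"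
      by blast
    then have "\<eta> \<in> E" "\<eta>' \<in> E" using Hc_subset by blast+
    then have "\<eta> = \<eta>'" using h(3,4) Q_inj[OF E_space E_space] by simp
    then have e: "scale_fun c \<eta> = scale_fun (- c) \<eta>" using h by (simp add: Hc_def)
    have "\<eta> S = 0" for S
    proof -
      have y: "c * \<eta> S = - (c * \<eta> S)" using fun_cong[OF e, of S] by simp
      have "2 * (c * \<eta> S) = c * \<eta> S + c * \<eta> S" by (rule mult_2)
      also have "\<dots> = - (c * \<eta> S) + c * \<eta> S" by (rule arg_cong2[OF y refl])
      finally have "2 * (c * \<eta> S) = 0" by simp
      then show ?thesis using two c0 by simp
    qed
    then have "\<eta> = 0" by (simp add: fun_eq_iff)
    then show "w = 0" using h(3) by (simp add: flinear_0[OF flinear_ext_map])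
  qed
  moreover have "0 \<in> Q ` Hc d" for d
    using fv.subspace_0[OF subspace_Hc] flinear_0[OF flinear_ext_map] by (metis imageI)
  ultimately have "Q ` Hc c \<inter> Q ` Hc (- c) = {0}" by blast
  moreover have "E = {u + v |u v. u \<in> Q ` Hc c \<and> v \<in> Q ` Hc (- c)}"
  proof safe
    fix \<omega> assume \<omega>: "\<omega> \<in> E"
    define \<eta> where "\<eta> = Qi \<omega>"
    have \<eta>: "\<eta> \<in> E" "\<omega> = Q \<eta>" using \<omega> Qi_in_E Q_Qi[OF E_space] by (auto simp: \<eta>_def)
    \<comment> \<open>The projection \<open>(1 + star1 / c) / 2\<close>, which lands in the
      \<open>c\<close>-eigenspace because \<open>c * c\<close> is the square of the star.\<close>
    define pr where "pr c = scale_fun (1 / 2) (\<eta> + scale_fun (inverse c) (star1 \<eta>))" for c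
    have pr: "pr c \<in> Hc c" if "c * c = (-1) ^ m" for c
    proof -
      have "c \<noteq> 0" using that by auto
      have "pr c \<in> E" unfolding pr_def
        by (intro fv.subspace_scale[OF subspace_ext_power] fv.subspace_add[OF subspace_ext_power] \<eta> star1_in_E)
      moreover have "star1 (pr c) = scale_fun (1 / 2) (star1 \<eta> + scale_fun (inverse c * (-1) ^ m) \<eta>)"
        by (simp add: pr_def flinear_add[OF flinear_star1] flinear_scale[OF flinear_star1] star1_star1[OF \<eta>(1)])
      moreover have "inverse c * (-1) ^ m = c"
        using \<open>c \<noteq> 0\<close> by (simp flip: that)
      moreover have "scale_fun c (pr c) = scale_fun (1 / 2) (scale_fun c \<eta> + star1 \<eta>)"
        using \<open>c \<noteq> 0\<close> by (simp add: pr_def fun_eq_iff algebra_simps)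
      ultimately show ?thesis by (simp add: Hc_def add.commute)
    qed
    have "pr c + pr (- c) = \<eta>"
      using two c0 by (simp add: pr_def fun_eq_iff field_simps)
    then have "\<omega> = Q (pr c) + Q (pr (- c))"
      by (simp add: \<eta>(2) flip: flinear_add[OF flinear_ext_map])
    moreover have "pr c \<in> Hc c" "pr (- c) \<in> Hc (- c)" using c by (auto intro!: pr)
    ultimately show "\<exists>u v. \<omega> = u + v \<and> u \<in> Q ` Hc c \<and> v \<in> Q ` Hc (- c)" by blast
  next
    fix u v assume "u \<in> Hc c" "v \<in> Hc (- c)"
    then show "Q u + Q v \<in> E"
      using Hc_subset Q_in_E fv.subspace_add[OF subspace_ext_power] by blast
  qed
  ultimately show ?thesis
    unfolding is_direct_sum_def
    using fvp.linear_subspace_image[OF flinear_ext_map subspace_Hc] by blast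
qed

text \<open>The eigenvector of the star with coefficient 1 at \<open>S\<close>; the eigenvalue
  equation forces the value \<open>hc S / c\<close> at the partner complement.\<close>

definition hb :: "'a \<Rightarrow> nat set \<Rightarrow> nat set \<Rightarrow> 'a"
  where "hb c S = (\<lambda>K. if K = S then 1 else if K = partner_compl m S then hc S / c else 0)"

lemma partner_compl_neq: "partner_compl m S \<noteq> S"
  using zero_mem_partner_compl[OF m, of S] by auto

lemma hb_Hc:
  assumes c: "c * c = (-1) ^ m" and S: "S \<in> middle_sets m"
  shows "hb c S \<in> Hc c"
  unfolding Hc_iff
proof (intro conjI ballI)
  have c0: "c \<noteq> 0" using c by auto
  show "hb c S \<in> E"
    using S partner_compl_middle by (auto simp: hb_def E_supported supported_def split: if_splits)
  fix K assume K: "K \<in> middle_sets m"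
  consider "K = S" | "K = partner_compl m S" | "K \<noteq> S" "K \<noteq> partner_compl m S" by blast
  then show "hc (partner_compl m K) * hb c S (partner_compl m K) = c * hb c S K"
  proof cases
    case 1
    have "hc (partner_compl m S) * (hc S / c) = c"
      using hc_mult[OF S] c c0 by (simp add: field_simps)
    then show ?thesis using partner_compl_neq[of S] by (simp add: 1 hb_def)
  next
    case 2
    then show ?thesis using partner_compl_neq[of S] c0
      by (simp add: partner_compl_middle_twice[OF S] hb_def)
  next
    case 3
    then have "partner_compl m K \<noteq> S" "partner_compl m K \<noteq> partner_compl m S"
      using partner_compl_middle_twice[OF K] partner_compl_middle_twice[OF S] by metis+
    with 3 show ?thesis by (simp add: hb_def)
  qed
qed

text \<open>Exactly one of \<open>S\<close> and \<open>partner_compl m S\<close> contains the index \<open>0\<close> of the root \<open>1\<close>, so a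
  vector in a Hodge half is determined by its coordinates at the sets containing \<open>0\<close>.\<close>

lemma dim_Hc:
  assumes c: "c * c = (-1) ^ m" and F: "F \<subseteq> middle_sets m"
    and closed: "\<And>S. S \<in> F \<Longrightarrow> partner_compl m S \<in> F"
  shows "fun_dim (Q ` Hc c \<inter> Q ` supported F) = card {S\<in>F. 0 \<in> S}"
proof (rule fun_dim_eq_card_coords[where b = "\<lambda>S. Q (hb c S)" and phi = "\<lambda>S w. Qi w S"])
  have c0: "c \<noteq> 0" using c by auto
  show fin: "finite {S\<in>F. 0 \<in> S}" using finite_subset[OF F finite_middle_sets] by simp
  have hb_F: "hb c S \<in> supported F" if "S \<in> F" for S
    using that closed by (auto simp: hb_def supported_def)
  show "Q (hb c S) \<in> Q ` Hc c \<inter> Q ` supported F" if "S \<in> {S\<in>F. 0 \<in> S}" for S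
    using that hb_Hc[OF c] F hb_F by blast
  have lin: "(\<Sum>S\<in>{S\<in>F. 0 \<in> S}. scale_fun (u S) (Q (hb c S))) =
      Q (\<Sum>S\<in>{S\<in>F. 0 \<in> S}. scale_fun (u S) (hb c S))" for u
    by (simp add: flinear_sum[OF flinear_ext_map] flinear_scale[OF flinear_ext_map])
  have ev0: "(\<Sum>S\<in>{S\<in>F. 0 \<in> S}. scale_fun (u S) (hb c S)) K = u K" if "K \<in> F" "0 \<in> K" for u K
  proof -
    have "(\<Sum>S\<in>{S\<in>F. 0 \<in> S}. scale_fun (u S) (hb c S)) K = (\<Sum>S\<in>{S\<in>F. 0 \<in> S}. if S = K then u K else 0)"
      unfolding sum_fun_eval using that(2) zero_mem_partner_compl[OF m]
      by (intro sum.cong) (auto simp: hb_def)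
    then show ?thesis using that fin by simp
  qed
  have sumE: "(\<Sum>S\<in>{S\<in>F. 0 \<in> S}. scale_fun (u S) (hb c S)) \<in> E" for u
    using hb_Hc[OF c] F Hc_subset
    by (intro fv.subspace_sum[OF subspace_ext_power] fv.subspace_scale[OF subspace_ext_power]) blast
  show "Qi (\<Sum>S\<in>{S\<in>F. 0 \<in> S}. scale_fun (u S) (Q (hb c S))) K = u K" if "K \<in> {S\<in>F. 0 \<in> S}" for u K
    unfolding lin Qi_Q[OF E_space[OF sumE]] using that ev0 by blast
  fix w assume "w \<in> Q ` Hc c \<inter> Q ` supported F"
  then obtain \<eta> \<eta>' where h: "\<eta> \<in> Hc c" "\<eta>' \<in> supported F" "w = Q \<eta>" "w = Q \<eta>'" by auto
  then have "\<eta>' \<in> E" using supported_mono[OF F] E_supported by blast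
  moreover have "\<eta> \<in> E" using h(1) Hc_subset by blast
  ultimately have "\<eta> = \<eta>'" using h(3,4) Q_inj[OF E_space E_space] by simp
  with h have \<eta>F: "\<eta> \<in> supported F" by simp
  have "\<eta> = (\<Sum>S\<in>{S\<in>F. 0 \<in> S}. scale_fun (\<eta> S) (hb c S))"
  proof
    fix K
    consider "K \<in> F" "0 \<in> K" | "K \<in> F" "0 \<notin> K" | "K \<notin> F" by blast
    then show "\<eta> K = (\<Sum>S\<in>{S\<in>F. 0 \<in> S}. scale_fun (\<eta> S) (hb c S)) K"
    proof cases
      case 1
      then show ?thesis by (simp add: ev0)
    next
      case 2
      let ?K' = "partner_compl m K"
      have KM: "K \<in> middle_sets m" using 2 F by blast
      have K': "?K' \<in> {S\<in>F. 0 \<in> S}" using 2 closed zero_mem_partner_compl[OF m] by blast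
      have "(\<Sum>S\<in>{S\<in>F. 0 \<in> S}. scale_fun (\<eta> S) (hb c S)) K =
          (\<Sum>S\<in>{S\<in>F. 0 \<in> S}. if S = ?K' then \<eta> ?K' * (hc ?K' / c) else 0)"
        unfolding sum_fun_eval
      proof (intro sum.cong refl)
        fix S assume S: "S \<in> {S\<in>F. 0 \<in> S}"
        then have "K = partner_compl m S \<longleftrightarrow> S = ?K'" "K \<noteq> S"
          using partner_compl_middle_twice KM F 2 by auto
        then show "scale_fun (\<eta> S) (hb c S) K = (if S = ?K' then \<eta> ?K' * (hc ?K' / c) else 0)"
          by (auto simp: hb_def)
      qed
      also have "\<dots> = \<eta> ?K' * (hc ?K' / c)" using K' fin by simp
      also have "\<dots> = \<eta> K"
        using h(1) KM c0 by (simp add: Hc_iff field_simps)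
      finally show ?thesis by simp
    next
      case 3
      then have "\<eta> K = 0" using \<eta>F by (auto simp: supported_def)
      moreover have "(\<Sum>S\<in>{S\<in>F. 0 \<in> S}. scale_fun (\<eta> S) (hb c S) K) = 0"
      proof (intro sum.neutral ballI)
        fix S assume "S \<in> {S\<in>F. 0 \<in> S}"
        then show "scale_fun (\<eta> S) (hb c S) K = 0"
          using hb_F[of S] 3 by (auto simp: supported_def)
      qed
      ultimately show ?thesis unfolding sum_fun_eval by simp
    qed
  qed
  then show "\<exists>u. w = (\<Sum>S\<in>{S\<in>F. 0 \<in> S}. scale_fun (u S) (Q (hb c S)))"
    unfolding lin h(3) by (metis (no_types))
qed

text \<open>The two halves differ only in the choice of the square root \<open>c\<close> of
  \<open>(-1) ^ m\<close>, so everything about a single half is proved for an arbitrary such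
  \<open>c\<close>.\<close>

lemma hodge_half:
  assumes c: "c * c = (-1) ^ m" and H: "H = hodge_eigenspace m G vol c" and T: "T = transfer m a"
  shows "real (fun_dim H) = 1/2 * real (2*m choose m)"
    and "(T \<circ> T) ` H \<subseteq> H"
    and "{l. \<exists>\<omega>\<in>H. \<omega> \<noteq> 0 \<and> T (T \<omega>) = scale_fun l \<omega>} = weight_value m a x ` ternary_weights m"
    and "\<epsilon> \<in> ternary_weights m \<Longrightarrow> \<omega> \<in> H \<inter> weight_space m a x \<epsilon> \<Longrightarrow>
      T (T \<omega>) = scale_fun (weight_value m a x \<epsilon>) \<omega>"
    and "\<epsilon> \<in> ternary_weights m \<Longrightarrow> fun_dim (H \<inter> weight_space m a x \<epsilon>) = weight_mult m \<epsilon>"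
    and "inj_on (weight_value m a x) (ternary_weights m) \<Longrightarrow> \<epsilon> \<in> ternary_weights m \<Longrightarrow>
      fun_dim {\<omega>\<in>H. T (T \<omega>) = scale_fun (weight_value m a x \<epsilon>) \<omega>} = weight_mult m \<epsilon>"
    and "\<exists>p. is_min_poly_on p (T \<circ> T) H \<and> degree p = card (weight_value m a x ` ternary_weights m)"
proof -
  have H: "H = Q ` Hc c" unfolding H by (rule hodge_eigenspace_eq)
  have TT: "T (T (Q \<eta>)) = Q (diag (\<lambda>S. tau S ^ 2) \<eta>)" if "\<eta> \<in> E" for \<eta>
    using transfer2_diag[OF that] by (simp add: T)
  have sc: "Q (diag (\<lambda>S. tau S ^ 2) \<eta>) = scale_fun l (Q \<eta>) \<longleftrightarrow> (\<forall>S. \<eta> S \<noteq> 0 \<longrightarrow> tau S ^ 2 = l)"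
    if "\<eta> \<in> E" for \<eta> l
  proof -
    have "Q (diag (\<lambda>S. tau S ^ 2) \<eta>) = scale_fun l (Q \<eta>) \<longleftrightarrow> diag (\<lambda>S. tau S ^ 2) \<eta> = scale_fun l \<eta>"
      using Q_inj[OF E_space[OF diag_in_E[OF that]] fv.subspace_scale[OF subspace_ext_space E_space[OF that]]]
      by (simp add: flinear_scale[OF flinear_ext_map])
    then show ?thesis by (auto simp: diag_def fun_eq_iff)
  qed
  \<comment> \<open>The vector \<open>hb c S\<close> lives on \<open>S\<close> and its partner
    complement. These have the same weight, so it is an eigenvector of \<open>T \<circ> T\<close>
    inside the half.\<close>
  have ex: "\<exists>\<eta>\<in>Hc c. \<eta> \<noteq> 0 \<and> (\<forall>S. \<eta> S \<noteq> 0 \<longrightarrow> tau S ^ 2 = weight_value m a x \<epsilon>)"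
    if e: "\<epsilon> \<in> ternary_weights m" for \<epsilon>
  proof -
    obtain S where S: "S \<in> weight_sets \<epsilon>" using weight_sets_nonempty[OF e] by blast
    have "hb c S S = 1" by (simp add: hb_def)
    then have "hb c S \<noteq> 0" by (metis zero_fun_apply zero_neq_one)
    then show ?thesis
      using hb_Hc[OF c, of S] S weight_sets_middle weight_sets_partner_compl
      by (intro bexI[of _ "hb c S"]) (auto simp: hb_def tau_square_weight split: if_splits)
  qed
  have dim_w: "fun_dim (H \<inter> weight_space m a x \<epsilon>) = weight_mult m \<epsilon>" if "\<epsilon> \<in> ternary_weights m" for \<epsilon>
    using dim_Hc[OF c weight_sets_middle weight_sets_partner_compl] card_weight_sets_zero[OF that]
    by (simp add: H weight_space_eq)
  have "Q ` Hc c \<inter> Q ` supported (middle_sets m) = Q ` Hc c"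
    using Hc_subset E_supported by blast
  then have "2 * fun_dim H = 2 * m choose m"
    using dim_Hc[OF c order_refl partner_compl_middle] card_middle_sets_zero[OF m] by (simp add: H)
  then have "2 * real (fun_dim H) = real (2 * m choose m)"
    by (metis of_nat_mult of_nat_numeral)
  then show "real (fun_dim H) = 1/2 * real (2*m choose m)" by simp
  show "(T \<circ> T) ` H \<subseteq> H"
  proof safe
    fix w assume "w \<in> H"
    then obtain \<eta> where \<eta>: "\<eta> \<in> Hc c" "w = Q \<eta>" by (auto simp: H)
    then have "(T \<circ> T) w = Q (diag (\<lambda>S. tau S ^ 2) \<eta>)" using TT Hc_subset by auto
    moreover have "diag (\<lambda>S. tau S ^ 2) \<eta> \<in> Hc c"
      using \<eta>(1) by (rule diag_Hc) (simp add: middle_sets_def tau_partner_compl)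
    ultimately show "(T \<circ> T) w \<in> H" by (simp add: H)
  qed
  show "{l. \<exists>\<omega>\<in>H. \<omega> \<noteq> 0 \<and> T (T \<omega>) = scale_fun l \<omega>} = weight_value m a x ` ternary_weights m"
  proof safe
    fix l \<omega> assume h: "\<omega> \<in> H" "\<omega> \<noteq> 0" "T (T \<omega>) = scale_fun l \<omega>"
    then obtain \<eta> where \<eta>: "\<eta> \<in> Hc c" "\<omega> = Q \<eta>" by (auto simp: H)
    then have \<eta>E: "\<eta> \<in> E" using Hc_subset by blast
    have "\<eta> \<noteq> 0" using h(2) \<eta>(2) flinear_0[OF flinear_ext_map] by metis
    then obtain S where S: "\<eta> S \<noteq> 0" by (auto simp: fun_eq_iff)
    then have "S \<in> middle_sets m" using \<eta>E by (auto simp: E_supported supported_def)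
    moreover have "tau S ^ 2 = l" using h(3) S sc[OF \<eta>E] by (simp add: \<eta>(2) TT[OF \<eta>E])
    ultimately show "l \<in> weight_value m a x ` ternary_weights m"
      unfolding tau_squares[symmetric] by blast
  next
    fix \<epsilon> assume "\<epsilon> \<in> ternary_weights m"
    then obtain \<eta> where \<eta>: "\<eta> \<in> Hc c" "\<eta> \<noteq> 0" "\<forall>S. \<eta> S \<noteq> 0 \<longrightarrow> tau S ^ 2 = weight_value m a x \<epsilon>"
      using ex by blast
    then have \<eta>E: "\<eta> \<in> E" using Hc_subset by blast
    have "Q \<eta> \<noteq> 0"
      using \<eta>(2) Q_inj[OF E_space[OF \<eta>E] fv.subspace_0[OF subspace_ext_space]]
      by (simp add: flinear_0[OF flinear_ext_map])
    moreover have "T (T (Q \<eta>)) = scale_fun (weight_value m a x \<epsilon>) (Q \<eta>)"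
      using \<eta>(3) sc[OF \<eta>E] by (simp add: TT[OF \<eta>E])
    ultimately show "\<exists>\<omega>\<in>H. \<omega> \<noteq> 0 \<and> T (T \<omega>) = scale_fun (weight_value m a x \<epsilon>) \<omega>"
      using \<eta>(1) by (auto simp: H)
  qed
  show "T (T \<omega>) = scale_fun (weight_value m a x \<epsilon>) \<omega>"
    if "\<epsilon> \<in> ternary_weights m" "\<omega> \<in> H \<inter> weight_space m a x \<epsilon>" for \<epsilon> \<omega>
  proof -
    from that obtain \<eta> where \<eta>: "\<eta> \<in> supported (weight_sets \<epsilon>)" "\<omega> = Q \<eta>"
      by (auto simp: weight_space_eq)
    then have \<eta>E: "\<eta> \<in> E" using supported_mono[OF weight_sets_middle] by (auto simp: E_supported)
    have "\<forall>S. \<eta> S \<noteq> 0 \<longrightarrow> tau S ^ 2 = weight_value m a x \<epsilon>"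
      using \<eta>(1) by (auto simp: supported_def tau_square_weight)
    then show ?thesis using sc[OF \<eta>E] by (simp add: \<eta>(2) TT[OF \<eta>E])
  qed
  show "fun_dim (H \<inter> weight_space m a x \<epsilon>) = weight_mult m \<epsilon>" if "\<epsilon> \<in> ternary_weights m" for \<epsilon>
    by (rule dim_w[OF that])
  show "fun_dim {\<omega>\<in>H. T (T \<omega>) = scale_fun (weight_value m a x \<epsilon>) \<omega>} = weight_mult m \<epsilon>"
    if inj: "inj_on (weight_value m a x) (ternary_weights m)" and \<epsilon>: "\<epsilon> \<in> ternary_weights m" for \<epsilon>
  proof -
    have "{\<omega>\<in>H. T (T \<omega>) = scale_fun (weight_value m a x \<epsilon>) \<omega>} = H \<inter> weight_space m a x \<epsilon>"
    proof safe
      fix \<omega> assume h: "\<omega> \<in> H" "T (T \<omega>) = scale_fun (weight_value m a x \<epsilon>) \<omega>"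
      then obtain \<eta> where \<eta>: "\<eta> \<in> Hc c" "\<omega> = Q \<eta>" by (auto simp: H)
      then have \<eta>E: "\<eta> \<in> E" using Hc_subset by blast
      have "\<forall>S. \<eta> S \<noteq> 0 \<longrightarrow> tau S ^ 2 = weight_value m a x \<epsilon>"
        using h(2) sc[OF \<eta>E] by (simp add: \<eta>(2) TT[OF \<eta>E])
      then have "\<eta> \<in> supported (weight_sets \<epsilon>)"
        using \<eta>E inj_onD[OF inj _ wt_ternary \<epsilon>]
        by (auto simp: supported_def E_supported weight_sets_def middle_sets_def tau_square)
      then show "\<omega> \<in> weight_space m a x \<epsilon>" by (auto simp: weight_space_eq \<eta>(2))
    next
      fix \<omega> assume "\<omega> \<in> H" "\<omega> \<in> weight_space m a x \<epsilon>"
      then show "T (T \<omega>) = scale_fun (weight_value m a x \<epsilon>) \<omega>"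
        using \<open>\<And>\<omega> \<epsilon>. \<epsilon> \<in> ternary_weights m \<Longrightarrow> \<omega> \<in> H \<inter> weight_space m a x \<epsilon> \<Longrightarrow>
          T (T \<omega>) = scale_fun (weight_value m a x \<epsilon>) \<omega>\<close> \<epsilon> by blast
    qed
    then show ?thesis using dim_w[OF \<epsilon>] by simp
  qed
  show "\<exists>p. is_min_poly_on p (T \<circ> T) H \<and> degree p = card (weight_value m a x ` ternary_weights m)"
  proof (intro exI conjI)
    show "is_min_poly_on (\<Prod>l\<in>weight_value m a x ` ternary_weights m. [:- l, 1:]) (T \<circ> T) H"
      unfolding H
    proof (rule min_poly_diag[where d = "\<lambda>S. tau S ^ 2"])
      show "(T \<circ> T) (Q \<omega>) = Q (diag (\<lambda>S. tau S ^ 2) \<omega>)" if "\<omega> \<in> E" for \<omega>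
        using TT[OF that] by simp
    qed (use Hc_subset finite_ternary tau_squares ex in auto)
  qed (rule degree_prod_linear)
qed

lemma hodge_star_star:
  assumes "\<gamma> \<in> E"
  shows "hodge_star m G vol (hodge_star m G vol \<gamma>) = scale_fun ((-1) ^ m) \<gamma>"
proof -
  obtain \<eta> where "\<eta> \<in> E" "\<gamma> = Q \<eta>" using assms Qi_in_E Q_Qi[OF E_space] by metis
  then show ?thesis
    by (simp add: star_Q_star1 star1_in_E star1_star1 flinear_scale[OF flinear_ext_map])
qed

end


subsection \<open>Minors of the skew-symmetric Toeplitz matrix\<close>

lemma eq_minus_self_imp_zero:
  fixes y :: "'a::field"
  assumes "(2::'a) \<noteq> 0" "y = - y"
  shows "y = 0"
proof -
  have "2 * y = y + y" by (rule mult_2)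
  also have "\<dots> = - y + y" by (rule arg_cong2[OF assms(2) refl])
  finally show ?thesis using assms(1) by simp
qed

lemma skew_ext_minus: "skew_ext m a (- s) = - skew_ext m a s"
  by (auto simp: skew_ext_def)

text \<open>After the shift from indices starting at 1 to rows starting at 0, all deleted rows lie
  below \<open>n\<close> because \<open>m \<le> n\<close>.\<close>

lemma card_complement_Suc:
  assumes "A \<subseteq> {1..m}" "m \<le> n"
  shows "card {i. i < n \<and> Suc i \<notin> A} = n - card A"
proof -
  have "{i. i < n \<and> Suc i \<notin> A} = {..<n} - {i. Suc i \<in> A}" by auto
  moreover have "Suc ` {i. Suc i \<in> A} = A"
  proof (intro equalityI subsetI)
    fix y assume "y \<in> A"
    moreover from this have "y = Suc (y - 1)" using assms(1) by force
    ultimately show "y \<in> Suc ` {i. Suc i \<in> A}" by (metis imageI mem_Collect_eq)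
  qed auto
  then have "card {i. Suc i \<in> A} = card A" by (metis card_image inj_Suc inj_on_subset subset_UNIV)
  moreover have "{i. Suc i \<in> A} \<subseteq> {..<n}" using assms by force
  ultimately show ?thesis
    using finite_subset[of "{i. Suc i \<in> A}" "{..<n}"] by (simp add: card_Diff_subset)
qed

text \<open>The Toeplitz matrix is skew-symmetric, so exchanging the row and column sets turns the
  submatrix into minus its transpose; its order is \<open>n - j\<close>.\<close>

lemma toeplitz_minor_swap:
  assumes "A \<subseteq> {1..m}" "B \<subseteq> {1..m}" "card A = j" "card B = j" "m \<le> n"
  shows "toeplitz_minor m n B A a = (-1) ^ (n - j) * toeplitz_minor m n A B a"
proof -
  let ?I = "{i. Suc i \<notin> A}" and ?J = "{i. Suc i \<notin> B}" and ?M = "toeplitz m a n"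
  have cI: "card {i. i < n \<and> i \<in> ?I} = n - j" "card {i. i < n \<and> i \<in> ?J} = n - j"
    using assms card_complement_Suc[of A m n] card_complement_Suc[of B m n] by simp_all
  have S: "submatrix ?M ?I ?J \<in> carrier_mat (n - j) (n - j)"
    using cI by (simp add: submatrix_def toeplitz_def)
  have "submatrix ?M ?J ?I = (-1) \<cdot>\<^sub>m transpose_mat (submatrix ?M ?I ?J)"
  proof (rule eq_matI)
    fix i k assume "i < dim_row ((-1) \<cdot>\<^sub>m transpose_mat (submatrix ?M ?I ?J))"
      "k < dim_col ((-1) \<cdot>\<^sub>m transpose_mat (submatrix ?M ?I ?J))"
    then have ik: "i < card {i. i < n \<and> i \<in> ?J}" "k < card {i. i < n \<and> i \<in> ?I}"
      using S cI by auto
    have p: "pick ?J i < n" "pick ?I k < n" using ik by (auto intro: pick_le)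
    have "skew_ext m a (int (pick ?I k) - int (pick ?J i)) = - skew_ext m a (int (pick ?J i) - int (pick ?I k))"
      by (subst skew_ext_minus[symmetric]) simp
    then show "submatrix ?M ?J ?I $$ (i, k) = ((-1) \<cdot>\<^sub>m transpose_mat (submatrix ?M ?I ?J)) $$ (i, k)"
      using ik p cI by (simp add: submatrix_def toeplitz_def)
  qed (use cI in \<open>auto simp: submatrix_def toeplitz_def\<close>)
  then have "det (submatrix ?M ?J ?I) = (-1) ^ (n - j) * det (submatrix ?M ?I ?J)"
    using S by (simp add: det_transpose[OF S])
  then show ?thesis by (simp add: toeplitz_minor_def)
qed

lemma sum_below: "real (\<Sum>q<M. q) = (real M ^ 2 - real M) / 2"
  by (induction M) (simp_all add: power2_eq_square algebra_simps)

text \<open>By the swap symmetry the minors at pairs \<open>p \<le> q\<close> in an enumeration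
  \<open>e\<close> of the \<open>j\<close>-subsets span everything. For odd \<open>n - j\<close> the
  minors with \<open>p = q\<close> equal their own negatives and vanish, which is why
  \<open>up q\<close> then excludes \<open>q\<close>.\<close>

lemma fun_dim_level_minors:
  assumes "(2::'a::field) \<noteq> 0" "m \<le> n" "j \<le> m"
  shows "real (fun_dim (fun_span (level_minors m n j :: ((nat \<Rightarrow> 'a) \<Rightarrow> 'a) set))) \<le> level_bound m n j"
proof -
  define F where "F = {A. A \<subseteq> {1..m} \<and> card A = j}"
  define M where "M = m choose j"
  have F: "finite F" "card F = M"
    unfolding F_def M_def by (simp_all add: n_subsets)
  then obtain e where e: "bij_betw e {..<M} F"
    using ex_bij_betw_nat_finite[of F] by (auto simp: atLeast0LessThan)
  have eF: "e p \<subseteq> {1..m}" "card (e p) = j" if "p < M" for p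
    using bij_betwE[OF e] that by (auto simp: F_def)
  let ?mn = "\<lambda>p q. toeplitz_minor m n (e p) (e q) :: (nat \<Rightarrow> 'a) \<Rightarrow> 'a"
  have swap: "?mn q p = scale_fun ((-1) ^ (n - j)) (?mn p q)" if "p < M" "q < M" for p q
    by (rule ext)
       (simp add: toeplitz_minor_swap[OF eF(1)[OF that(1)] eF(1)[OF that(2)] eF(2)[OF that(1)] eF(2)[OF that(2)] assms(2)])
  define up where "up q = (if even (n - j) then {..q} else {..<q})" for q :: nat
  define W where "W = (\<lambda>(q, p). ?mn p q) ` (SIGMA q:{..<M}. up q)"
  have finW: "finite W" unfolding W_def up_def by (intro finite_imageI finite_SigmaI) auto
  have le: "?mn p q \<in> fun_span W" if "p \<le> q" "q < M" for p q
  proof (cases "p \<in> up q")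
    case True
    then show ?thesis using that by (intro fv.span_base) (auto simp: W_def)
  next
    case False
    then have pq: "p = q" "odd (n - j)" using that by (auto simp: up_def split: if_splits)
    have "?mn p p b = - ?mn p p b" for b
      using fun_cong[OF swap[of p p], of b] that pq by auto
    then have "?mn p p b = 0" for b using eq_minus_self_imp_zero[OF assms(1)] by blast
    then have "?mn p q = 0" using pq by (simp add: fun_eq_iff)
    then show ?thesis by (simp only: fv.span_zero)
  qed
  have "level_minors m n j \<subseteq> fun_span W"
  proof
    fix f :: "(nat \<Rightarrow> 'a) \<Rightarrow> 'a" assume "f \<in> level_minors m n j"
    then obtain A B where AB: "f = toeplitz_minor m n A B" "A \<in> F" "B \<in> F"
      by (auto simp: level_minors_def F_def)
    then obtain p q where pq: "p < M" "q < M" "A = e p" "B = e q"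
      using bij_betw_imp_surj_on[OF e] by (metis imageE lessThan_iff)
    show "f \<in> fun_span W"
    proof (cases "p \<le> q")
      case True
      then show ?thesis using le pq AB(1) by simp
    next
      case False
      then have "?mn q p \<in> fun_span W" using pq by (intro le) auto
      moreover have "f = scale_fun ((-1) ^ (n - j)) (?mn q p)"
        unfolding AB(1) pq(3,4) by (rule swap[OF pq(2,1)])
      ultimately show ?thesis by (simp only: fv.span_scale)
    qed
  qed
  then have "fun_dim (level_minors m n j :: ((nat \<Rightarrow> 'a) \<Rightarrow> 'a) set) \<le> card W"
    using finW by (rule fv.dim_le_card)
  also have "card W \<le> card (SIGMA q:{..<M}. up q)"
    unfolding W_def by (rule card_image_le) (auto simp: up_def)
  also have "\<dots> = (\<Sum>q<M. card (up q))" by (rule card_SigmaI) (auto simp: up_def)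
  finally have "real (fun_dim (level_minors m n j :: ((nat \<Rightarrow> 'a) \<Rightarrow> 'a) set)) \<le> real (\<Sum>q<M. card (up q))"
    by (simp only: of_nat_le_iff)
  also have "real (\<Sum>q<M. card (up q)) = level_bound m n j"
  proof (cases "even (n - j)")
    case True
    then have "(\<Sum>q<M. card (up q)) = (\<Sum>q<M. q) + M"
      by (simp add: up_def) (induction M, auto)
    then show ?thesis using True sum_below[of M]
      by (simp add: level_bound_def M_def field_simps)
  next
    case False
    then have "(\<Sum>q<M. card (up q)) = (\<Sum>q<M. q)" by (simp add: up_def)
    then show ?thesis using False sum_below[of M]
      by (simp add: level_bound_def M_def field_simps)
  qed
  finally show ?thesis by simp
qed

text \<open>The squares of the binomial coefficients add up to the central one, and the signed part
  is an alternating row sum of Pascal's triangle, zero because \<open>m\<close> is positive.\<close>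

lemma sum_level_bound:
  assumes "1 \<le> m" "m \<le> n"
  shows "(\<Sum>j=0..m. level_bound m n j) = 1/2 * real (2*m choose m)"
proof -
  have "(\<Sum>j=0..m. level_bound m n j) =
      (\<Sum>j\<le>m. 1/2 * real ((m choose j) ^ 2) + 1/2 * (-1) ^ n * ((-1) ^ j * real (m choose j)))"
    unfolding atLeast0AtMost
  proof (intro sum.cong refl)
    fix j assume "j \<in> {..m}"
    then have "j \<le> n" using assms by auto
    then have "(-1) ^ (n - j) = ((-1) ^ n * (-1) ^ j :: real)"
      by (simp add: minus_one_power_iff)
    then show "level_bound m n j = 1/2 * real ((m choose j) ^ 2) + 1/2 * (-1) ^ n * ((-1) ^ j * real (m choose j))"
      by (simp add: level_bound_def algebra_simps)
  qed
  also have "\<dots> = 1/2 * (\<Sum>j\<le>m. real ((m choose j) ^ 2)) + 1/2 * (-1) ^ n * (\<Sum>j\<le>m. (-1) ^ j * real (m choose j))"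
    by (simp only: sum.distrib sum_distrib_left)
  also have "(\<Sum>j\<le>m. (-1) ^ j * real (m choose j)) = 0"
    using assms by (intro choose_alternating_sum) auto
  also have "(\<Sum>j\<le>m. real ((m choose j) ^ 2)) = real (2 * m choose m)"
    by (subst of_nat_sum[symmetric]) (simp only: choose_square_sum)
  finally show ?thesis by simp
qed


subsection \<open>Pairing the roots of the symbol\<close>

lemma involution_pairs:
  assumes "finite A" "card A = 2 * n" "\<And>z. z \<in> A \<Longrightarrow> f z \<in> A" "\<And>z. z \<in> A \<Longrightarrow> f (f z) = z"
    "\<And>z. z \<in> A \<Longrightarrow> f z \<noteq> z"
  shows "\<exists>x. A = x ` {1..n} \<union> f ` x ` {1..n}"
  using assms
proof (induction n arbitrary: A)
  case 0
  then show ?case by simp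
next
  case (Suc n)
  then obtain z where z: "z \<in> A" by fastforce
  define A' where "A' = A - {z, f z}"
  have "card A' = card A - card {z, f z}"
    unfolding A'_def using z Suc.prems by (intro card_Diff_subset) auto
  then have "card A' = 2 * n" using Suc.prems(2) Suc.prems(5)[OF z] by simp
  moreover have "f w \<in> A'" if "w \<in> A'" for w
    using that Suc.prems(3,4) z unfolding A'_def by (metis DiffE DiffI insert_iff singletonD)
  ultimately obtain x where x: "A' = x ` {1..n} \<union> f ` x ` {1..n}"
    using Suc.IH[of A'] Suc.prems by (auto simp: A'_def)
  define x' where "x' = x(Suc n := z)"
  have "x' ` {1..n} = x ` {1..n}" by (auto simp: x'_def image_iff)
  moreover have "{1..Suc n} = insert (Suc n) {1..n}" by auto
  then have "x' ` {1..Suc n} = insert z (x' ` {1..n})" by (simp only: image_insert) (simp add: x'_def)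
  ultimately have "x' ` {1..Suc n} \<union> f ` x' ` {1..Suc n} = {z, f z} \<union> A'"
    unfolding x by auto
  also have "\<dots> = A" using z Suc.prems(3) by (auto simp: A'_def)
  finally show ?case by blast
qed

lemma coeff_symbol_poly_reflect:
  assumes "k \<le> 2 * m"
  shows "coeff (symbol_poly m a) (2 * m - k) = - coeff (symbol_poly m a) k"
proof -
  have "int (2 * m - k) - int m = - (int k - int m)" using assms by simp
  then show ?thesis by (simp only: coeff_symbol_poly skew_ext_minus)
qed

text \<open>Skew-symmetry of the coefficients makes the symbol antipalindromic: its reflection is
  its negative.\<close>

lemma poly_symbol_inverse:
  fixes a :: "nat \<Rightarrow> 'a::field"
  assumes "a m \<noteq> 0" "m \<ge> 1" "z \<noteq> 0"
  shows "z ^ (2 * m) * poly (symbol_poly m a) (inverse z) = - poly (symbol_poly m a) z"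
proof -
  have "reflect_poly (symbol_poly m a) = - symbol_poly m a"
  proof (rule poly_eqI)
    fix k
    have "coeff (symbol_poly m a) k = 0" if "k > 2 * m"
      using that degree_symbol_poly(1)[of a m, OF assms(1,2)] by (intro coeff_eq_0) simp
    then show "coeff (reflect_poly (symbol_poly m a)) k = coeff (- symbol_poly m a) k"
      using coeff_symbol_poly_reflect[of k m a]
      by (auto simp: coeff_reflect_poly degree_symbol_poly(1)[of a m, OF assms(1,2)])
  qed
  then show ?thesis
    using poly_reflect_poly_nz[OF assms(3), of "symbol_poly m a"]
    by (simp add: degree_symbol_poly(1)[of a m, OF assms(1,2)])
qed

lemma poly_eq_smult_prod_roots:
  fixes q :: "'a::field poly"
  assumes "finite A" "card A = degree q" "\<And>z. z \<in> A \<Longrightarrow> poly q z = 0" "q \<noteq> 0"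
  shows "q = smult (lead_coeff q) (\<Prod>z\<in>A. [:- z, 1:])"
proof -
  let ?p = "\<Prod>z\<in>A. [:- z, 1:]"
  obtain r where r: "q = ?p * r"
    using prod_linear_dvd[OF assms(1,3)] unfolding dvd_def by blast
  have p0: "?p \<noteq> 0" using monic_prod_linear[of A] by auto
  have "r \<noteq> 0" using assms(4) r by auto
  then have "degree q = degree ?p + degree r" using p0 by (subst r) (rule degree_mult_eq)
  then have "degree r = 0" using assms(2) by (simp add: degree_prod_linear)
  then obtain c where c: "r = [:c:]" by (rule degree_eq_zeroE)
  then have q: "q = smult c ?p" using r by simp
  then have lc: "lead_coeff q = c"
    by (subst q) (simp only: lead_coeff_smult monic_prod_linear mult_1_right)
  show ?thesis unfolding lc by (rule q)
qed

text \<open>The symbol is antipalindromic, so inversion permutes its roots. At \<open>z\<close> with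
  \<open>z * z = 1\<close> the value equals its own negative, so 1 and -1 are roots; on the
  remaining \<open>2 * (m - 1)\<close> roots inversion has no fixed point and they fall into
  pairs.\<close>

lemma ex_root_pairs:
  fixes a :: "nat \<Rightarrow> 'a::alg_closed_field"
  assumes m: "m \<ge> 1" and two: "(2::'a) \<noteq> 0" and adm: "admissible m a"
  shows "\<exists>x. root_pairs m a x"
proof -
  let ?q = "symbol_poly m a"
  define R where "R = {z. poly ?q z = 0}"
  have am: "a m \<noteq> 0" and cR: "card R = 2 * m" using adm by (simp_all add: admissible_def R_def)
  have dq: "degree ?q = 2 * m" "lead_coeff ?q = a m" using degree_symbol_poly[of a m, OF am m] by simp_all
  have q0: "?q \<noteq> 0" using dq am by auto
  have fR: "finite R" using q0 by (simp add: R_def poly_roots_finite)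
  have nz: "z \<noteq> 0" if "z \<in> R" for z
  proof
    assume "z = 0"
    then have "coeff ?q 0 = 0" using that by (simp add: R_def poly_0_coeff_0)
    then show False using coeff_symbol_poly_reflect[of 0 m a] dq am by simp
  qed
  have inv: "inverse z \<in> R" if "z \<in> R" for z
    using poly_symbol_inverse[of a m z, OF am m nz[OF that]] that nz[OF that] by (simp add: R_def)
  have pm: "z \<in> R" if "z * z = 1" for z
  proof -
    have "z \<noteq> 0" using that by auto
    have "inverse z = z" using that by (metis inverse_unique)
    moreover have "z ^ (2 * m) = 1" using that by (simp add: power_mult power2_eq_square)
    ultimately have y: "poly ?q z = - poly ?q z"
      using poly_symbol_inverse[of a m z, OF am m \<open>z \<noteq> 0\<close>] by simp
    have "poly ?q z = 0" by (rule eq_minus_self_imp_zero[OF two y])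
    then show ?thesis by (simp add: R_def)
  qed
  have ne: "(1::'a) \<noteq> -1" using eq_minus_self_imp_zero[OF two, of 1] zero_neq_one by metis
  define R' where "R' = R - {1, -1}"
  have "card R' = card R - card {1, -1::'a}"
    unfolding R'_def using pm[of 1] pm[of "-1"] by (intro card_Diff_subset) auto
  then have "card R' = 2 * (m - 1)" using cR ne by simp
  moreover have "inverse z \<in> R'" if "z \<in> R'" for z
  proof -
    have "inverse z \<noteq> 1" "inverse z \<noteq> -1"
      using that unfolding R'_def by (metis DiffE insertI1 insertI2 inverse_1 inverse_inverse_eq inverse_minus_eq)+
    then show ?thesis using that inv[of z] by (simp add: R'_def)
  qed
  moreover have "inverse z \<noteq> z" if "z \<in> R'" for z
  proof
    assume "inverse z = z"
    then have "z * z = 1" using nz[of z] that unfolding R'_def by (metis Diff_iff right_inverse)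
    then have "z = 1 \<or> z = -1" by (metis power2_eq_1_iff power2_eq_square)
    then show False using that by (auto simp: R'_def)
  qed
  ultimately obtain x where x: "R' = x ` {1..m - 1} \<union> inverse ` x ` {1..m - 1}"
    using involution_pairs[of R' "m - 1" inverse] fR by (auto simp: R'_def)
  have xR: "x i \<in> R'" "inverse (x i) \<in> R'" if "i \<in> {1..<m}" for i
    unfolding x using that by auto
  have "R = root_at x ` {..<2 * m}"
  proof
    show "root_at x ` {..<2 * m} \<subseteq> R"
    proof -
      have "\<forall>k<2 * m. root_at x k \<in> R"
        unfolding ball_pairs
      proof (intro allI impI)
        fix i assume "i < m"
        then show "root_at x (2 * i) \<in> R \<and> root_at x (Suc (2 * i)) \<in> R"
          using xR[of i] pm[of 1] pm[of "-1"]
          by (cases "i = 0") (auto simp: root_at_def R'_def)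
      qed
      then show ?thesis by auto
    qed
    show "R \<subseteq> root_at x ` {..<2 * m}"
    proof
      fix z assume z: "z \<in> R"
      consider "z = 1" | "z = -1" | "z \<in> R'" using z by (auto simp: R'_def)
      then show "z \<in> root_at x ` {..<2 * m}"
      proof cases
        case 1
        then show ?thesis using m by (intro image_eqI[of _ _ 0]) (auto simp: root_at_def)
      next
        case 2
        then show ?thesis using m by (intro image_eqI[of _ _ 1]) (auto simp: root_at_def)
      next
        case 3
        then obtain i where i: "i \<in> {1..m - 1}" "z = x i \<or> z = inverse (x i)"
          unfolding x by auto
        then have "z = root_at x (2 * i) \<or> z = root_at x (Suc (2 * i))"
          by (auto simp: root_at_even root_at_odd)
        moreover have "2 * i < 2 * m" "Suc (2 * i) < 2 * m" using i(1) by auto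
        ultimately show ?thesis by blast
      qed
    qed
  qed
  moreover from this have inj: "inj_on (root_at x) {..<2 * m}"
    using cR by (intro eq_card_imp_inj_on) auto
  ultimately have "(\<Prod>z\<in>R. [:- z, 1:]) = (\<Prod>k<2 * m. [:- root_at x k, 1:])"
    by (simp add: prod.reindex)
  moreover have "?q = smult (lead_coeff ?q) (\<Prod>z\<in>R. [:- z, 1:])"
    using fR cR dq(1) q0 by (intro poly_eq_smult_prod_roots) (auto simp: R_def)
  ultimately have "root_pairs m a x"
    using xR(1) nz unfolding root_pairs_iff[OF m] dq(2) by (auto simp: R'_def)
  then show ?thesis by blast
qed


subsection \<open>Existence of the invariant form\<close>

context skew_symbol
begin

text \<open>A model of the invariant form in eigenbasis coordinates, giving the value 1 to each
  partner pair. \<open>G0\<close> is its Gram matrix pulled back along \<open>Vm\<close>.\<close>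

definition pairing :: "'a vec \<Rightarrow> 'a vec \<Rightarrow> 'a"
  where "pairing w w' = (\<Sum>k<2 * m. w $ k * w' $ (partner k))"

definition G0 :: "'a mat"
  where "G0 = transpose_mat Vm * (mat (2 * m) (2 * m) (\<lambda>(k, l). if l = partner k then 1 else 0) * Vm)"

lemma G0_carrier [simp]: "G0 \<in> carrier_mat (2 * m) (2 * m)"
  unfolding G0_def
  by (intro mult_carrier_mat[of _ "2 * m" "2 * m" _ "2 * m"]) simp_all

lemma Vm_vec_carrier [simp]: "u \<in> carrier_vec (2 * m) \<Longrightarrow> Vm *\<^sub>v u \<in> carrier_vec (2 * m)"
  by (rule mult_mat_vec_carrier[OF Vm_carrier])

lemma bform_G0:
  assumes u: "u \<in> carrier_vec (2 * m)" and w: "w \<in> carrier_vec (2 * m)"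
  shows "bform G0 u w = pairing (Vm *\<^sub>v u) (Vm *\<^sub>v w)"
proof -
  let ?B = "mat (2 * m) (2 * m) (\<lambda>(k, l). if l = partner k then 1 else 0) :: 'a mat"
  have B: "?B \<in> carrier_mat (2 * m) (2 * m)" by simp
  have Vt: "transpose_mat Vm \<in> carrier_mat (2 * m) (2 * m)" by simp
  have BV: "?B * Vm \<in> carrier_mat (2 * m) (2 * m)" by (rule mult_carrier_mat[OF B Vm_carrier])
  have Bw: "?B *\<^sub>v (Vm *\<^sub>v w) \<in> carrier_vec (2 * m)"
    using w by (intro mult_mat_vec_carrier[OF B] Vm_vec_carrier)
  have "G0 *\<^sub>v w = transpose_mat Vm *\<^sub>v ((?B * Vm) *\<^sub>v w)"
    unfolding G0_def by (rule assoc_mult_mat_vec[OF Vt BV w])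
  also have "(?B * Vm) *\<^sub>v w = ?B *\<^sub>v (Vm *\<^sub>v w)"
    by (rule assoc_mult_mat_vec[OF B Vm_carrier w])
  finally have e: "G0 *\<^sub>v w = transpose_mat Vm *\<^sub>v (?B *\<^sub>v (Vm *\<^sub>v w))" .
  have "bform G0 u w = (transpose_mat Vm *\<^sub>v (?B *\<^sub>v (Vm *\<^sub>v w))) \<bullet> u"
    unfolding bform_def e
    by (rule comm_scalar_prod[OF u mult_mat_vec_carrier[OF Vt Bw]])
  also have "\<dots> = (?B *\<^sub>v (Vm *\<^sub>v w)) \<bullet> (Vm *\<^sub>v u)"
    by (rule transpose_vec_mult_scalar[OF Vm_carrier u Bw])
  also have "\<dots> = (\<Sum>k<2 * m. (?B *\<^sub>v (Vm *\<^sub>v w)) $ k * (Vm *\<^sub>v u) $ k)"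
    using carrier_vecD[OF Vm_vec_carrier[OF u]] by (simp add: scalar_prod_def atLeast0LessThan)
  also have "\<dots> = pairing (Vm *\<^sub>v u) (Vm *\<^sub>v w)"
    unfolding pairing_def
  proof (intro sum.cong refl)
    fix k assume "k \<in> {..<2 * m}"
    then have k: "k < 2 * m" "partner k < 2 * m" by (simp_all add: partner_less)
    have "(?B *\<^sub>v (Vm *\<^sub>v w)) $ k = (\<Sum>l<2 * m. (if l = partner k then 1 else 0) * (Vm *\<^sub>v w) $ l)"
      using k carrier_vecD[OF Vm_vec_carrier[OF w]] by (simp add: scalar_prod_def atLeast0LessThan)
    also have "\<dots> = (\<Sum>l<2 * m. if l = partner k then (Vm *\<^sub>v w) $ partner k else 0)"
      by (intro sum.cong) auto
    also have "\<dots> = (Vm *\<^sub>v w) $ partner k" using k by simp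
    finally show "(?B *\<^sub>v (Vm *\<^sub>v w)) $ k * (Vm *\<^sub>v u) $ k = (Vm *\<^sub>v u) $ k * (Vm *\<^sub>v w) $ partner k"
      by simp
  qed
  finally show ?thesis .
qed

lemma bij_partner: "bij_betw partner {..<2 * m} {..<2 * m}"
  by (rule bij_betw_byWitness[where f' = partner]) (auto simp: partner_less)

lemma pairing_sym: "pairing w w' = pairing w' w"
proof -
  have "pairing w w' = (\<Sum>k<2 * m. w $ partner k * w' $ (partner (partner k)))"
    unfolding pairing_def by (rule sum.reindex_bij_betw[OF bij_partner, symmetric])
  then show ?thesis by (simp add: pairing_def mult.commute)
qed

lemma pairing_unit:
  assumes "k < 2 * m"
  shows "pairing w (unit_vec (2 * m) (partner k)) = w $ k"
proof -
  have "pairing w (unit_vec (2 * m) (partner k)) = (\<Sum>l<2 * m. if l = k then w $ k else 0)"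
    unfolding pairing_def
    using assms by (intro sum.cong) (auto simp: partner_less inj_eq[OF inj_partner])
  then show ?thesis using assms by simp
qed

lemma Vm_C_vec:
  assumes "u \<in> carrier_vec (2 * m)" "k < 2 * m"
  shows "(Vm *\<^sub>v (C *\<^sub>v u)) $ k = ev k * (Vm *\<^sub>v u) $ k"
proof -
  have "Vm *\<^sub>v (C *\<^sub>v u) = (D * Vm) *\<^sub>v u"
    using assoc_mult_mat_vec[OF Vm_carrier C_carrier assms(1)] by (simp add: Vm_C)
  also have "\<dots> = D *\<^sub>v (Vm *\<^sub>v u)"
    by (rule assoc_mult_mat_vec[OF D_carrier Vm_carrier assms(1)])
  finally have "(Vm *\<^sub>v (C *\<^sub>v u)) $ k = (\<Sum>i<2 * m. (if k = i then ev k else 0) * (Vm *\<^sub>v u) $ i)"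
    using assms(2) carrier_vecD[OF Vm_vec_carrier[OF assms(1)]]
    by (simp add: D_def scalar_prod_def atLeast0LessThan)
  also have "\<dots> = (\<Sum>i<2 * m. if i = k then ev k * (Vm *\<^sub>v u) $ k else 0)"
    by (intro sum.cong) auto
  finally show ?thesis using assms(2) by simp
qed

lemma G0_nondegenerate:
  assumes u: "u \<in> carrier_vec (2 * m)" and z: "\<And>w. w \<in> carrier_vec (2 * m) \<Longrightarrow> bform G0 u w = 0"
  shows "u = 0\<^sub>v (2 * m)"
proof -
  have "(Vm *\<^sub>v u) $ k = 0" if "k < 2 * m" for k
    using z[of "col Pm (partner k)"] that partner_less[OF that]
    by (simp add: bform_G0 u Vm_col_Pm pairing_unit)
  then have "Vm *\<^sub>v u = 0\<^sub>v (2 * m)"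
    using carrier_vecD[OF Vm_vec_carrier[OF u]] by (intro eq_vecI) auto
  then show ?thesis using Pm_Vm_vec[OF u] by (simp add: mult_mat_zero_vec[OF Pm_carrier])
qed

text \<open>Under \<open>C\<close> the term at \<open>k\<close> of the pairing is multiplied by
  \<open>ev k * ev (partner k)\<close>, which is 1. For eigenvectors a single term is left, and it
  is nonzero just when their indices are partners.\<close>

lemma G0_invariant: "invariant_form C G0"
  unfolding invariant_form_def carrier_matD(1)[OF C_carrier]
proof (intro conjI ballI impI allI)
  fix u w :: "'a vec" assume u: "u \<in> carrier_vec (2 * m)" and w: "w \<in> carrier_vec (2 * m)"
  show "bform G0 u w = bform G0 w u"
    using u w by (simp add: bform_G0 pairing_sym)
  have Cu: "C *\<^sub>v u \<in> carrier_vec (2 * m)" "C *\<^sub>v w \<in> carrier_vec (2 * m)"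
    using u w by (auto intro: mult_mat_vec_carrier[OF C_carrier])
  have "(Vm *\<^sub>v (C *\<^sub>v u)) $ k * (Vm *\<^sub>v (C *\<^sub>v w)) $ partner k = (Vm *\<^sub>v u) $ k * (Vm *\<^sub>v w) $ partner k"
    if "k < 2 * m" for k
    using ev_partner[OF that] partner_less[OF that] u w that
    by (simp add: Vm_C_vec)
  then show "bform G0 (C *\<^sub>v u) (C *\<^sub>v w) = bform G0 u w"
    using u w Cu by (simp add: bform_G0 pairing_def)
next
  fix u w l l' assume h: "eigenvector C u l \<and> eigenvector C w l'"
  then obtain k s where k: "k < 2 * m" "s \<noteq> 0" "l = ev k" "Vm *\<^sub>v u = s \<cdot>\<^sub>v unit_vec (2 * m) k"
    by (metis eigenvector_C)
  obtain k' s' where k': "k' < 2 * m" "s' \<noteq> 0" "l' = ev k'" "Vm *\<^sub>v w = s' \<cdot>\<^sub>v unit_vec (2 * m) k'"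
    using h by (metis eigenvector_C)
  have car: "u \<in> carrier_vec (2 * m)" "w \<in> carrier_vec (2 * m)"
    using h by (simp_all add: eigenvector_def carrier_matD(1)[OF C_carrier])
  have "bform G0 u w = (\<Sum>i<2 * m. if i = k then (if partner k = k' then s * s' else 0) else 0)"
    unfolding bform_G0[OF car] pairing_def k(4) k'(4) using k(1) k'(1)
    by (intro sum.cong) (auto simp: partner_less)
  also have "\<dots> = (if partner k = k' then s * s' else 0)" using k(1) by simp
  finally show "bform G0 u w \<noteq> 0 \<longleftrightarrow> l * l' = 1"
    using k k' ev_mult_eq_1_iff[OF k(1) k'(1)] by auto
next
  fix u assume "u \<in> carrier_vec (2 * m)" "\<forall>w\<in>carrier_vec (2 * m). bform G0 u w = 0"
  then show "u = 0\<^sub>v (2 * m)" using G0_nondegenerate by blast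
qed simp

lemma ex_hodge_data: "\<exists>G vol. hodge_data m a G vol"
proof -
  have "det G0 \<noteq> 0"
  proof
    assume "det G0 = 0"
    then obtain u where u: "u \<in> carrier_vec (2 * m)" "u \<noteq> 0\<^sub>v (2 * m)" "G0 *\<^sub>v u = 0\<^sub>v (2 * m)"
      using det_0_iff_vec_prod_zero_field[OF G0_carrier] by auto
    have "bform G0 u w = 0" if "w \<in> carrier_vec (2 * m)" for w
    proof -
      have "bform G0 u w = bform G0 w u"
        using u(1) that by (simp add: bform_G0 pairing_sym)
      then show ?thesis using that u(3) by (simp add: bform_def)
    qed
    then show False using G0_nondegenerate[OF u(1)] u(2) by blast
  qed
  \<comment> \<open>Normalising the volume means solving \<open>t^2 * det G0 = 1\<close>; the square
    root exists in an algebraically closed field.\<close>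
  obtain t where t: "t ^ 2 = inverse (det G0)"
    using nth_root_exists[of 2 "inverse (det G0)"] by auto
  define vol where "vol = scale_fun t (ext_basis {..<2 * m})"
  have "vol \<in> ext_power (2 * m) (2 * m)"
    by (auto simp: vol_def ext_power_def ext_basis_def)
  moreover have "ext_bform G0 vol vol = 1"
  proof -
    have "ext_bform G0 vol vol = (\<Sum>I\<in>Pow {..<2 * m}. vol I * ext_map G0 vol I)"
      by (simp add: ext_bform_eq_dot[OF G0_carrier] ext_dot_def)
    also have "\<dots> = (\<Sum>I\<in>{{..<2 * m}}. vol I * ext_map G0 vol I)"
      by (rule sum.mono_neutral_right) (auto simp: vol_def ext_basis_def)
    also have "\<dots> = t ^ 2 * det G0"
      by (simp add: ext_map_top[OF G0_carrier]) (simp add: vol_def ext_basis_def power2_eq_square)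
    finally show ?thesis using t \<open>det G0 \<noteq> 0\<close> by simp
  qed
  ultimately have "hodge_data m a G0 vol"
    using G0_invariant by (simp add: hodge_data_def C_def)
  then show ?thesis by blast
qed

end


subsection \<open>Functions that are polynomial up to powers of the leading coefficient\<close>

text \<open>The localisation of the polynomial functions at the last parameter, with values at
  \<open>b m = 0\<close> disregarded. The companion matrix divides by \<open>b m\<close>, so its
  entries live here.\<close>

definition polyfrac :: "nat \<Rightarrow> ((nat \<Rightarrow> 'a::field) \<Rightarrow> 'a) set"
  where "polyfrac m = {f. \<exists>k. \<exists>g\<in>poly_funs m. \<forall>b. b m \<noteq> 0 \<longrightarrow> g b = b m ^ k * f b}"

lemma polyfracI:
  "g \<in> poly_funs m \<Longrightarrow> (\<And>b. b m \<noteq> 0 \<Longrightarrow> g b = b m ^ k * f b) \<Longrightarrow> f \<in> polyfrac m"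
  unfolding polyfrac_def by blast

lemma polyfrac_poly: "f \<in> poly_funs m \<Longrightarrow> f \<in> polyfrac m"
  by (rule polyfracI[where k = 0]) auto

lemma polyfrac_const: "(\<lambda>b. c) \<in> polyfrac m"
  by (intro polyfrac_poly poly_funs.const)

lemma polyfrac_cong:
  assumes "f \<in> polyfrac m" "\<And>b. b m \<noteq> 0 \<Longrightarrow> f b = f' b"
  shows "f' \<in> polyfrac m"
proof -
  obtain k g where "g \<in> poly_funs m" "\<And>b. b m \<noteq> 0 \<Longrightarrow> g b = b m ^ k * f b"
    using assms(1) unfolding polyfrac_def by blast
  then show ?thesis using assms(2) by (intro polyfracI[of g m k]) simp_all
qed

lemma polyfrac_if:
  "(P \<Longrightarrow> f \<in> polyfrac m) \<Longrightarrow> (\<not> P \<Longrightarrow> f' \<in> polyfrac m) \<Longrightarrow> (\<lambda>b. if P then f b else f' b) \<in> polyfrac m"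
  by (cases P) simp_all

context
  fixes m :: nat
  assumes m: "m \<ge> 1"
begin

lemma poly_funs_lead_power: "(\<lambda>b. b m ^ k) \<in> poly_funs m"
proof (induction k)
  case 0
  then show ?case by (simp add: poly_funs.const)
next
  case (Suc k)
  then show ?case using poly_funs.mult[OF poly_funs.coord[of m m] Suc.IH] m by simp
qed

lemma polyfrac_add:
  assumes "f \<in> polyfrac m" "f' \<in> polyfrac m"
  shows "(\<lambda>b. f b + f' b) \<in> polyfrac m"
proof -
  obtain k g where g: "g \<in> poly_funs m" "\<And>b. b m \<noteq> 0 \<Longrightarrow> g b = b m ^ k * f b"
    using assms(1) unfolding polyfrac_def by blast
  obtain k' g' where g': "g' \<in> poly_funs m" "\<And>b. b m \<noteq> 0 \<Longrightarrow> g' b = b m ^ k' * f' b"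
    using assms(2) unfolding polyfrac_def by blast
  show ?thesis
  proof (rule polyfracI)
    show "(\<lambda>b. b m ^ k' * g b + b m ^ k * g' b) \<in> poly_funs m"
      by (intro poly_funs.add poly_funs.mult poly_funs_lead_power g g')
    show "b m ^ k' * g b + b m ^ k * g' b = b m ^ (k + k') * (f b + f' b)" if "b m \<noteq> 0" for b
      using that by (simp add: g(2) g'(2) power_add algebra_simps)
  qed
qed

lemma polyfrac_mult:
  assumes "f \<in> polyfrac m" "f' \<in> polyfrac m"
  shows "(\<lambda>b. f b * f' b) \<in> polyfrac m"
proof -
  obtain k g where g: "g \<in> poly_funs m" "\<And>b. b m \<noteq> 0 \<Longrightarrow> g b = b m ^ k * f b"
    using assms(1) unfolding polyfrac_def by blast
  obtain k' g' where g': "g' \<in> poly_funs m" "\<And>b. b m \<noteq> 0 \<Longrightarrow> g' b = b m ^ k' * f' b"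
    using assms(2) unfolding polyfrac_def by blast
  show ?thesis
  proof (rule polyfracI)
    show "(\<lambda>b. g b * g' b) \<in> poly_funs m"
      by (intro poly_funs.mult g g')
    show "g b * g' b = b m ^ (k + k') * (f b * f' b)" if "b m \<noteq> 0" for b
      using that by (simp add: g(2) g'(2) power_add algebra_simps)
  qed
qed

lemma polyfrac_uminus: "f \<in> polyfrac m \<Longrightarrow> (\<lambda>b. - f b) \<in> polyfrac m"
  using polyfrac_mult[OF polyfrac_const[of "-1"]] by fastforce

lemma polyfrac_sum: "(\<And>i. i \<in> A \<Longrightarrow> f i \<in> polyfrac m) \<Longrightarrow> (\<lambda>b. \<Sum>i\<in>A. f i b) \<in> polyfrac m"
  by (induction A rule: infinite_finite_induct) (auto intro: polyfrac_const polyfrac_add)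

lemma polyfrac_prod: "(\<And>i. i \<in> A \<Longrightarrow> f i \<in> polyfrac m) \<Longrightarrow> (\<lambda>b. \<Prod>i\<in>A. f i b) \<in> polyfrac m"
  by (induction A rule: infinite_finite_induct) (auto intro: polyfrac_const polyfrac_mult)

lemma polyfrac_lead: "(\<lambda>b. b m) \<in> polyfrac m"
  using m by (intro polyfrac_poly poly_funs.coord) auto

lemma polyfrac_inverse_lead: "(\<lambda>b. inverse (b m)) \<in> polyfrac m"
  by (rule polyfracI[OF poly_funs.const[of 1], of _ 1]) auto

lemma polyfrac_det:
  assumes "\<And>i j. i < n \<Longrightarrow> j < n \<Longrightarrow> (\<lambda>b. F b i j) \<in> polyfrac m"
  shows "(\<lambda>b. det (mat n n (\<lambda>(i, j). F b i j))) \<in> polyfrac m"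
proof (rule polyfrac_cong)
  have less: "p i < n" if "p permutes {0..<n}" "i < n" for p i
    using permutes_in_image[OF that(1), of i] that(2) by simp
  show "(\<lambda>b. \<Sum>p\<in>{p. p permutes {0..<n}}. signof p * (\<Prod>i\<in>{0..<n}. F b i (p i))) \<in> polyfrac m"
    by (intro polyfrac_sum polyfrac_mult polyfrac_const polyfrac_prod assms)
       (auto simp: less)
  show "(\<Sum>p\<in>{p. p permutes {0..<n}}. signof p * (\<Prod>i\<in>{0..<n}. F b i (p i))) =
      det (mat n n (\<lambda>(i, j). F b i j))" for b
    by (auto simp: det_def'[of _ n] less intro!: sum.cong prod.cong)
qed

lemma polyfrac_coeff_symbol: "(\<lambda>b. coeff (symbol_poly m b) k) \<in> polyfrac m"
proof -
  have "(\<lambda>b. skew_ext m b s) \<in> polyfrac m" for s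
  proof -
    consider "1 \<le> s \<and> s \<le> int m" | "1 \<le> - s \<and> - s \<le> int m" | "\<not> (1 \<le> s \<and> s \<le> int m)" "\<not> (1 \<le> - s \<and> - s \<le> int m)"
      by blast
    then show ?thesis
    proof cases
      case 1
      then have "(\<lambda>b. b (nat s)) \<in> polyfrac m" by (intro polyfrac_poly poly_funs.coord) auto
      then show ?thesis using 1 by (simp add: skew_ext_def)
    next
      case 2
      then have "(\<lambda>b. - b (nat (- s))) \<in> polyfrac m"
        by (intro polyfrac_uminus polyfrac_poly poly_funs.coord) auto
      then show ?thesis using 2 by (simp add: skew_ext_def)
    next
      case 3
      then show ?thesis unfolding skew_ext_def by (simp only: if_False polyfrac_const)
    qed
  qed
  then show ?thesis by (simp add: coeff_symbol_poly)
qed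

lemma polyfrac_companion:
  assumes "i < 2 * m" "j < 2 * m"
  shows "(\<lambda>b. companion_q m b $$ (i, j)) \<in> polyfrac m"
proof (rule polyfrac_cong)
  show "(\<lambda>b. if Suc j = 2 * m then - (inverse (b m) * coeff (symbol_poly m b) i)
      else if i = Suc j then 1 else 0) \<in> polyfrac m"
    by (intro polyfrac_if polyfrac_const polyfrac_uminus polyfrac_mult polyfrac_inverse_lead polyfrac_coeff_symbol)
  fix b :: "nat \<Rightarrow> 'a" assume "b m \<noteq> 0"
  then show "(if Suc j = 2 * m then - (inverse (b m) * coeff (symbol_poly m b) i)
      else if i = Suc j then 1 else 0) = companion_q m b $$ (i, j)"
    using assms degree_symbol_poly(1)[of b m] m by (simp add: companion_q_def companion_def)
qed

text \<open>The coordinates of the image are sums of minors times coordinates of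
  \<open>\<omega>\<close>, and minors are polynomial in the entries.\<close>

lemma polyfrac_ext_map:
  assumes C: "\<And>b. b m \<noteq> 0 \<Longrightarrow> C b \<in> carrier_mat N N"
    and F: "\<And>i j. i < N \<Longrightarrow> j < N \<Longrightarrow> (\<lambda>b. C b $$ (i, j)) \<in> polyfrac m"
    and \<omega>: "\<And>J. (\<lambda>b. \<omega> b J) \<in> polyfrac m"
  shows "(\<lambda>b. ext_map (C b) (\<omega> b) I) \<in> polyfrac m"
proof (cases "I \<subseteq> {..<N}")
  case True
  let ?S = "\<lambda>b J. mat (card I) (card I) (\<lambda>(i, j). C b $$ (pick I i, pick J j))"
  show ?thesis
  proof (rule polyfrac_cong)
    show "(\<lambda>b. \<Sum>J | J \<subseteq> {..<N} \<and> card J = card I. \<omega> b J * det (?S b J)) \<in> polyfrac m"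
      using True by (intro polyfrac_sum polyfrac_mult \<omega> polyfrac_det F) (auto intro!: pick_less)
    fix b :: "nat \<Rightarrow> 'a" assume b: "b m \<noteq> 0"
    have "submatrix (C b) I J = ?S b J" if "J \<subseteq> {..<N}" "card J = card I" for J
    proof -
      have "{i. i < N \<and> i \<in> I} = I" "{i. i < N \<and> i \<in> J} = J" using True that by auto
      then show ?thesis using that carrier_matD[OF C[of b, OF b]] by (simp add: submatrix_def)
    qed
    then show "(\<Sum>J | J \<subseteq> {..<N} \<and> card J = card I. \<omega> b J * det (?S b J)) = ext_map (C b) (\<omega> b) I"
      unfolding ext_map_eval[OF C[of b, OF b] True] by (intro sum.cong) auto
  qed
next
  case False
  have "ext_map (C b) (\<omega> b) I = 0" if "b m \<noteq> 0" for b
    using ext_map_in_space[OF C[of b, OF that], of "\<omega> b"] False by (auto simp: ext_space_def)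
  then show ?thesis by (intro polyfrac_cong[OF polyfrac_const[of 0]]) simp
qed

lemma polyfrac_transfer:
  assumes "\<And>J. (\<lambda>b. \<omega> b J) \<in> polyfrac m"
  shows "(\<lambda>b. transfer m b (\<omega> b) I) \<in> polyfrac m"
  unfolding transfer_def scale_fun_apply using m
  by (intro polyfrac_mult polyfrac_const polyfrac_lead polyfrac_ext_map[where N = "2 * m"]
      companion_q_carrier polyfrac_companion assms)

lemma polyfrac_transfer_power:
  "(\<lambda>b. ((transfer m b \<circ> transfer m b) ^^ k) w I) \<in> polyfrac m"
proof (induction k arbitrary: I)
  case 0
  then show ?case by (simp add: polyfrac_const)
next
  case (Suc k)
  then show ?case by (simp add: polyfrac_transfer)
qed

text \<open>Multiplying the numerator once more by \<open>b m\<close> puts both inequalities into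
  the nonvanishing of one polynomial function.\<close>

lemma polyfrac_nonzero_open:
  assumes "f \<in> polyfrac m"
  shows "zariski_open m {b. b m \<noteq> 0 \<and> f b \<noteq> 0}"
proof -
  obtain k g where g: "g \<in> poly_funs m" "\<And>b. b m \<noteq> 0 \<Longrightarrow> g b = b m ^ k * f b"
    using assms unfolding polyfrac_def by blast
  have "(\<lambda>b. b m * g b) \<in> poly_funs m"
    using m by (intro poly_funs.mult poly_funs.coord g) auto
  moreover have "{b. b m \<noteq> 0 \<and> f b \<noteq> 0} = {b. \<exists>h\<in>{\<lambda>b. b m * g b}. h b \<noteq> 0}"
    using g(2) by auto
  ultimately show ?thesis unfolding zariski_open_def by blast
qed

end


subsection \<open>A discriminant of the symbol\<close>

text \<open>A Sylvester matrix of \<open>q\<close> and \<open>q'\<close> whose size does not shrink when \<open>q'\<close> drops in degree, as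
  happens if the characteristic divides \<open>2m\<close>.\<close>

definition sylvester_symbol :: "nat \<Rightarrow> (nat \<Rightarrow> 'a::field) \<Rightarrow> 'a mat"
  where "sylvester_symbol m b = mat (4 * m - 1) (4 * m - 1) (\<lambda>(i, j).
    if i < 2 * m - 1 then coeff (monom 1 i * symbol_poly m b) j
    else coeff (monom 1 (i - (2 * m - 1)) * pderiv (symbol_poly m b)) j)"

lemma polyfrac_det_sylvester:
  assumes m: "m \<ge> 1"
  shows "(\<lambda>b. det (sylvester_symbol m b)) \<in> polyfrac m"
  unfolding sylvester_symbol_def coeff_monom_mult coeff_pderiv
  by (intro polyfrac_det[OF m] polyfrac_if polyfrac_mult[OF m] polyfrac_const polyfrac_coeff_symbol[OF m])

lemma poly_sum_coeffs: "degree p < n \<Longrightarrow> poly p z = (\<Sum>j<n. coeff p j * z ^ j)" for z :: "'a::field"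
  unfolding poly_altdef by (rule sum.mono_neutral_left) (auto simp: coeff_eq_0)

lemma degree_monom_mult_less:
  "i + degree p < n \<Longrightarrow> degree (monom 1 i * p) < n" for p :: "'a::field poly"
  using degree_mult_le[of "monom 1 i" p] degree_monom_le[of "1::'a" i] by linarith

text \<open>The rows are coefficient vectors of multiples of the symbol and of its derivative, so a
  multiple root \<open>z\<close> would make the vector of powers of \<open>z\<close> a kernel
  vector. Hence all roots are simple, and the cofactor left after dividing out one factor per root
  is constant.\<close>

lemma admissible_if_det_sylvester:
  fixes b :: "nat \<Rightarrow> 'a::alg_closed_field"
  assumes m: "m \<ge> 1" and bm: "b m \<noteq> 0" and det: "det (sylvester_symbol m b) \<noteq> 0"
  shows "admissible m b"
proof -
  let ?q = "symbol_poly m b" and ?n = "4 * m - 1"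
  have dq: "degree ?q = 2 * m" and q0: "?q \<noteq> 0"
    using degree_symbol_poly[of b m, OF bm m] bm by auto
  have S: "sylvester_symbol m b \<in> carrier_mat ?n ?n" by (simp add: sylvester_symbol_def)
  have simple: "poly (pderiv ?q) z \<noteq> 0" if z: "poly ?q z = 0" for z
  proof
    assume z': "poly (pderiv ?q) z = 0"
    define w where "w = vec ?n (\<lambda>j. z ^ j)"
    have "sylvester_symbol m b *\<^sub>v w = 0\<^sub>v ?n"
    proof (rule eq_vecI)
      fix i assume i: "i < dim_vec (0\<^sub>v ?n :: 'a vec)"
      define r where "r = (if i < 2 * m - 1 then monom 1 i * ?q else monom 1 (i - (2 * m - 1)) * pderiv ?q)"
      have "degree (pderiv ?q) \<le> 2 * m - 1" using degree_pderiv_le[of ?q] dq by simp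
      then have "degree r < ?n"
        using i m dq by (auto simp: r_def intro!: degree_monom_mult_less)
      then have "(sylvester_symbol m b *\<^sub>v w) $ i = poly r z"
        using i by (simp add: sylvester_symbol_def w_def scalar_prod_def atLeast0LessThan poly_sum_coeffs r_def)
      then show "(sylvester_symbol m b *\<^sub>v w) $ i = 0\<^sub>v ?n $ i"
        using i z z' by (simp add: r_def)
    qed (simp add: sylvester_symbol_def)
    moreover have "w \<in> carrier_vec ?n" by (simp add: w_def)
    moreover have "w \<noteq> 0\<^sub>v ?n"
    proof
      assume "w = 0\<^sub>v ?n"
      moreover have "w $ 0 = 1" using m by (simp add: w_def)
      ultimately show False using m by simp
    qed
    ultimately show False using det det_0_iff_vec_prod_zero_field[OF S] by blast
  qed
  define R where "R = {z. poly ?q z = 0}"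
  have fR: "finite R" unfolding R_def using q0 by (rule poly_roots_finite)
  obtain r where r: "?q = (\<Prod>z\<in>R. [:- z, 1:]) * r"
    using prod_linear_dvd[OF fR, of ?q] unfolding R_def dvd_def by blast
  have "degree r = 0"
  proof (rule ccontr)
    assume "degree r \<noteq> 0"
    then obtain z where z: "poly r z = 0" using alg_closed_imp_poly_has_root[of r] by auto
    then have "poly ?q z = 0" by (subst r) simp
    then have "z \<in> R" by (simp add: R_def)
    then have "poly (\<Prod>z\<in>R. [:- z, 1:]) z = 0" using fR by (auto simp: poly_prod)
    then have "poly (pderiv ?q) z = 0" using z by (subst r) (simp add: pderiv_mult)
    then show False using simple[OF \<open>poly ?q z = 0\<close>] by simp
  qed
  moreover have "degree ?q = degree (\<Prod>z\<in>R. [:- z, 1:]) + degree r"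
    using q0 by (subst r, intro degree_mult_eq) (use r in auto)
  ultimately have "card R = 2 * m" using dq by (simp add: degree_prod_linear)
  then show ?thesis using bm by (simp add: admissible_def R_def)
qed

lemma sum_lessThan_add: "(\<Sum>i<k + l. f i) = (\<Sum>i<k. f i) + (\<Sum>i<l. f (k + i))"
  for f :: "nat \<Rightarrow> 'a::comm_monoid_add"
  by (induction l) (simp_all add: add_ac)

text \<open>A vector in the left kernel encodes a relation \<open>u * q + v * q' = 0\<close> with
  \<open>degree v < 2 * m\<close>. At the \<open>2 * m\<close> simple roots of \<open>q\<close> the
  derivative is nonzero, so \<open>v\<close> vanishes at all of them; hence \<open>v = 0\<close>,
  then \<open>u = 0\<close>.\<close>

lemma det_sylvester_if_admissible:
  fixes b :: "nat \<Rightarrow> 'a::alg_closed_field"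
  assumes m: "m \<ge> 1" and adm: "admissible m b"
  shows "det (sylvester_symbol m b) \<noteq> 0"
proof
  let ?q = "symbol_poly m b" and ?n = "4 * m - 1" and ?S = "sylvester_symbol m b"
  assume "det ?S = 0"
  have bm: "b m \<noteq> 0" using adm by (simp add: admissible_def)
  have dq: "degree ?q = 2 * m" and q0: "?q \<noteq> 0"
    using degree_symbol_poly[of b m, OF bm m] bm by auto
  have S: "?S \<in> carrier_mat ?n ?n" by (simp add: sylvester_symbol_def)
  then have "det (transpose_mat ?S) = 0" using \<open>det ?S = 0\<close> by (simp add: det_transpose)
  then obtain w where w: "w \<in> carrier_vec ?n" "w \<noteq> 0\<^sub>v ?n" "transpose_mat ?S *\<^sub>v w = 0\<^sub>v ?n"
    using det_0_iff_vec_prod_zero_field[of "transpose_mat ?S" ?n] S by auto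
  have n: "?n = (2 * m - 1) + 2 * m" using m by simp
  define u where "u = (\<Sum>i<2 * m - 1. monom (w $ i) i)"
  define v where "v = (\<Sum>i<2 * m. monom (w $ (2 * m - 1 + i)) i)"
  have cu: "coeff u i = (if i < 2 * m - 1 then w $ i else 0)"
    and cv: "coeff v i = (if i < 2 * m then w $ (2 * m - 1 + i) else 0)" for i
    by (simp_all add: u_def v_def coeff_sum if_distrib cong: if_cong)
  have mm: "coeff (monom c i * p) j = coeff (monom 1 i * p) j * c" for c i j and p :: "'a poly"
    by (simp add: coeff_monom_mult)
  have "coeff (u * ?q + v * pderiv ?q) j = 0" if "j < ?n" for j
  proof -
    have "0 = (transpose_mat ?S *\<^sub>v w) $ j" using w(3) that by simp
    also have "\<dots> = (\<Sum>i<?n. ?S $$ (i, j) * w $ i)"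
      using that w(1) S by (simp add: scalar_prod_def atLeast0LessThan)
    also have "\<dots> = (\<Sum>i<2 * m - 1. ?S $$ (i, j) * w $ i) + (\<Sum>i<2 * m. ?S $$ (2 * m - 1 + i, j) * w $ (2 * m - 1 + i))"
      unfolding n by (rule sum_lessThan_add)
    also have "(\<Sum>i<2 * m - 1. ?S $$ (i, j) * w $ i) = coeff (u * ?q) j"
      unfolding u_def sum_distrib_right coeff_sum using that m
      by (intro sum.cong) (auto simp: mm[of "w $ _"] sylvester_symbol_def)
    also have "(\<Sum>i<2 * m. ?S $$ (2 * m - 1 + i, j) * w $ (2 * m - 1 + i)) = coeff (v * pderiv ?q) j"
      unfolding v_def sum_distrib_right coeff_sum using that m
      by (intro sum.cong) (auto simp: mm[of "w $ _"] sylvester_symbol_def)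
    finally show ?thesis by simp
  qed
  moreover have "coeff (u * ?q + v * pderiv ?q) j = 0" if "j \<ge> ?n" for j
  proof -
    have "degree u \<le> 2 * m - 2" by (rule degree_le) (auto simp: cu)
    then have "degree (u * ?q) < j"
      using degree_mult_le[of u ?q] dq that m by linarith
    moreover have "degree v \<le> 2 * m - 1" by (rule degree_le) (auto simp: cv)
    then have "degree (v * pderiv ?q) < j"
      using degree_mult_le[of v "pderiv ?q"] degree_pderiv_le[of ?q] dq that m by linarith
    ultimately show ?thesis by (simp add: coeff_eq_0)
  qed
  ultimately have z: "u * ?q + v * pderiv ?q = 0"
    by (intro poly_eqI) (metis coeff_0 not_le)
  define R where "R = {z. poly ?q z = 0}"
  have fR: "finite R" unfolding R_def using q0 by (rule poly_roots_finite)
  have cR: "card R = 2 * m" using adm by (simp add: admissible_def R_def)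
  have q: "?q = smult (lead_coeff ?q) (\<Prod>z\<in>R. [:- z, 1:])"
    using fR cR dq q0 by (intro poly_eq_smult_prod_roots) (auto simp: R_def)
  have simple: "poly (pderiv ?q) z \<noteq> 0" if "z \<in> R" for z
  proof -
    define r where "r = smult (lead_coeff ?q) (\<Prod>y\<in>R - {z}. [:- y, 1:])"
    have "?q = [:- z, 1:] * r"
      by (subst q) (simp add: r_def prod.remove[OF fR that])
    then have "poly (pderiv ?q) z = poly ([:- z, 1:] * pderiv r + r * pderiv [:- z, 1:]) z"
      by (simp only: pderiv_mult)
    also have "\<dots> = poly r z" by (simp add: pderiv_pCons)
    finally have "poly (pderiv ?q) z = poly r z" .
    moreover have "poly r z \<noteq> 0" using fR q0 by (auto simp: r_def poly_prod)
    ultimately show ?thesis by simp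
  qed
  have "poly v z = 0" if "z \<in> R" for z
  proof -
    have "poly (u * ?q + v * pderiv ?q) z = 0" using z by simp
    then show ?thesis using simple[OF that] that by (simp add: R_def)
  qed
  then have sub: "R \<subseteq> {z. poly v z = 0}" by auto
  have v0: "v = 0"
  proof (rule ccontr)
    assume "v \<noteq> 0"
    then have "2 * m \<le> degree v"
      using card_mono[OF poly_roots_finite sub] card_poly_roots_bound[of v] cR by linarith
    then show False using cv[of "degree v"] \<open>v \<noteq> 0\<close> by simp
  qed
  then have u0: "u = 0" using z q0 by simp
  have "w $ i = 0" if "i < ?n" for i
  proof (cases "i < 2 * m - 1")
    case True
    then show ?thesis using cu[of i] u0 by simp
  next
    case False
    then have "i = 2 * m - 1 + (i - (2 * m - 1))" "i - (2 * m - 1) < 2 * m" using that m by simp_all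
    then show ?thesis using cv[of "i - (2 * m - 1)"] v0 by (metis coeff_0)
  qed
  then have "w = 0\<^sub>v ?n" using w(1) by auto
  with w(2) show False by simp
qed


subsection \<open>Krylov determinants\<close>

context skew_symbol
begin

text \<open>The polynomial with the weight values as roots annihilates \<open>T \<circ> T\<close>,
  and its degree is below \<open>d\<close>, so its coefficients give a linear relation among the
  rows. \<open>M\<close> and \<open>S\<close> are arbitrary because they will come from a different
  parameter point.\<close>

lemma krylov_degenerate:
  assumes w: "w \<in> E" and "card (weight_value m a x ` ternary_weights m) < d"
    and M: "M \<in> carrier_mat n (2 * m)"
  shows "det (mat d d (\<lambda>(i, j). ext_map M (((transfer m a \<circ> transfer m a) ^^ i) w) (S j))) = 0"
proof -
  let ?TT = "transfer m a \<circ> transfer m a"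
  let ?K = "mat d d (\<lambda>(i, j). ext_map M ((?TT ^^ i) w) (S j))"
  define p where "p = (\<Prod>l\<in>weight_value m a x ` ternary_weights m. [:- l, 1:])"
  have dp: "degree p < d" unfolding p_def degree_prod_linear by (rule assms)
  have lp: "coeff p (degree p) = 1" unfolding p_def by (rule monic_prod_linear)
  define \<eta> where "\<eta> = Qi w"
  have \<eta>: "\<eta> \<in> E" "w = Q \<eta>" using w Qi_in_E Q_Qi[OF E_space] by (auto simp: \<eta>_def)
  have "diag (\<lambda>S. poly p (tau S ^ 2)) \<eta> = 0"
  proof
    fix S
    have "poly p (tau S ^ 2) = 0" if "S \<in> middle_sets m"
    proof -
      have "tau S ^ 2 \<in> weight_value m a x ` ternary_weights m"
        using that unfolding tau_squares[symmetric] by blast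
      then show ?thesis using finite_ternary by (auto simp: p_def poly_prod)
    qed
    then show "diag (\<lambda>S. poly p (tau S ^ 2)) \<eta> S = 0 S"
      using \<eta>(1) by (auto simp: diag_def E_supported supported_def)
  qed
  then have "(\<Sum>k\<le>degree p. scale_fun (coeff p k) ((?TT ^^ k) w)) = 0"
    using poly_diag[where f = ?TT and d = "\<lambda>S. tau S ^ 2", OF transfer2_diag \<eta>(1), of p]
    by (simp only: \<eta>(2) flinear_0[OF flinear_ext_map])
  moreover have "(\<Sum>k<d. scale_fun (coeff p k) ((?TT ^^ k) w)) = (\<Sum>k\<le>degree p. scale_fun (coeff p k) ((?TT ^^ k) w))"
    using dp by (intro sum.mono_neutral_right) (auto simp: coeff_eq_0)
  ultimately have z: "(\<Sum>k<d. scale_fun (coeff p k) ((?TT ^^ k) w)) = 0" by simp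
  define u where "u = vec d (coeff p)"
  have "transpose_mat ?K *\<^sub>v u = 0\<^sub>v d"
  proof (rule eq_vecI)
    fix j assume j: "j < dim_vec (0\<^sub>v d :: 'a vec)"
    have "(transpose_mat ?K *\<^sub>v u) $ j = (\<Sum>i<d. ext_map M ((?TT ^^ i) w) (S j) * coeff p i)"
      using j by (simp add: u_def scalar_prod_def atLeast0LessThan)
    also have "\<dots> = ext_map M (\<Sum>i<d. scale_fun (coeff p i) ((?TT ^^ i) w)) (S j)"
      by (simp add: flinear_sum[OF flinear_ext_map] flinear_scale[OF flinear_ext_map] sum_fun_eval mult.commute)
    also have "\<dots> = 0" by (simp add: z flinear_0[OF flinear_ext_map])
    finally show "(transpose_mat ?K *\<^sub>v u) $ j = 0\<^sub>v d $ j" using j by simp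
  qed simp
  moreover have "u \<noteq> 0\<^sub>v d"
  proof
    assume "u = 0\<^sub>v d"
    then have "u $ degree p = 0" using dp by simp
    then show False using dp lp by (simp add: u_def)
  qed
  moreover have "u \<in> carrier_vec d" by (simp add: u_def)
  ultimately have "det (transpose_mat ?K) = 0"
    using det_0_iff_vec_prod_zero_field[of "transpose_mat ?K" d] by auto
  then show ?thesis using det_transpose[of ?K d] by simp
qed

text \<open>The vector has coefficient 1 at one chosen index set of each weight, and the coordinates
  read off are those at the chosen sets. The matrix is then the transposed Vandermonde matrix of the
  weight values.\<close>

lemma krylov_generic:
  assumes inj: "inj_on (weight_value m a x) (ternary_weights m)"
  obtains w S where "w \<in> E"
    "det (mat (3 ^ (m - 1)) (3 ^ (m - 1))
      (\<lambda>(i, j). Qi (((transfer m a \<circ> transfer m a) ^^ i) w) (S j))) \<noteq> 0"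
proof -
  let ?d = "3 ^ (m - 1) :: nat" and ?TT = "transfer m a \<circ> transfer m a"
  obtain e where e: "bij_betw e {..<?d} (ternary_weights m)"
    using ex_bij_betw_nat_finite[OF finite_ternary[of m]] card_ternary by (auto simp: atLeast0LessThan)
  have "\<forall>j. \<exists>S. j < ?d \<longrightarrow> S \<in> weight_sets (e j)"
    using weight_sets_nonempty bij_betwE[OF e] by (metis lessThan_iff)
  then obtain S where S: "\<And>j. j < ?d \<Longrightarrow> S j \<in> weight_sets (e j)" by metis
  define \<eta> where "\<eta> = (\<lambda>R. if R \<in> S ` {..<?d} then 1 else 0 :: 'a)"
  have \<eta>: "\<eta> \<in> E"
    using S weight_sets_middle by (auto simp: \<eta>_def E_supported supported_def split: if_splits)
  define y where "y j = weight_value m a x (e j)" for j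
  have "inj_on y {..<?d}"
    unfolding y_def using comp_inj_on[of e "{..<?d}" "weight_value m a x"] e inj
    by (simp add: bij_betw_def o_def)
  then have V: "det (mat ?d ?d (\<lambda>(k, j). y k ^ j)) \<noteq> 0" by (rule det_vandermonde)
  have "mat ?d ?d (\<lambda>(i, j). Qi ((?TT ^^ i) (Q \<eta>)) (S j)) = transpose_mat (mat ?d ?d (\<lambda>(k, j). y k ^ j))"
  proof (rule eq_matI)
    fix i j assume "i < dim_row (transpose_mat (mat ?d ?d (\<lambda>(k, j). y k ^ j)))"
      "j < dim_col (transpose_mat (mat ?d ?d (\<lambda>(k, j). y k ^ j)))"
    then have ij: "i < ?d" "j < ?d" by simp_all
    have "(?TT ^^ i) (Q \<eta>) = Q (diag (\<lambda>S. (tau S ^ 2) ^ i) \<eta>)"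
      by (rule funpow_diag[where f = ?TT and d = "\<lambda>S. tau S ^ 2", OF transfer2_diag \<eta>])
    moreover have "\<eta> (S j) = 1" using ij(2) by (simp add: \<eta>_def)
    ultimately have "Qi ((?TT ^^ i) (Q \<eta>)) (S j) = (tau (S j) ^ 2) ^ i"
      by (simp only: Qi_Q[OF E_space[OF diag_in_E[OF \<eta>]]]) (simp add: diag_def)
    then show "mat ?d ?d (\<lambda>(i, j). Qi ((?TT ^^ i) (Q \<eta>)) (S j)) $$ (i, j) =
        transpose_mat (mat ?d ?d (\<lambda>(k, j). y k ^ j)) $$ (i, j)"
      using ij by (simp add: tau_square_weight[OF S] y_def)
  qed simp_all
  then have "det (mat ?d ?d (\<lambda>(i, j). Qi ((?TT ^^ i) (Q \<eta>)) (S j))) \<noteq> 0"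
    using V det_transpose[of "mat ?d ?d (\<lambda>(k, j). y k ^ j)" ?d] by simp
  then show thesis using that Q_in_E[OF \<eta>] by blast
qed

end


subsection \<open>A generic choice of roots\<close>

text \<open>In a finite field the polynomial with every element as a root, increased by 1, would
  have positive degree and no root.\<close>

lemma infinite_alg_closed: "infinite (UNIV :: 'a::alg_closed_field set)"
proof
  assume fin: "finite (UNIV :: 'a set)"
  define p where "p = (\<Prod>z\<in>(UNIV::'a set). [:- z, 1:])"
  have "degree p > 0" unfolding p_def degree_prod_linear using fin by (simp add: card_gt_0_iff)
  then have "degree (p + 1) > 0" by (subst degree_add_eq_left) auto
  then obtain z where "poly (p + 1) z = 0" using alg_closed_imp_poly_has_root by blast
  moreover have "poly p z = 0" using fin by (auto simp: p_def poly_prod)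
  ultimately show False by simp
qed

lemma finite_power_coincidences:
  fixes p p' :: "'a::field"
  assumes "p \<noteq> 0" "k \<noteq> k'"
  shows "finite {y. p * y ^ k = p' * y ^ k'}"
proof -
  have "monom p k - monom p' k' \<noteq> 0"
  proof
    assume "monom p k - monom p' k' = 0"
    then have "coeff (monom p k - monom p' k') k = 0" by simp
    then show False using assms by simp
  qed
  then have "finite {y. poly (monom p k - monom p' k') y = 0}" by (rule poly_roots_finite)
  then show ?thesis by (simp add: poly_monom)
qed

text \<open>The new root \<open>y\<close> must avoid finitely many coincidences between products of
  different degree in \<open>y\<close>; for equal degrees in \<open>y\<close> the induction
  hypothesis separates the weights.\<close>

lemma ex_generic_roots:
  assumes "m \<ge> 1"
  shows "\<exists>x :: nat \<Rightarrow> 'a::alg_closed_field. (\<forall>i\<in>{1..<m}. x i \<noteq> 0) \<and>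
    inj_on (\<lambda>\<epsilon>. \<Prod>i=1..<m. x i powi (2 * \<epsilon> i)) (ternary_weights m)"
  using assms
proof (induction m rule: nat_induct_at_least)
  case base
  then show ?case by (auto simp: ternary_weights_def)
next
  case (Suc m)
  then obtain x :: "nat \<Rightarrow> 'a" where x: "\<forall>i\<in>{1..<m}. x i \<noteq> 0"
    and inj: "inj_on (\<lambda>\<epsilon>. \<Prod>i=1..<m. x i powi (2 * \<epsilon> i)) (ternary_weights m)"
    by blast
  define P where "P \<epsilon> = (\<Prod>i=1..<m. x i powi (2 * \<epsilon> i))" for \<epsilon> :: "nat \<Rightarrow> int"
  have P0: "P \<epsilon> \<noteq> 0" for \<epsilon> using x by (auto simp: P_def)
  \<comment> \<open>The exponents \<open>2 * \<epsilon> m\<close>, that is -2, 0 and 2, raised by 2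
    so that the coincidences become polynomial equations in \<open>y\<close>.\<close>
  define K where "K = {0, 2, 4 :: nat}"
  define bad where "bad = insert 0 (\<Union>p\<in>P ` ternary_weights m. \<Union>p'\<in>P ` ternary_weights m.
    \<Union>k\<in>K. \<Union>k'\<in>K - {k}. {y. p * y ^ k = p' * y ^ k'})"
  have "finite bad"
    unfolding bad_def K_def using finite_ternary P0
    by (intro finite.insertI finite_UN_I finite_imageI finite_power_coincidences) auto
  then obtain y where y: "y \<notin> bad" using infinite_alg_closed ex_new_if_finite by blast
  then have y0: "y \<noteq> 0" by (simp add: bad_def)
  define x' where "x' = x(m := y)"
  have split: "{1..<Suc m} = insert m {1..<m}" using Suc.hyps by auto
  have prod: "(\<Prod>i=1..<Suc m. x' i powi (2 * \<epsilon> i)) = y powi (2 * \<epsilon> m) * P (restrict \<epsilon> {1..<m})" for \<epsilon>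
    unfolding split by (auto simp: x'_def P_def intro!: prod.cong)
  have "inj_on (\<lambda>\<epsilon>. \<Prod>i=1..<Suc m. x' i powi (2 * \<epsilon> i)) (ternary_weights (Suc m))"
  proof (rule inj_onI)
    fix \<epsilon> \<epsilon>' assume t: "\<epsilon> \<in> ternary_weights (Suc m)" "\<epsilon>' \<in> ternary_weights (Suc m)"
    assume eq: "(\<Prod>i=1..<Suc m. x' i powi (2 * \<epsilon> i)) = (\<Prod>i=1..<Suc m. x' i powi (2 * \<epsilon>' i))"
    let ?r = "restrict \<epsilon> {1..<m}" and ?r' = "restrict \<epsilon>' {1..<m}"
    have r: "?r \<in> ternary_weights m" "?r' \<in> ternary_weights m"
      using t by (auto simp: ternary_weights_def)
    have em: "\<epsilon> m \<in> {-1, 0, 1}" "\<epsilon>' m \<in> {-1, 0, 1}"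
      using t Suc.hyps by (auto simp: ternary_weights_def)
    have sh: "y powi (2 * e) * y ^ 2 = y ^ nat (2 * e + 2)" if "e \<in> {-1, 0, 1}" for e
      using that y0 by (auto simp: power_int_def field_simps)
    have eq': "P ?r * y ^ nat (2 * \<epsilon> m + 2) = P ?r' * y ^ nat (2 * \<epsilon>' m + 2)"
      using eq unfolding prod sh[OF em(1), symmetric] sh[OF em(2), symmetric] by (simp add: mult_ac)
    have K: "nat (2 * \<epsilon> m + 2) \<in> K" "nat (2 * \<epsilon>' m + 2) \<in> K" using em by (auto simp: K_def)
    have "nat (2 * \<epsilon> m + 2) = nat (2 * \<epsilon>' m + 2)"
    proof (rule ccontr)
      assume ne: "nat (2 * \<epsilon> m + 2) \<noteq> nat (2 * \<epsilon>' m + 2)"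
      have "y \<in> bad"
        unfolding bad_def
      proof (intro insertI2 UN_I)
        show "P ?r \<in> P ` ternary_weights m" "P ?r' \<in> P ` ternary_weights m"
          using r by blast+
        show "nat (2 * \<epsilon> m + 2) \<in> K" by (fact K)
        show "nat (2 * \<epsilon>' m + 2) \<in> K - {nat (2 * \<epsilon> m + 2)}" using K(2) ne by simp
        show "y \<in> {y. P ?r * y ^ nat (2 * \<epsilon> m + 2) = P ?r' * y ^ nat (2 * \<epsilon>' m + 2)}"
          using eq' by simp
      qed
      then show False using y by simp
    qed
    then have m_eq: "\<epsilon> m = \<epsilon>' m" using em by auto
    then have "P ?r = P ?r'" using eq' y0 by simp
    then have r_eq: "?r = ?r'" using inj r by (auto simp: inj_on_def P_def)
    show "\<epsilon> = \<epsilon>'"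
    proof
      fix i
      consider "i \<in> {1..<m}" | "i = m" | "i \<notin> {1..<Suc m}"
        by (cases "i = m"; cases "i \<in> {1..<m}") auto
      then show "\<epsilon> i = \<epsilon>' i"
      proof cases
        case 1
        then show ?thesis using fun_cong[OF r_eq, of i] by simp
      next
        case 2
        then show ?thesis using m_eq by simp
      next
        case 3
        then show ?thesis using t by (auto simp: ternary_weights_def PiE_def extensional_def)
      qed
    qed
  qed
  moreover have "\<forall>i\<in>{1..<Suc m}. x' i \<noteq> 0" using x y0 by (auto simp: x'_def)
  ultimately show ?case by blast
qed

text \<open>Distinct weights already force distinct roots: compare the weights \<open>\<plusminus>e\<^sub>i\<close>, \<open>\<plusminus>e\<^sub>k\<close> and \<open>0\<close>,
  where \<open>e\<^sub>i\<close> is the \<open>i\<close>-th unit vector.\<close>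

lemma ex_generic_symbol:
  assumes m: "m \<ge> 1" and two: "(2::'a::alg_closed_field) \<noteq> 0"
  obtains c x :: "nat \<Rightarrow> 'a::alg_closed_field" where "skew_symbol m c x" "inj_on (weight_value m c x) (ternary_weights m)"
proof -
  obtain x :: "nat \<Rightarrow> 'a" where x: "\<forall>i\<in>{1..<m}. x i \<noteq> 0"
    and inj: "inj_on (\<lambda>\<epsilon>. \<Prod>i=1..<m. x i powi (2 * \<epsilon> i)) (ternary_weights m)"
    using ex_generic_roots[OF m] by blast
  define P where "P \<epsilon> = (\<Prod>i=1..<m. x i powi (2 * \<epsilon> i))" for \<epsilon> :: "nat \<Rightarrow> int"
  define e where "e i s = (\<lambda>k\<in>{1..<m}. if k = i then s else 0)" for i and s :: int
  have e_tern: "e i s \<in> ternary_weights m" if "s \<in> {-1, 0, 1}" for i s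
    using that by (auto simp: e_def ternary_weights_def)
  have P_e: "P (e i s) = x i powi (2 * s)" if "i \<in> {1..<m}" for i s
  proof -
    have "P (e i s) = (\<Prod>k=1..<m. if k = i then x i powi (2 * s) else 1)"
      unfolding P_def by (intro prod.cong) (auto simp: e_def)
    then show ?thesis using that by simp
  qed
  have sep: "x i powi (2 * s) = x k powi (2 * t) \<Longrightarrow> e i s = e k t"
    if "i \<in> {1..<m}" "k \<in> {1..<m}" "s \<in> {-1, 0, 1}" "t \<in> {-1, 0, 1}" for i k s t
    using inj_onD[OF inj, of "e i s" "e k t"] e_tern that P_e[of i s] P_e[of k t] by (simp add: P_def)
  have e_val: "e i s i = s" "k \<in> {1..<m} \<Longrightarrow> k \<noteq> i \<Longrightarrow> e i s k = 0" if "i \<in> {1..<m}" for i k s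
    using that by (auto simp: e_def)
  have ne: "(1::'a) \<noteq> -1" using eq_minus_self_imp_zero[OF two, of 1] zero_neq_one by metis
  define q where "q = (\<Prod>k<2 * m. [:- root_at x k, 1:])"
  \<comment> \<open>The parameters are the coefficients of \<open>q\<close> above the middle.
    Antipalindromy gives those below, and it makes the middle one zero outside characteristic
    2.\<close>
  define c where "c s = coeff q (m + s)" for s
  have dq: "degree q = 2 * m"
    unfolding q_def by (subst degree_prod_sum_eq) auto
  have lq: "coeff q (2 * m) = 1"
    using monic_prod[of "{..<2 * m}" "\<lambda>k. [:- root_at x k, 1:]"] dq by (simp add: q_def)
  have refl: "reflect_poly q = - q"
  proof -
    have pair: "reflect_poly ([:- x i, 1:] * [:- inverse (x i), 1:]) = [:- x i, 1:] * [:- inverse (x i), 1:]"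
      if "i \<in> {1..<m}" for i
      using x that by (auto simp: reflect_poly_def)
    have "reflect_poly [:-1, 0, 1::'a:] = - [:-1, 0, 1:]" by (simp add: reflect_poly_def)
    then show ?thesis
      unfolding q_def prod_root_factors[OF m] reflect_poly_mult reflect_poly_prod
      by (simp only: mult_minus_left) (metis (no_types, lifting) pair prod.cong reflect_poly_mult)
  qed
  have anti: "coeff q (2 * m - k) = - coeff q k" if "k \<le> 2 * m" for k
    using arg_cong[OF refl, of "\<lambda>p. coeff p k"] that by (simp add: coeff_reflect_poly dq)
  have symb: "symbol_poly m c = q"
  proof (rule poly_eqI)
    fix k
    consider "k < m" | "k = m" | "m < k" "k \<le> 2 * m" | "k > 2 * m" by linarith
    then show "coeff (symbol_poly m c) k = coeff q k"
    proof cases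
      case 1
      then have "m + nat (int m - int k) = 2 * m - k" by simp
      then show ?thesis using 1 anti[of k] by (simp add: coeff_symbol_poly skew_ext_def c_def)
    next
      case 2
      have "coeff q m = - coeff q m" using anti[of m] by simp
      then have "coeff q m = 0" by (rule eq_minus_self_imp_zero[OF two])
      then show ?thesis using 2 by (simp add: coeff_symbol_poly skew_ext_def)
    next
      case 3
      then have "m + nat (int k - int m) = k" by simp
      then show ?thesis using 3 by (simp add: coeff_symbol_poly skew_ext_def c_def)
    next
      case 4
      then show ?thesis by (simp add: coeff_symbol_poly skew_ext_def coeff_eq_0 dq)
    qed
  qed
  have cm: "c m = 1" using lq by (simp add: c_def mult_2)
  have rp: "root_pairs m c x"
    using x unfolding root_pairs_iff[OF m] symb cm q_def by simp
  have sq: "root_at x (2 * i) ^ 2 = x i powi (2 * 1)" "root_at x (Suc (2 * i)) ^ 2 = x i powi (2 * - 1)"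
    if "i \<in> {1..<m}" for i
    using that by (simp_all add: root_at_even root_at_odd power_int_def power_inverse)
  have inj_root: "inj_on (root_at x) {..<2 * m}"
  proof (rule inj_onI)
    fix k l assume kl: "k \<in> {..<2 * m}" "l \<in> {..<2 * m}" and eq: "root_at x k = root_at x l"
    \<comment> \<open>\<open>val k\<close> is the weight of the root with index \<open>k\<close> in
      its own pair, so equal squares of roots turn into equal weights through \<open>sep\<close>.
      The squares of 1 and -1 correspond to the weight 0.\<close>
    define val where "val k = (if k < 2 then 0 else if even k then 1 else -1 :: int)" for k :: nat
    have val: "root_at x k ^ 2 = x (k div 2) powi (2 * val k)" "k div 2 \<in> {1..<m}" "val k \<in> {-1, 1}"
      if "k < 2 * m" "k \<ge> 2" for k
      using that sq[of "k div 2"] by (auto simp: val_def elim!: evenE oddE)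
    have low: "k \<ge> 2 \<Longrightarrow> k < 2 * m \<Longrightarrow> root_at x k ^ 2 \<noteq> 1" for k
    proof
      assume k: "k \<ge> 2" "k < 2 * m" and "root_at x k ^ 2 = 1"
      then have "x (k div 2) powi (2 * val k) = x (k div 2) powi (2 * 0)" using val(1)[of k] by simp
      then have "e (k div 2) (val k) = e (k div 2) 0"
        using sep[of "k div 2" "k div 2" "val k" 0] val(2,3)[OF k(2,1)] by auto
      then have "val k = 0" using e_val(1)[OF val(2)[OF k(2,1)]] by metis
      then show False using val(3)[OF k(2,1)] by auto
    qed
    consider "k < 2" "l < 2" | "k < 2" "l \<ge> 2" | "k \<ge> 2" "l < 2" | "k \<ge> 2" "l \<ge> 2" by linarith
    then show "k = l"
    proof cases
      case 1
      then show ?thesis using eq ne by (auto simp: root_at_def split: if_splits)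
    next
      case 2
      then have "root_at x k ^ 2 = 1" by (auto simp: root_at_def)
      then show ?thesis using low[of l] 2 kl eq by simp
    next
      case 3
      then have "root_at x l ^ 2 = 1" by (auto simp: root_at_def)
      then show ?thesis using low[of k] 3 kl eq by simp
    next
      case 4
      have k: "k < 2 * m" "l < 2 * m" using kl by simp_all
      have "x (k div 2) powi (2 * val k) = x (l div 2) powi (2 * val l)"
        using val(1)[OF k(1) 4(1)] val(1)[OF k(2) 4(2)] eq by simp
      then have ee: "e (k div 2) (val k) = e (l div 2) (val l)"
        using sep[of "k div 2" "l div 2" "val k" "val l"] val(2,3)[OF k(1) 4(1)] val(2,3)[OF k(2) 4(2)] by auto
      note ek = e_val(1)[OF val(2)[OF k(1) 4(1)], of "val k"]
        and el = e_val(1)[OF val(2)[OF k(2) 4(2)], of "val l"]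
      have dd: "k div 2 = l div 2"
      proof (rule ccontr)
        assume ne: "k div 2 \<noteq> l div 2"
        have "val k = e (l div 2) (val l) (k div 2)" unfolding ee[symmetric] ek ..
        also have "\<dots> = 0"
          by (rule e_val(2)[OF val(2)[OF k(2) 4(2)] val(2)[OF k(1) 4(1)] ne])
        finally show False using val(3)[OF k(1) 4(1)] by auto
      qed
      have "val k = e (l div 2) (val l) (k div 2)" unfolding ee[symmetric] ek ..
      also have "\<dots> = val l" unfolding dd by (rule el)
      finally have "val k = val l" .
      then have "even k \<longleftrightarrow> even l" using 4 by (auto simp: val_def split: if_splits)
      then have "k mod 2 = l mod 2" by (simp add: mod2_eq_if)
      moreover have "k = k div 2 * 2 + k mod 2" "l = l div 2 * 2 + l mod 2" by simp_all
      ultimately show ?thesis using dd by simp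
    qed
  qed
  have "{z. poly (symbol_poly m c) z = 0} = root_at x ` {..<2 * m}"
    by (auto simp: symb q_def poly_prod)
  then have "admissible m c"
    using cm by (simp add: admissible_def card_image inj_root)
  with m rp have sk: "skew_symbol m c x" by (simp add: skew_symbol_def)
  have "inj_on (weight_value m c x) (ternary_weights m)"
    using inj by (simp add: inj_on_def weight_value_def cm)
  with sk show thesis using that by blast
qed

lemma generic_minimal_polynomials:
  assumes m: "m \<ge> 1" and two: "(2::'a::alg_closed_field) \<noteq> 0"
  shows "\<exists>U :: (nat \<Rightarrow> 'a::alg_closed_field) set. zariski_open m U \<and> U \<noteq> {} \<and>
      (\<forall>c\<in>U. admissible m c \<and> (\<forall>x. root_pairs m c x \<longrightarrow>
        card (weight_value m c x ` ternary_weights m) = 3 ^ (m - 1)))"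
proof -
  obtain c x :: "nat \<Rightarrow> 'a" where sk: "skew_symbol m c x"
    and inj: "inj_on (weight_value m c x) (ternary_weights m)"
    using ex_generic_symbol[OF m two] by blast
  \<comment> \<open>The Vandermonde matrix of the generic point stays fixed while \<open>b\<close>
    varies. Built from the roots of \<open>b\<close> it would not depend polynomially on
    \<open>b\<close>.\<close>
  define V where "V = skew_symbol.Vm m x"
  have V: "V \<in> carrier_mat (2 * m) (2 * m)" unfolding V_def by (rule skew_symbol.Vm_carrier[OF sk])
  let ?d = "3 ^ (m - 1) :: nat"
  let ?K = "\<lambda>w S b. mat ?d ?d (\<lambda>(i, j). ext_map V (((transfer m b \<circ> transfer m b) ^^ i) w) (S j))"
  obtain w S where w: "w \<in> ext_power (2 * m) m" and K: "det (?K w S c) \<noteq> 0"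
    unfolding V_def by (rule skew_symbol.krylov_generic[OF sk inj])
  \<comment> \<open>The first factor ensures admissibility at \<open>b\<close>, the second that no
    two weights coincide.\<close>
  define f where "f b = det (sylvester_symbol m b) * det (?K w S b)" for b
  have "f \<in> polyfrac m"
    unfolding f_def
    by (intro polyfrac_mult[OF m] polyfrac_det_sylvester[OF m] polyfrac_det[OF m]
        polyfrac_ext_map[OF m V] polyfrac_const polyfrac_transfer_power[OF m])
  then have "zariski_open m {b. b m \<noteq> 0 \<and> f b \<noteq> 0}" by (rule polyfrac_nonzero_open[OF m])
  moreover have "c \<in> {b. b m \<noteq> 0 \<and> f b \<noteq> 0}"
    using skew_symbol.am[OF sk] K det_sylvester_if_admissible[OF m] skew_symbol.adm[OF sk]
    by (auto simp: f_def)
  moreover have "admissible m b \<and> (\<forall>y. root_pairs m b y \<longrightarrow>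
      card (weight_value m b y ` ternary_weights m) = 3 ^ (m - 1))"
    if b: "b \<in> {b. b m \<noteq> 0 \<and> f b \<noteq> 0}" for b
  proof (intro conjI allI impI)
    show adm: "admissible m b"
      using b by (intro admissible_if_det_sylvester[OF m]) (auto simp: f_def)
    fix y assume "root_pairs m b y"
    with adm m have sk': "skew_symbol m b y" by (simp add: skew_symbol_def)
    have "\<not> card (weight_value m b y ` ternary_weights m) < ?d"
      using skew_symbol.krylov_degenerate[OF sk' w _ V, of ?d S] b by (auto simp: f_def)
    moreover have "card (weight_value m b y ` ternary_weights m) \<le> ?d"
      using card_image_le[OF finite_ternary] card_ternary by metis
    ultimately show "card (weight_value m b y ` ternary_weights m) = 3 ^ (m - 1)" by simp
  qed
  ultimately show ?thesis by (intro exI[of _ "{b. b m \<noteq> 0 \<and> f b \<noteq> 0}"]) blast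
qed


section \<open>Assembly of the three claims\<close>

lemma ball_pairI: "P a \<Longrightarrow> P b \<Longrightarrow> \<forall>H\<in>{a, b}. P H"
  by simp

text \<open>The second conclusion keeps the exact degree of the minimal polynomial on each half,
  which becomes \<open>3 ^ (m - 1)\<close> at generic parameters.\<close>

lemma hodge_decomposition:
  fixes b :: "nat \<Rightarrow> 'a::alg_closed_field"
  assumes "m \<ge> 1" "admissible m b" "root_pairs m b x" "hodge_data m b G vol" "\<iota> ^ 2 = -1"
    and T: "T = transfer m b"
    and Hp: "Hp = hodge_eigenspace m G vol (\<iota> ^ m)" and Hm: "Hm = hodge_eigenspace m G vol (- (\<iota> ^ m))"
  shows "(\<forall>\<gamma>\<in>ext_power (2*m) m. \<exists>!\<delta>. is_hodge_dual m G vol \<gamma> \<delta>) \<and>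
    (\<forall>\<gamma>\<in>ext_power (2*m) m.
       hodge_star m G vol (hodge_star m G vol \<gamma>) = scale_fun ((-1) ^ m) \<gamma>) \<and>
    is_direct_sum (ext_power (2*m) m) Hp Hm \<and>
    real (fun_dim Hp) = 1/2 * real (2*m choose m) \<and>
    real (fun_dim Hm) = 1/2 * real (2*m choose m) \<and>
    T ` Hp = Hm \<and> T ` Hm = Hp \<and>
    (\<forall>H\<in>{Hp, Hm}.
       (T \<circ> T) ` H \<subseteq> H \<and>
       {l. \<exists>\<omega>\<in>H. \<omega> \<noteq> 0 \<and> T (T \<omega>) = scale_fun l \<omega>}
         = weight_value m b x ` ternary_weights m \<and>
       (\<forall>\<epsilon>\<in>ternary_weights m.
          (\<forall>\<omega>\<in>H \<inter> weight_space m b x \<epsilon>.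
             T (T \<omega>) = scale_fun (weight_value m b x \<epsilon>) \<omega>) \<and>
          fun_dim (H \<inter> weight_space m b x \<epsilon>) = weight_mult m \<epsilon>) \<and>
       (inj_on (weight_value m b x) (ternary_weights m) \<longrightarrow>
         (\<forall>\<epsilon>\<in>ternary_weights m.
            fun_dim {\<omega>\<in>H. T (T \<omega>) = scale_fun (weight_value m b x \<epsilon>) \<omega>}
              = weight_mult m \<epsilon>)) \<and>
       (\<exists>p. is_min_poly_on p (T \<circ> T) H \<and> degree p \<le> 3 ^ (m - 1)))"
      (is "?unique \<and> ?square \<and> ?sum \<and> ?dim1 \<and> ?dim2 \<and> ?T1 \<and> ?T2 \<and> (\<forall>H\<in>_. ?P H)")
    and "\<forall>H\<in>{Hp, Hm}. \<exists>p. is_min_poly_on p (T \<circ> T) H \<and>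
      degree p = card (weight_value m b x ` ternary_weights m)"
proof -
  interpret skew_hodge m b x G vol
    using assms by unfold_locales auto
  have c: "\<iota> ^ m * \<iota> ^ m = (-1) ^ m" "- (\<iota> ^ m) * - (\<iota> ^ m) = (-1) ^ m"
    using assms(5) by (simp_all add: power2_eq_square flip: power_mult_distrib)
  note hp = hodge_half[OF c(1) Hp T] and hm = hodge_half[OF c(2) Hm T]
  have ?unique
  proof
    fix \<gamma> :: "nat set \<Rightarrow> 'a" assume "\<gamma> \<in> E"
    then show "\<exists>!\<delta>. is_hodge_dual m G vol \<gamma> \<delta>" by (simp add: dual_iff)
  qed
  moreover have ?square using hodge_star_star by blast
  moreover have ?sum
    unfolding Hp Hm hodge_eigenspace_eq by (rule direct_sum_Hc[OF c(1)])
  moreover have ?T1 ?T2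
    using transfer_Hc[of "\<iota> ^ m"] transfer_Hc[of "- (\<iota> ^ m)"]
    by (simp_all add: T Hp Hm hodge_eigenspace_eq)
  moreover have "card (weight_value m b x ` ternary_weights m) \<le> 3 ^ (m - 1)"
    using card_image_le[OF finite_ternary] card_ternary by metis
  then have "?P Hp" "?P Hm"
    using hp(7) hm(7) by (intro conjI ballI impI hp(2-6) hm(2-6); (assumption | auto))+
  then have "\<forall>H\<in>{Hp, Hm}. ?P H"
    by (intro ball_pairI)
  ultimately show "?unique \<and> ?square \<and> ?sum \<and> ?dim1 \<and> ?dim2 \<and> ?T1 \<and> ?T2 \<and> (\<forall>H\<in>{Hp, Hm}. ?P H)"
    using hp(1) hm(1) by (intro conjI)
  show "\<forall>H\<in>{Hp, Hm}. \<exists>p. is_min_poly_on p (T \<circ> T) H \<and>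
      degree p = card (weight_value m b x ` ternary_weights m)"
    using hp(7) hm(7) by blast
qed

theorem theorem3p12:
  fixes m :: nat and a :: "nat \<Rightarrow> 'k::field"
  assumes "m \<ge> 1" and "CHAR('k) \<noteq> 2"
  shows
   "(\<forall>n\<ge>m.
      (\<forall>j\<le>m. \<forall>A B. A \<subseteq> {1..m} \<and> B \<subseteq> {1..m} \<and> card A = j \<and> card B = j \<longrightarrow>
         toeplitz_minor m n B A a = (-1) ^ (n - j) * toeplitz_minor m n A B a) \<and>
      (\<forall>j\<le>m.
         real (fun_dim (fun_span (level_minors m n j :: ((nat \<Rightarrow> 'k) \<Rightarrow> 'k) set)))
           \<le> level_bound m n j \<and>
         real (fun_dim (fun_span
             (level_minors m n j :: ((nat \<Rightarrow> 'k alg_closure) \<Rightarrow> 'k alg_closure) set)))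
           \<le> level_bound m n j) \<and>
      (\<Sum>j=0..m. level_bound m n j) = 1/2 * real (2*m choose m))
    \<and>
    (let b = (\<lambda>i. to_ac (a i)) in admissible m b \<longrightarrow>
      (\<exists>x. root_pairs m b x) \<and>
      (\<exists>G vol. hodge_data m b G vol) \<and>
      (\<forall>x G vol \<iota>. root_pairs m b x \<and> hodge_data m b G vol \<and> \<iota> ^ 2 = -1 \<longrightarrow>
        (let T = transfer m b;
             Hp = hodge_eigenspace m G vol (\<iota> ^ m);
             Hm = hodge_eigenspace m G vol (- (\<iota> ^ m))
         in
          (\<forall>\<gamma>\<in>ext_power (2*m) m. \<exists>!\<delta>. is_hodge_dual m G vol \<gamma> \<delta>) \<and>
          (\<forall>\<gamma>\<in>ext_power (2*m) m.
             hodge_star m G vol (hodge_star m G vol \<gamma>) = scale_fun ((-1) ^ m) \<gamma>) \<and>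
          is_direct_sum (ext_power (2*m) m) Hp Hm \<and>
          real (fun_dim Hp) = 1/2 * real (2*m choose m) \<and>
          real (fun_dim Hm) = 1/2 * real (2*m choose m) \<and>
          T ` Hp = Hm \<and> T ` Hm = Hp \<and>
          (\<forall>H\<in>{Hp, Hm}.
             (T \<circ> T) ` H \<subseteq> H \<and>
             {l. \<exists>\<omega>\<in>H. \<omega> \<noteq> 0 \<and> T (T \<omega>) = scale_fun l \<omega>}
               = weight_value m b x ` ternary_weights m \<and>
             (\<forall>\<epsilon>\<in>ternary_weights m.
                (\<forall>\<omega>\<in>H \<inter> weight_space m b x \<epsilon>.
                   T (T \<omega>) = scale_fun (weight_value m b x \<epsilon>) \<omega>) \<and>
                fun_dim (H \<inter> weight_space m b x \<epsilon>) = weight_mult m \<epsilon>) \<and>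
             (inj_on (weight_value m b x) (ternary_weights m) \<longrightarrow>
               (\<forall>\<epsilon>\<in>ternary_weights m.
                  fun_dim {\<omega>\<in>H. T (T \<omega>) = scale_fun (weight_value m b x \<epsilon>) \<omega>}
                    = weight_mult m \<epsilon>)) \<and>
             (\<exists>p. is_min_poly_on p (T \<circ> T) H \<and> degree p \<le> 3 ^ (m - 1))))) \<and>
      (\<exists>p. p \<noteq> 0 \<and> degree p \<le> 2 * 3 ^ (m - 1) \<and>
           annihilates_on p (transfer m b) (ext_power (2*m) m)))
    \<and>
    (\<exists>U :: (nat \<Rightarrow> 'k alg_closure) set. zariski_open m U \<and> U \<noteq> {} \<and>
      (\<forall>c\<in>U. admissible m c \<and>
        (\<forall>G vol \<iota>. hodge_data m c G vol \<and> \<iota> ^ 2 = -1 \<longrightarrow>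
          (\<forall>H\<in>{hodge_eigenspace m G vol (\<iota> ^ m), hodge_eigenspace m G vol (- (\<iota> ^ m))}.
             \<exists>p. is_min_poly_on p (transfer m c \<circ> transfer m c) H \<and> degree p = 3 ^ (m - 1))) \<and>
        (\<exists>p. is_min_poly_on p (transfer m c) (ext_power (2*m) m) \<and>
             degree p = 2 * 3 ^ (m - 1))))"
proof -
  \<comment> \<open>The arguments about signs use \<open>2 \<noteq> 0\<close>. A characteristic
    dividing 2 would be 1 or 2, and 1 is impossible in a field.\<close>
  have two: "(2::'k) \<noteq> 0"
  proof
    assume "(2::'k) = 0"
    then have "CHAR('k) dvd 2" by (metis of_nat_eq_0_iff_char_dvd of_nat_numeral)
    then have "CHAR('k) = 1 \<or> CHAR('k) = 2" by (meson two_is_prime_nat prime_nat_iff)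
    then show False using assms(2) CHAR_not_1'[where 'a = 'k] by auto
  qed
  have two': "(2::'k alg_closure) \<noteq> 0"
    using two by (metis to_ac_numeral to_ac_eq_0_iff)
  note m = assms(1)
  let ?b = "\<lambda>i. to_ac (a i)"
  obtain U :: "(nat \<Rightarrow> 'k alg_closure) set" where U: "zariski_open m U" "U \<noteq> {}"
    "\<And>c. c \<in> U \<Longrightarrow> admissible m c"
    "\<And>c x. c \<in> U \<Longrightarrow> root_pairs m c x \<Longrightarrow> card (weight_value m c x ` ternary_weights m) = 3 ^ (m - 1)"
    using generic_minimal_polynomials[OF m two'] by blast
  have card_le: "card (weight_value m c x ` ternary_weights m) \<le> 3 ^ (m - 1)"
    for c x :: "nat \<Rightarrow> 'k alg_closure"
    using card_image_le[OF finite_ternary] card_ternary by metis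
  show ?thesis
    unfolding Let_def
  proof (intro conjI impI, goal_cases)
    case 1
    show ?case
      by (intro allI impI conjI; (elim conjE)?; rule toeplitz_minor_swap fun_dim_level_minors[OF two]
          fun_dim_level_minors[OF two'] sum_level_bound[OF m]; assumption)
  next
    case 2
    then show ?case by (rule ex_root_pairs[OF m two'])
  next
    case 3
    then obtain y where "root_pairs m ?b y" using ex_root_pairs[OF m two'] by blast
    with 3 m have "skew_symbol m ?b y" by unfold_locales
    then show ?case by (rule skew_symbol.ex_hodge_data)
  next
    case 4
    show ?case
      by (intro allI impI, elim conjE, rule hodge_decomposition(1)[OF m 4 _ _ _ refl refl refl])
  next
    case 5
    then obtain y where "root_pairs m ?b y" using ex_root_pairs[OF m two'] by blast
    with 5 m have "skew_symbol m ?b y" by unfold_locales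
    then obtain p where p: "is_min_poly_on p (transfer m ?b) (ext_power (2 * m) m)"
      "degree p = 2 * card (weight_value m ?b y ` ternary_weights m)"
      by (rule skew_symbol.transfer_min_poly)
    have "p \<noteq> 0" "annihilates_on p (transfer m ?b) (ext_power (2 * m) m)"
      using p(1) by (auto simp: is_min_poly_on_def)
    then show ?case
      using p(2) card_le[of ?b y] by (intro exI[of _ p]) simp
  next
    case 6
    have "(\<forall>G vol \<iota>. hodge_data m c G vol \<and> \<iota> ^ 2 = -1 \<longrightarrow>
          (\<forall>H\<in>{hodge_eigenspace m G vol (\<iota> ^ m), hodge_eigenspace m G vol (- (\<iota> ^ m))}.
             \<exists>p. is_min_poly_on p (transfer m c \<circ> transfer m c) H \<and> degree p = 3 ^ (m - 1))) \<and>
        (\<exists>p. is_min_poly_on p (transfer m c) (ext_power (2*m) m) \<and>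
             degree p = 2 * 3 ^ (m - 1))" if c: "c \<in> U" for c
    proof -
      note adm = U(3)[OF c]
      obtain y where y: "root_pairs m c y" using ex_root_pairs[OF m two' adm] by blast
      note card = U(4)[OF c y]
      have "skew_symbol m c y" using adm m y by unfold_locales
      then obtain p where "is_min_poly_on p (transfer m c) (ext_power (2 * m) m)"
        "degree p = 2 * card (weight_value m c y ` ternary_weights m)"
        by (rule skew_symbol.transfer_min_poly)
      moreover have "\<forall>H\<in>{hodge_eigenspace m G vol (\<iota> ^ m), hodge_eigenspace m G vol (- (\<iota> ^ m))}.
             \<exists>p. is_min_poly_on p (transfer m c \<circ> transfer m c) H \<and> degree p = 3 ^ (m - 1)"
        if "hodge_data m c G vol" "\<iota> ^ 2 = -1" for G vol \<iota>
        using hodge_decomposition(2)[OF m adm y that refl refl refl] unfolding card .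
      ultimately show ?thesis using card by auto
    qed
    with U(1-3) show ?case by (intro exI[of _ U]) blast
  qed
qed

end
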